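(* Let $N\in\mathbb{F}_q(t^p)[Y]$ be monic, irreducible and separable over $\mathbb{F}_q(t^p)$, let $\nu\in\mathbb{N}$, and let $L\in\mathbb{F}_q(t)\langle\partial\rangle$ be a monic (leading coefficient $1$) right divisor of $N(\partial^p)^\nu$. (1) If $N(\partial^p)$ is irreducible in $\mathbb{F}_q(t)\langle\partial\rangle$, then $L=N(\partial^p)^m$ for some $m\le\nu$, and $L$ is indecomposable. (2) Otherwise, let $N^{\nu_1}\mid N^{\nu_2}\mid\cdots\mid N^{\nu_k}$ be the Frobenius invariants of $\psi_p^L$. Then there exist $L_1,\dots,L_k\in\mathbb{F}_q(t)\langle\partial\rangle$ such that (i) $L=\mathrm{LCLM}(L_1,\dots,L_k)$ and $\operatorname{ord}L=\sum_{i=1}^k\operatorname{ord}L_i$; (ii) $\operatorname{ord}L_i=\nu_i\deg N$ for all $i$; (iii) each $L_i$ is indecomposable.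
   Context: Let $p$ be a prime, $q=p^n$. $\mathbb{F}_q(t)\langle\partial\rangle$ is the ring of linear differential operators with coefficients in $\mathbb{F}_q(t)$, multiplication given by $\partial f=f\partial+\frac{df}{dt}$; $\operatorname{ord}$ is the order in $\partial$. $\mathrm{LCLM}(L_1,\dots,L_k)$ generates $\bigcap_i\mathbb{F}_q(t)\langle\partial\rangle L_i$ and $\mathrm{GCRD}(L_1,L_2)$ generates $\mathbb{F}_q(t)\langle\partial\rangle L_1+\mathbb{F}_q(t)\langle\partial\rangle L_2$ (up to left multiplication by nonzero elements of $\mathbb{F}_q(t)$); $L_1,L_2$ are coprime if their GCRD is $1$. $L$ is decomposable if $L=\mathrm{LCLM}(L_1,L_2)$ for some coprime $L_1,L_2$ of positive order, and indecomposable otherwise. $\mathcal{D}_L:=\mathbb{F}_q(t)\langle\partial\rangle/\mathbb{F}_q(t)\langle\partial\rangle L$. The $p$-curvature $\psi_p^L$ is the $\mathbb{F}_q(t)$-linear endomorphism of $\mathcal{D}_L$ given by left multiplication by $\partial^p$. The Frobenius invariants of an endomorphism $\psi$ of a finite-dimensional vector space $V$ are its nonconstant monic invariant factors $P_1\mid\cdots\mid P_m$, i.e. $V\simeq\bigoplus_i \mathbb{F}_q(t)[Y]/(P_i)$ as $\mathbb{F}_q(t)[Y]$-modules with $Y$ acting by $\psi$; for $\psi_p^L$ they lie in $\mathbb{F}_q(t^p)[Y]$. For $P\in\mathbb{F}_q(t^p)[Y]$, $P(\partial^p)$ is the (central) operator obtained by substituting $\partial^p$ for $Y$. *)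

theory Defs
  imports "HOL-Computational_Algebra.Computational_Algebra"
begin

type_synonym 'a ratfun = "'a poly fract"

definition ddt :: "'a::{finite,field} ratfun \<Rightarrow> 'a ratfun" where
  "ddt x = (SOME y. \<forall>a b. b \<noteq> 0 \<longrightarrow> x = Fract a b \<longrightarrow>
              y = Fract (pderiv a * b - a * pderiv b) (b * b))"

text \<open>Embedding of F_q(s) into F_q(t) by s \<mapsto> t^p, identifying F_q(s) with F_q(t^p).\<close>
definition frob_emb :: "'a::{finite,field} ratfun \<Rightarrow> 'a ratfun" where
  "frob_emb x = (SOME y. \<forall>a b. b \<noteq> 0 \<longrightarrow> x = Fract a b \<longrightarrow>
              y = Fract (pcompose a (monom 1 CHAR('a))) (pcompose b (monom 1 CHAR('a))))"

text \<open>Differential operators: an operator \<Sum> a_i \<partial>^i is represented by the polynomial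
  with coefficients a_i (the variable being \<partial>).  Addition and left multiplication by
  elements of F_q(t) (smult) are the polynomial ones; the product is the Ore product
  with \<partial> f = f \<partial> + f'.\<close>
type_synonym 'a diffop = "'a ratfun poly"

definition dleft :: "'a::{finite,field} diffop \<Rightarrow> 'a diffop" where
  "dleft B = pCons 0 B + map_poly ddt B"

definition op_mult :: "'a::{finite,field} diffop \<Rightarrow> 'a diffop \<Rightarrow> 'a diffop" (infixl "\<odot>" 70) where
  "A \<odot> B = (\<Sum>i\<le>degree A. smult (coeff A i) ((dleft ^^ i) B))"

definition op_pow :: "'a::{finite,field} diffop \<Rightarrow> nat \<Rightarrow> 'a diffop" where
  "op_pow A m = ((\<lambda>B. A \<odot> B) ^^ m) 1"

definition op_ord :: "'a::{finite,field} diffop \<Rightarrow> nat" where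
  "op_ord A = degree A"

definition partial :: "'a::{finite,field} diffop" where
  "partial = [:0, 1:]"

definition subst_dp :: "'a::{finite,field} ratfun poly \<Rightarrow> 'a diffop" where
  "subst_dp P = (\<Sum>k\<le>degree P. smult (coeff P k) (op_pow partial (k * CHAR('a))))"

definition right_divides :: "'a::{finite,field} diffop \<Rightarrow> 'a diffop \<Rightarrow> bool" where
  "right_divides L M \<longleftrightarrow> (\<exists>Q. M = Q \<odot> L)"

text \<open>L generates the left ideal \<Inter>_i R L_i, i.e. L = LCLM(Ls) up to a left unit.\<close>
definition is_lclm :: "'a::{finite,field} diffop \<Rightarrow> 'a diffop list \<Rightarrow> bool" where
  "is_lclm L Ls \<longleftrightarrow> (\<forall>M. right_divides L M \<longleftrightarrow> (\<forall>Li\<in>set Ls. right_divides Li M))"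

definition op_coprime :: "'a::{finite,field} diffop \<Rightarrow> 'a diffop \<Rightarrow> bool" where
  "op_coprime L1 L2 \<longleftrightarrow> (\<exists>A B. A \<odot> L1 + B \<odot> L2 = 1)"

definition decomposable :: "'a::{finite,field} diffop \<Rightarrow> bool" where
  "decomposable L \<longleftrightarrow> (\<exists>L1 L2. op_coprime L1 L2 \<and> op_ord L1 > 0 \<and> op_ord L2 > 0
                                  \<and> is_lclm L [L1, L2])"

definition indecomposable :: "'a::{finite,field} diffop \<Rightarrow> bool" where
  "indecomposable L \<longleftrightarrow> \<not> decomposable L"

text \<open>Irreducible element of the ring F_q(t)<\<partial>> (units are the nonzero operators of order 0).\<close>
definition op_irreducible :: "'a::{finite,field} diffop \<Rightarrow> bool" where
  "op_irreducible L \<longleftrightarrow> L \<noteq> 0 \<and> op_ord L > 0 \<and>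
     (\<forall>A B. L = A \<odot> B \<longrightarrow> op_ord A = 0 \<or> op_ord B = 0)"

text \<open>Right remainder of M modulo L; D_L is represented by the remainders
  (operators of order < ord L).\<close>
definition op_rmod :: "'a::{finite,field} diffop \<Rightarrow> 'a diffop \<Rightarrow> 'a diffop" where
  "op_rmod M L = (SOME R. (\<exists>Q. M = Q \<odot> L + R) \<and> (R = 0 \<or> degree R < degree L))"

definition DL :: "'a::{finite,field} diffop \<Rightarrow> 'a diffop set" where
  "DL L = {R. R = 0 \<or> degree R < degree L}"

definition pcurv :: "'a::{finite,field} diffop \<Rightarrow> 'a diffop \<Rightarrow> 'a diffop" where
  "pcurv L v = op_rmod (op_pow partial CHAR('a) \<odot> v) L"

definition poly_act :: "'a::{finite,field} diffop \<Rightarrow> 'a ratfun poly \<Rightarrow> 'a diffop \<Rightarrow> 'a diffop" where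
  "poly_act L P v = (\<Sum>k\<le>degree P. smult (coeff P k) ((pcurv L ^^ k) v))"

text \<open>Ps = [P_1,...,P_m] are the Frobenius invariants of \<psi>_p^L: nonconstant monic,
  P_1 | ... | P_m, and D_L = \<oplus> F_q(t)[Y] v_i with v_i annihilated exactly by P_i,
  i.e. the vectors \<psi>^j v_i (i < m, j < deg P_i) form a basis of D_L and P_i(\<psi>) v_i = 0.\<close>
definition frobenius_invariants :: "'a::{finite,field} diffop \<Rightarrow> 'a ratfun poly list \<Rightarrow> bool" where
  "frobenius_invariants L Ps \<longleftrightarrow>
     (\<forall>P\<in>set Ps. lead_coeff P = 1 \<and> degree P > 0) \<and>
     (\<forall>i. Suc i < length Ps \<longrightarrow> Ps ! i dvd Ps ! Suc i) \<and>
     (\<exists>vs. length vs = length Ps \<and>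
        (\<forall>i<length Ps. vs ! i \<in> DL L \<and> poly_act L (Ps ! i) (vs ! i) = 0) \<and>
        (\<forall>w\<in>DL L. \<exists>!c :: nat \<Rightarrow> nat \<Rightarrow> 'a ratfun.
            (\<forall>i j. \<not> (i < length Ps \<and> j < degree (Ps ! i)) \<longrightarrow> c i j = 0) \<and>
            w = (\<Sum>i<length Ps. \<Sum>j<degree (Ps ! i). smult (c i j) ((pcurv L ^^ j) (vs ! i)))))"

end

theory Submission
  imports Defs
begin

text \<open>
  Write K = F_q(t), R for the ring of operators, and n for the central operator N(\<partial>^p), of order
  p * deg N; N stays irreducible over K because it is separable.
  If n is irreducible, the left ideal R n is maximal, so a right divisor of n^\<nu> is either a left
  multiple of n, which can be cancelled, or coprime to n and then a right divisor of n^(\<nu> - 1).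

  Otherwise let l be a right divisor of n of minimal positive order. Since R/Rn is a simple ring, it
  is a direct sum of copies of R/Rl, so ord l divides p * deg N; as R/Rl is a vector space over
  K[Y]/(N), ord l is a multiple of deg N, and since p is prime ord l = deg N. Hence R/Rl is spanned by
  K[\<partial>^p], so some \<nabla> = \<partial> - f(\<partial>^p) lies in R l, and \<nabla>^p, being central, lies in R n. Hensel
  lifting improves f until \<nabla>^p lies in R n^\<nu>. By Cartier's theorem, R/RL is then generated over K by
  the elements killed by \<nabla>; each of them spans over K[\<partial>^p] an R-submodule. By an exchange argument
  the generators given by the Frobenius invariants can be replaced one at a time, with the same
  annihilators, by elements killed by \<nabla>. The L_i are the annihilators of the components of 1; L_i is
  indecomposable because a proper right divisor has order less than \<nu>_i * deg N and therefore
  divides n^(\<nu>_i - 1), which L_i does not.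
\<close>

subsection \<open>Derivation and Frobenius on rational functions\<close>

text \<open>The Frobenius invariants split R/RL only over K[\<partial>^p], and K[\<partial>^p] v is
  in general not stable under \<partial>. If \<nabla> w = 0, however, then \<partial> w =
  f(\<partial>^p) w, so K[\<partial>^p] w is an R-submodule; this is why \<nabla> is constructed.
  Its f exists because order deg N makes R/Rl a line over the field K[Y]/(N), where \<partial> sends
  the class of 1 to a multiple f(\<partial>^p). The power \<nabla>^p is central because \<nabla> and
  \<partial> have the same commutators with K; a central element is a polynomial in \<partial>^p,
  and it kills the class of 1 in R/Rl only if N divides it, which leads from R l to R n. For the
  lifting, let \<nabla>^p = g n^a with g central. Replacing \<nabla> by \<nabla> - n^a u changes
  \<nabla>^p to first order by -n^a (ad \<nabla>)^(p-1)(u). On K g the operator ad \<nabla>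
  differentiates the coefficient, so u = t^(p-1)/(p-1)! g cancels the error. The exchange argument
  rests on polynomials prime to N being units modulo every power of N.\<close>

lemma CHAR_prime_ff: "prime CHAR('a::{finite,field})"
  by (rule prime_CHAR_semidom, rule finite_imp_CHAR_pos) simp

lemma CHAR_pos_ff: "CHAR('a::{finite,field}) > 0"
  using CHAR_prime_ff prime_gt_0_nat by blast

text \<open>The \<open>SOME\<close> in \<open>ddt\<close> asks for one value fitting every
  representation of the fraction, so the point is that the quotient rule is independent of the
  representation: differentiate a * d = c * b.\<close>

lemma ddt_Fract:
  fixes a b :: "'a::{finite,field} poly"
  assumes "b \<noteq> 0"
  shows "ddt (Fract a b) = Fract (pderiv a * b - a * pderiv b) (b * b)"
  unfolding ddt_def
proof (rule some_equality)
  show "\<forall>c d. d \<noteq> 0 \<longrightarrow> Fract a b = Fract c d \<longrightarrow>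
     Fract (pderiv a * b - a * pderiv b) (b * b) = Fract (pderiv c * d - c * pderiv d) (d * d)"
  proof (intro allI impI)
    fix c d assume d: "d \<noteq> 0" and "Fract a b = Fract c d"
    with assms have e: "a * d = c * b" by (simp add: eq_fract)
    have "pderiv (a * d) = pderiv (c * b)" using e by simp
    then have e': "a * pderiv d + d * pderiv a = c * pderiv b + b * pderiv c"
      by (simp add: pderiv_mult)
    have "(pderiv a * b - a * pderiv b) * (d * d) = (pderiv c * d - c * pderiv d) * (b * b)"
      using e e' by algebra
    then show "Fract (pderiv a * b - a * pderiv b) (b * b) = Fract (pderiv c * d - c * pderiv d) (d * d)"
      using assms d by (simp add: eq_fract)
  qed
qed (use assms in blast)

lemma frob_emb_Fract:
  fixes a b :: "'a::{finite,field} poly"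
  assumes "b \<noteq> 0"
  shows "frob_emb (Fract a b)
    = Fract (pcompose a (monom 1 CHAR('a))) (pcompose b (monom 1 CHAR('a)))"
  unfolding frob_emb_def
proof (rule some_equality)
  show "\<forall>c d. d \<noteq> 0 \<longrightarrow> Fract a b = Fract c d \<longrightarrow>
     Fract (pcompose a (monom 1 CHAR('a))) (pcompose b (monom 1 CHAR('a)))
       = Fract (pcompose c (monom 1 CHAR('a))) (pcompose d (monom 1 CHAR('a)))"
  proof (intro allI impI)
    fix c d :: "'a poly"
    assume d: "d \<noteq> 0" and "Fract a b = Fract c d"
    with assms have e: "a * d = c * b" by (simp add: eq_fract)
    have pos: "degree (monom (1::'a) CHAR('a)) > 0" by (simp add: degree_monom_eq CHAR_pos_ff)
    have "pcompose b (monom 1 CHAR('a)) \<noteq> 0" "pcompose d (monom 1 CHAR('a)) \<noteq> 0"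
      using assms d pos pcompose_eq_0 by blast+
    moreover have "pcompose (a * d) (monom 1 CHAR('a)) = pcompose (c * b) (monom 1 CHAR('a))"
      using e by simp
    ultimately show "Fract (pcompose a (monom 1 CHAR('a))) (pcompose b (monom 1 CHAR('a)))
       = Fract (pcompose c (monom 1 CHAR('a))) (pcompose d (monom 1 CHAR('a)))"
      by (simp add: eq_fract pcompose_mult)
  qed
qed (use assms in blast)

lemma pcompose_monom_CHAR_nonzero:
  "b \<noteq> 0 \<Longrightarrow> pcompose b (monom 1 CHAR('a)) \<noteq> (0 :: 'a::{finite,field} poly)"
  using pcompose_eq_0[of b "monom 1 CHAR('a)"] by (auto simp: degree_monom_eq CHAR_pos_ff)

lemma ddt_add [simp]: "ddt (x + y) = ddt x + ddt y"
proof (cases x, cases y)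
  fix a b c d :: "'a poly"
  assume x: "x = Fract a b" "b \<noteq> 0" and y: "y = Fract c d" "d \<noteq> 0"
  then show ?thesis
    by (simp add: ddt_Fract eq_fract pderiv_mult pderiv_add algebra_simps)
qed

lemma ddt_mult: "ddt (x * y) = x * ddt y + ddt x * y"
proof (cases x, cases y)
  fix a b c d :: "'a poly"
  assume x: "x = Fract a b" "b \<noteq> 0" and y: "y = Fract c d" "d \<noteq> 0"
  then show ?thesis
    by (simp add: ddt_Fract eq_fract pderiv_mult pderiv_add algebra_simps)
qed

lemma ddt_0 [simp]: "ddt 0 = 0"
  by (metis ddt_add add_cancel_right_right)

lemma ddt_1 [simp]: "ddt 1 = 0"
  by (metis ddt_mult add_cancel_right_right mult_1 mult_1_right)

lemma ddt_sum: "ddt (sum f A) = (\<Sum>i\<in>A. ddt (f i))"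
  by (induction A rule: infinite_finite_induct) simp_all

lemma frob_emb_add [simp]: "frob_emb (x + y) = frob_emb x + frob_emb y"
proof (cases x, cases y)
  fix a b c d :: "'a poly"
  assume x: "x = Fract a b" "b \<noteq> 0" and y: "y = Fract c d" "d \<noteq> 0"
  then show ?thesis
    by (simp add: frob_emb_Fract pcompose_mult pcompose_add pcompose_monom_CHAR_nonzero)
qed

lemma frob_emb_mult [simp]: "frob_emb (x * y) = frob_emb x * frob_emb y"
proof (cases x, cases y)
  fix a b c d :: "'a poly"
  assume x: "x = Fract a b" "b \<noteq> 0" and y: "y = Fract c d" "d \<noteq> 0"
  then show ?thesis
    by (simp add: frob_emb_Fract pcompose_mult)
qed

lemma frob_emb_1 [simp]: "frob_emb 1 = 1"
  by (simp add: One_fract_def frob_emb_Fract pcompose_1)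

lemma frob_emb_0 [simp]: "frob_emb 0 = 0"
  by (metis frob_emb_add add_cancel_right_right)

lemma frob_emb_eq_0_iff [simp]: "frob_emb x = 0 \<longleftrightarrow> x = 0"
proof
  assume "frob_emb x = 0"
  then have "\<not> frob_emb (x * inverse x) = 1" by simp
  then show "x = 0" by (cases "x = 0") (simp_all del: frob_emb_mult)
qed simp

lemma frob_emb_minus [simp]: "frob_emb (- x) = - frob_emb x"
  using frob_emb_add[of x "- x"] by (simp add: eq_neg_iff_add_eq_0 add.commute)

lemma frob_emb_inj: "frob_emb x = frob_emb y \<Longrightarrow> x = y"
  using frob_emb_eq_0_iff[of "x - y"] frob_emb_add[of x "- y"] by simp

lemma pderiv_pcompose_monom_CHAR:
  "pderiv (pcompose a (monom 1 CHAR('a))) = (0 :: 'a::{finite,field} poly)"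
proof -
  have "pderiv (monom (1::'a) CHAR('a)) = 0"
    by (simp add: pderiv_monom)
  then show ?thesis by (simp add: pderiv_pcompose)
qed

lemma ddt_frob_emb [simp]: "ddt (frob_emb x) = 0"
  by (cases x) (simp add: frob_emb_Fract ddt_Fract pderiv_pcompose_monom_CHAR
      pcompose_monom_CHAR_nonzero fract_collapse)

text \<open>From k * a_k = 0 the coefficient a_k vanishes unless p divides k; \<open>c\<close>
  collects the others.\<close>

lemma pderiv_eq_0_imp_pcompose:
  fixes a :: "'a::{finite,field} poly"
  assumes "pderiv a = 0"
  obtains c where "a = pcompose c (monom 1 CHAR('a))"
proof -
  define p where "p = CHAR('a)"
  have p: "p > 0" by (simp add: p_def CHAR_pos_ff)
  have z: "coeff a k = 0" if "\<not> p dvd k" for k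
  proof (cases k)
    case (Suc j)
    have "of_nat (Suc j) * coeff a (Suc j) = 0"
      using assms coeff_pderiv[of a j] by simp
    moreover have "of_nat (Suc j) \<noteq> (0::'a)"
      using that Suc by (metis of_nat_eq_0_iff_char_dvd p_def)
    ultimately show ?thesis using Suc by (metis mult_eq_0_iff)
  qed (use that in simp)
  define c where "c = Abs_poly (\<lambda>k. coeff a (p * k))"
  have "coeff c = (\<lambda>k. coeff a (p * k))"
    unfolding c_def
  proof (rule Abs_poly_inverse, simp add: MOST_nat, intro exI allI impI)
    fix m assume "m > degree a"
    moreover have "m \<le> p * m" using p by simp
    ultimately have "p * m > degree a" by linarith
    then show "coeff a (p * m) = 0" by (rule coeff_eq_0)
  qed
  then have cc: "coeff c k = coeff a (p * k)" for k by simp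
  have "a = pcompose c (monom 1 p)"
  proof (rule poly_eqI)
    fix m
    have "coeff (pcompose c (monom 1 p)) m = (\<Sum>i\<le>degree c. if p * i = m then coeff c i else 0)"
      by (simp add: pcompose_altdef poly_altdef degree_map_poly coeff_sum monom_power coeff_map_poly
          if_distrib[where f = "\<lambda>x. _ * x"] cong: if_cong) 
    also have "\<dots> = coeff a m"
    proof (cases "p dvd m")
      case True
      then obtain i where m: "m = p * i" by auto
      show ?thesis using p cc[of i] coeff_eq_0[of c i]
        by (auto simp: m not_le)
    next
      case False
      then have "(\<Sum>i\<le>degree c. if p * i = m then coeff c i else 0) = 0"
        by (intro sum.neutral) auto
      then show ?thesis using z[OF False] by simp
    qed
    finally show "coeff a m = coeff (pcompose c (monom 1 p)) m" by simp
  qed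
  then show thesis using that by (simp add: p_def)
qed

lemma ddt_eq_0_imp_frob_emb:
  fixes x :: "'a::{finite,field} ratfun"
  assumes "ddt x = 0"
  obtains y where "x = frob_emb y"
proof (cases x)
  case (Fract a b)
  define p where "p = CHAR('a)"
  have p: "p > 0" by (simp add: p_def CHAR_pos_ff)
  have "pderiv (b ^ Suc (p - 1)) = smult (of_nat p) (b ^ (p - 1)) * pderiv b"
    by (simp only: pderiv_power_Suc) (use p in simp)
  then have bp: "pderiv (b ^ p) = 0" using p by (simp add: p_def del: power_Suc)
  \<comment> \<open>Expanding the fraction by b^(p-1) makes the denominator a p-th power, whose
    derivative is 0, so the condition on x becomes one on the numerator alone.\<close>
  have x: "x = Fract (a * b ^ (p - 1)) (b ^ p)"
    using Fract p by (simp add: eq_fract power_eq_if[of b p])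
  have nz: "b ^ p \<noteq> 0" using Fract by simp
  have "0 = ddt x" using assms by simp
  also have "\<dots> = Fract (pderiv (a * b ^ (p - 1)) * b ^ p) (b ^ p * b ^ p)"
    unfolding x ddt_Fract[OF nz] bp by simp
  finally have "Fract 0 1 = Fract (pderiv (a * b ^ (p - 1)) * b ^ p) (b ^ p * b ^ p)"
    unfolding Zero_fract_def .
  then have "0 * (b ^ p * b ^ p) = pderiv (a * b ^ (p - 1)) * b ^ p * 1"
    by (subst (asm) eq_fract(1)) (use nz in auto)
  then have "pderiv (a * b ^ (p - 1)) = 0"
    using nz by auto
  then obtain c where c: "a * b ^ (p - 1) = pcompose c (monom 1 CHAR('a))"
    by (rule pderiv_eq_0_imp_pcompose)
  obtain d where d: "b ^ p = pcompose d (monom 1 CHAR('a))"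
    using bp by (rule pderiv_eq_0_imp_pcompose)
  have "d \<noteq> 0" using Fract d by force
  then have "x = frob_emb (Fract c d)" unfolding x c d by (simp add: frob_emb_Fract)
  then show thesis by (rule that)
qed

definition tvar :: "'a::{finite,field} ratfun" where "tvar = Fract [:0, 1:] 1"

lemma ddt_tvar [simp]: "ddt tvar = 1"
  by (simp add: tvar_def ddt_Fract pderiv_pCons One_fract_def one_pCons)

lemma of_nat_CHAR_ratfun [simp]: "of_nat CHAR('a) = (0 :: 'a::{finite,field} ratfun)"
  by (simp only: of_nat_fract of_nat_poly of_nat_CHAR) (simp add: fract_collapse)

lemma of_nat_ratfun_eq_0_iff: "of_nat k = (0 :: 'a::{finite,field} ratfun) \<longleftrightarrow> CHAR('a) dvd k"
  by (simp add: of_nat_fract Zero_fract_def eq_fract of_nat_eq_0_iff_char_dvd)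

lemma ddt_of_nat [simp]: "ddt (of_nat k) = 0"
  by (induction k) simp_all

subsection \<open>The ring of differential operators\<close>

lemma dleft_add [simp]: "dleft (A + B) = dleft A + dleft B"
  by (intro poly_eqI) (simp add: dleft_def coeff_pCons coeff_map_poly split: nat.split)

lemma dleft_0 [simp]: "dleft 0 = 0"
  by (simp add: dleft_def)

lemma coeff_dleft: "coeff (dleft B) k = (case k of 0 \<Rightarrow> 0 | Suc j \<Rightarrow> coeff B j) + ddt (coeff B k)"
  by (simp add: dleft_def coeff_pCons coeff_map_poly)

lemma dleft_smult: "dleft (smult a B) = smult a (dleft B) + smult (ddt a) B"
  by (intro poly_eqI) (simp add: coeff_dleft ddt_mult algebra_simps split: nat.split)

lemma funpow_dleft_add [simp]: "(dleft ^^ i) (A + B) = (dleft ^^ i) A + (dleft ^^ i) B"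
  by (induction i) simp_all

lemma funpow_dleft_0 [simp]: "(dleft ^^ i) 0 = 0"
  by (induction i) simp_all

lemma op_mult_eq_sum:
  assumes "degree A \<le> n"
  shows "A \<odot> B = (\<Sum>i\<le>n. smult (coeff A i) ((dleft ^^ i) B))"
  unfolding op_mult_def
  by (rule sum.mono_neutral_left) (use assms in \<open>auto simp: coeff_eq_0 not_le\<close>)

lemma op_mult_add_left: "(A + B) \<odot> C = A \<odot> C + B \<odot> C"
proof -
  define n where "n = max (degree A) (degree B)"
  have "degree (A + B) \<le> n" "degree A \<le> n" "degree B \<le> n"
    by (auto simp: n_def degree_add_le_max)
  then show ?thesis
    by (simp add: op_mult_eq_sum[of _ n] smult_add_left sum.distrib)
qed

lemma op_mult_add_right: "A \<odot> (B + C) = A \<odot> B + A \<odot> C"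
  by (simp add: op_mult_def smult_add_right sum.distrib)

lemma op_mult_0_left [simp]: "0 \<odot> C = 0"
  by (simp add: op_mult_def)

lemma op_mult_0_right [simp]: "C \<odot> 0 = 0"
  by (simp add: op_mult_def)

text \<open>This is (a + A \<partial>) B = a B + A (\<partial> B). It allows induction on the left
  factor of a product, with the right factor arbitrary.\<close>

lemma op_mult_pCons: "pCons a A \<odot> B = smult a B + A \<odot> dleft B"
proof -
  have "pCons a A \<odot> B = (\<Sum>i\<le>Suc (degree A). smult (coeff (pCons a A) i) ((dleft ^^ i) B))"
    by (rule op_mult_eq_sum) (rule degree_pCons_le)
  also have "\<dots> = smult a B + (\<Sum>i\<le>degree A. smult (coeff A i) ((dleft ^^ i) (dleft B)))"
    by (subst sum.atMost_Suc_shift) (simp add: funpow_swap1 del: funpow.simps add: funpow_Suc_right)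
  finally show ?thesis by (simp add: op_mult_def)
qed

lemma op_mult_smult_left: "smult a A \<odot> B = smult a (A \<odot> B)"
  by (induction A arbitrary: B) (simp_all add: op_mult_pCons smult_add_right)

text \<open>Associativity with left factor \<partial>, the inductive core of
  \<open>op_mult_assoc\<close>.\<close>

lemma dleft_op_mult: "dleft A \<odot> B = dleft (A \<odot> B)"
proof (induction A arbitrary: B)
  case (pCons a A)
  have "dleft (pCons a A) = pCons (ddt a) (dleft A) + [:0, a:]"
    by (intro poly_eqI) (simp add: coeff_dleft coeff_pCons split: nat.split)
  then show ?case
    by (simp add: op_mult_add_left op_mult_pCons pCons.IH dleft_smult algebra_simps)
qed simp

lemma op_mult_assoc: "(A \<odot> B) \<odot> C = A \<odot> (B \<odot> C)"
proof (induction A arbitrary: B)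
  case (pCons a A)
  then show ?case
    by (simp add: op_mult_pCons op_mult_add_left op_mult_smult_left dleft_op_mult)
qed simp

lemma op_mult_1_left: "1 \<odot> A = A"
  by (simp add: one_pCons op_mult_pCons)

lemma op_mult_1_right: "A \<odot> 1 = A"
proof -
  have d: "(dleft ^^ i) 1 = monom 1 i" for i
  proof (induction i)
    case (Suc i)
    have "dleft (monom 1 i) = monom 1 (Suc i)"
      by (intro poly_eqI) (auto simp: coeff_dleft split: nat.split)
    then show ?case using Suc by simp
  qed (simp add: monom_0 one_pCons)
  show ?thesis
    unfolding op_mult_def d by (simp add: smult_monom poly_as_sum_of_monoms)
qed

lemma degree_lead_dleft:
  assumes "B \<noteq> 0"
  shows "degree (dleft B) = Suc (degree B)" "lead_coeff (dleft B) = lead_coeff B"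
proof -
  have c: "coeff (dleft B) (Suc (degree B)) = lead_coeff B"
    by (simp add: coeff_dleft coeff_eq_0)
  have "degree (dleft B) \<le> Suc (degree B)"
    by (rule degree_le) (auto simp: coeff_dleft coeff_eq_0 split: nat.split)
  then show d: "degree (dleft B) = Suc (degree B)"
    using c assms le_degree[of "dleft B" "Suc (degree B)"] by simp
  then show "lead_coeff (dleft B) = lead_coeff B" using c by simp
qed

lemma degree_lead_funpow_dleft:
  assumes "B \<noteq> 0"
  shows "degree ((dleft ^^ i) B) = i + degree B \<and> lead_coeff ((dleft ^^ i) B) = lead_coeff B"
proof (induction i)
  case (Suc i)
  then have "(dleft ^^ i) B \<noteq> 0" using assms by force
  then show ?case using Suc degree_lead_dleft[of "(dleft ^^ i) B"] by (metis add_Suc comp_apply funpow.simps(2))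
qed simp

text \<open>Derivatives of coefficients enter only below the top order, so order and leading
  coefficient behave as for commutative polynomials. Absence of zero divisors follows.\<close>

lemma degree_lead_op_mult:
  assumes "A \<noteq> 0" "B \<noteq> 0"
  shows "degree (A \<odot> B) = degree A + degree B"
    "lead_coeff (A \<odot> B) = lead_coeff A * lead_coeff B"
proof -
  have h: "coeff ((dleft ^^ i) B) (degree A + degree B) = (if i = degree A then lead_coeff B else 0)"
    if "i \<le> degree A" for i
    using degree_lead_funpow_dleft[OF assms(2), of i] that
    by (auto intro!: coeff_eq_0)
  have "coeff (A \<odot> B) (degree A + degree B)
      = (\<Sum>i\<le>degree A. coeff A i * (if i = degree A then lead_coeff B else 0))"
    unfolding op_mult_def coeff_sum by (intro sum.cong) (auto simp: h)
  also have "\<dots> = lead_coeff A * lead_coeff B" by (simp add: if_distrib cong: if_cong)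
  finally have c: "coeff (A \<odot> B) (degree A + degree B) = lead_coeff A * lead_coeff B" .
  have "degree (A \<odot> B) \<le> degree A + degree B"
    unfolding op_mult_def
    by (intro degree_sum_le) (use degree_lead_funpow_dleft[OF assms(2)] degree_smult_le in
        \<open>force intro: order.trans\<close>)+
  moreover have "coeff (A \<odot> B) (degree A + degree B) \<noteq> 0" using c assms by simp
  ultimately show d: "degree (A \<odot> B) = degree A + degree B"
    by (meson le_degree order_antisym)
  show "lead_coeff (A \<odot> B) = lead_coeff A * lead_coeff B" using c d by simp
qed

text \<open>A copy of the type of operators, so that the Ore product can be the product of a type class.\<close>
typedef (overloaded) 'a ldo = "UNIV :: 'a::{finite,field} diffop set" morphisms rep_ldo Ldo
  by simp

setup_lifting type_definition_ldo

instantiation ldo :: ("{finite,field}") ring_1_no_zero_divisors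
begin
lift_definition zero_ldo :: "'a ldo" is 0 .
lift_definition one_ldo :: "'a ldo" is 1 .
lift_definition plus_ldo :: "'a ldo \<Rightarrow> 'a ldo \<Rightarrow> 'a ldo" is "(+)" .
lift_definition minus_ldo :: "'a ldo \<Rightarrow> 'a ldo \<Rightarrow> 'a ldo" is "(-)" .
lift_definition uminus_ldo :: "'a ldo \<Rightarrow> 'a ldo" is "uminus" .
lift_definition times_ldo :: "'a ldo \<Rightarrow> 'a ldo \<Rightarrow> 'a ldo" is "(\<odot>)" .
instance
proof
  fix a b c :: "'a ldo"
  show "a + b + c = a + (b + c)" by transfer simp
  show "a + b = b + a" by transfer simp
  show "0 + a = a" by transfer simp
  show "- a + a = 0" by transfer simp
  show "a - b = a + - b" by transfer simp
  show "a * b * c = a * (b * c)" by transfer (rule op_mult_assoc)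
  show "1 * a = a" by transfer (rule op_mult_1_left)
  show "a * 1 = a" by transfer (rule op_mult_1_right)
  show "(a + b) * c = a * c + b * c" by transfer (rule op_mult_add_left)
  show "a * (b + c) = a * b + a * c" by transfer (rule op_mult_add_right)
  show "(0::'a ldo) \<noteq> 1" by transfer simp
  show "a \<noteq> 0 \<Longrightarrow> b \<noteq> 0 \<Longrightarrow> a * b \<noteq> 0"
    by transfer (metis degree_lead_op_mult(2) leading_coeff_0_iff mult_eq_0_iff)
  show "0 * a = 0" by transfer simp
  show "a * 0 = 0" by transfer simp
qed
end

definition cst :: "'a::{finite,field} ratfun \<Rightarrow> 'a ldo" where "cst a = Ldo [:a:]"
definition dd :: "'a::{finite,field} ldo" where "dd = Ldo partial"
definition ord :: "'a::{finite,field} ldo \<Rightarrow> nat" where "ord x = degree (rep_ldo x)"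
definition cf :: "'a::{finite,field} ldo \<Rightarrow> nat \<Rightarrow> 'a ratfun" where "cf x = coeff (rep_ldo x)"

lemma rep_Ldo [simp]: "rep_ldo (Ldo A) = A"
  by (simp add: Ldo_inverse)

lemmas rep_ldo_ops = zero_ldo.rep_eq one_ldo.rep_eq plus_ldo.rep_eq minus_ldo.rep_eq
  uminus_ldo.rep_eq times_ldo.rep_eq

lemma rep_cst: "rep_ldo (cst a) = [:a:]"
  by (simp add: cst_def)

lemma rep_dd: "rep_ldo dd = [:0, 1:]"
  by (simp add: dd_def partial_def)

lemmas ldo_defs = ord_def cf_def rep_cst rep_dd rep_ldo_ops rep_ldo_inject[symmetric]

abbreviation lc :: "'a::{finite,field} ldo \<Rightarrow> 'a ratfun" where "lc x \<equiv> cf x (ord x)"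

lemma cf_cst_mult [simp]: "cf (cst a * x) k = a * cf x k"
  by (simp add: ldo_defs op_mult_pCons)

lemma cf_add [simp]: "cf (x + y) k = cf x k + cf y k"
  by (simp add: ldo_defs)

lemma cf_diff [simp]: "cf (x - y) k = cf x k - cf y k"
  by (simp add: ldo_defs)

lemma cf_0 [simp]: "cf 0 k = 0"
  by (simp add: ldo_defs)

lemma cf_sum: "cf (sum f A) k = (\<Sum>i\<in>A. cf (f i) k)"
  by (induction A rule: infinite_finite_induct) simp_all

lemma cst_mult: "cst (a * b) = cst a * cst b"
  by (simp add: ldo_defs op_mult_pCons)

lemma cst_add: "cst (a + b) = cst a + cst b"
  by (simp add: ldo_defs)

lemma cst_uminus: "cst (- b) = - cst b"
  by (simp add: ldo_defs)

lemma cst_0 [simp]: "cst 0 = 0"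
  by (simp add: ldo_defs)

lemma cst_1 [simp]: "cst 1 = 1"
  by (simp add: ldo_defs one_pCons)

lemma cst_eq_0_iff [simp]: "cst a = 0 \<longleftrightarrow> a = 0"
  by (simp add: ldo_defs)

lemma cst_of_nat: "cst (of_nat k) = of_nat k"
  by (induction k) (simp_all add: cst_add)

lemma dd_cst: "dd * cst a = cst a * dd + cst (ddt a)"
  by (simp add: ldo_defs op_mult_pCons dleft_def map_poly_pCons)

lemma cf_dd_power: "cf (dd ^ k) j = (if j = k then 1 else 0)"
proof -
  have "rep_ldo (dd ^ k :: 'a ldo) = monom 1 k"
  proof (induction k)
    case (Suc k)
    have "rep_ldo (dd ^ Suc k :: 'a ldo) = partial \<odot> monom 1 k"
      using Suc by (simp add: times_ldo.rep_eq dd_def)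
    also have "\<dots> = monom 1 (Suc k)"
      by (intro poly_eqI) (auto simp: partial_def op_mult_pCons coeff_dleft split: nat.split)
    finally show ?case .
  qed (simp add: one_ldo.rep_eq monom_0 one_pCons)
  then show ?thesis by (auto simp: cf_def)
qed

lemma ldo_eqI: "(\<And>k. cf x k = cf y k) \<Longrightarrow> x = y"
  by (simp add: ldo_defs poly_eqI)

lemma cf_eq_0: "ord x < k \<Longrightarrow> cf x k = 0"
  by (simp add: ldo_defs coeff_eq_0)

lemma lc_eq_0_iff [simp]: "lc x = 0 \<longleftrightarrow> x = 0"
  by (simp add: ldo_defs)

lemma ldo_expand:
  assumes "\<And>k. k \<ge> m \<Longrightarrow> cf x k = 0"
  shows "x = (\<Sum>k<m. cst (cf x k) * dd ^ k)"
proof (rule ldo_eqI)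
  fix j
  have "cf (\<Sum>k<m. cst (cf x k) * dd ^ k) j = (\<Sum>k<m. if j = k then cf x k else 0)"
    by (simp add: cf_sum cf_dd_power if_distrib cong: if_cong)
  also have "\<dots> = cf x j" using assms[of j] by (simp add: not_less)
  finally show "cf x j = cf (\<Sum>k<m. cst (cf x k) * dd ^ k) j" by simp
qed

lemma ord_mult: "x \<noteq> 0 \<Longrightarrow> y \<noteq> 0 \<Longrightarrow> ord (x * y) = ord x + ord y"
  by (simp add: ldo_defs degree_lead_op_mult)

lemma lc_mult: "lc (x * y) = lc x * lc y"
proof (cases "x = 0 \<or> y = 0")
  case False
  then show ?thesis using degree_lead_op_mult[of "rep_ldo x" "rep_ldo y"] by (simp add: ldo_defs)
qed auto

lemma ord_0 [simp]: "ord 0 = 0"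
  by (simp add: ldo_defs)

lemma ord_1 [simp]: "ord 1 = 0"
  by (simp add: ldo_defs)

lemma ord_cst [simp]: "ord (cst a) = 0"
  by (simp add: ldo_defs)

lemma cf_1_0 [simp]: "cf 1 0 = 1"
  by (simp add: ldo_defs)

lemma ord_less_iff: "m > 0 \<Longrightarrow> ord x < m \<longleftrightarrow> (\<forall>k\<ge>m. cf x k = 0)"
  using lc_eq_0_iff[of x] by (metis cf_eq_0 linorder_not_less order_less_le_trans ord_0)

lemma ord_cst_mult: "a \<noteq> 0 \<Longrightarrow> ord (cst a * x) = ord x"
  by (cases "x = 0") (simp_all add: ord_mult)

lemma ord_dd_power [simp]: "ord (dd ^ k) = k"
proof -
  have "ord (dd :: 'a ldo) = 1" "(dd :: 'a ldo) \<noteq> 0" by (simp_all add: ldo_defs)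
  then show ?thesis by (induction k) (simp_all add: ord_mult)
qed

lemma ord_eq_0_imp_cst: "ord x = 0 \<Longrightarrow> x = cst (cf x 0)"
  using ldo_expand[of 1 x] cf_eq_0[of x] by simp

lemma ord_0_inverse:
  assumes "ord x = 0" "x \<noteq> 0"
  obtains y where "y * x = 1"
proof -
  have x: "x = cst (cf x 0)" using assms(1) by (rule ord_eq_0_imp_cst)
  then have "cf x 0 \<noteq> 0" using assms(2) by auto
  then have "cst (inverse (cf x 0)) * x = 1" by (subst x) (simp flip: cst_mult)
  then show thesis by (rule that)
qed

section \<open>The central power of \<partial> and criteria for centrality\<close>

definition yy :: "'a::{finite,field} ldo" where "yy = dd ^ CHAR('a)"

text \<open>Coefficients from all of F_q(t) are allowed: the image K[\<partial>^p] is a commutative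
  subring, the centralizer of t, while the centre is the image of the polynomials over
  F_q(t^p).\<close>

definition ysub :: "'a::{finite,field} ratfun poly \<Rightarrow> 'a ldo" where
  "ysub P = (\<Sum>k\<le>degree P. cst (coeff P k) * dd ^ (k * CHAR('a)))"

definition central :: "'a::{finite,field} ldo \<Rightarrow> bool" where
  "central z \<longleftrightarrow> (\<forall>x. z * x = x * z)"

definition lid :: "'a::{finite,field} ldo \<Rightarrow> 'a ldo set" where
  "lid L = {q * L |q. True}"

lemma of_nat_CHAR_ldo [simp]: "of_nat CHAR('a) = (0 :: 'a::{finite,field} ldo)"
  using cst_of_nat[of "CHAR('a)", where 'a = 'a] by simp

lemma power_commutator:
  fixes x u :: "'b::ring_1"
  assumes "x * u = u * x + 1"
  shows "x ^ m * u = u * x ^ m + of_nat m * x ^ (m - 1)"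
proof (induction m)
  case (Suc m)
  have "x ^ Suc m * u = x * (x ^ m * u)" by (simp add: mult.assoc)
  also have "\<dots> = x * u * x ^ m + of_nat m * (x * x ^ (m - 1))"
    unfolding Suc distrib_left by (metis mult.assoc mult_of_nat_commute)
  also have "of_nat m * (x * x ^ (m - 1)) = of_nat m * x ^ m"
    by (cases m) simp_all
  finally show ?case by (simp add: assms algebra_simps)
qed simp

lemma commutes_power: "x * (z::'b::monoid_mult) = z * x \<Longrightarrow> x ^ m * z = z * x ^ m"
  by (metis power_commuting_commutes)

text \<open>F_q(t) is generated as a field by t and the constants F_q.\<close>
lemma commutes_cstI:
  fixes z :: "'a::{finite,field} ldo"
  assumes t: "z * cst tvar = cst tvar * z" and c: "\<And>c. z * cst (Fract [:c:] 1) = cst (Fract [:c:] 1) * z"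
  shows "z * cst a = cst a * z"
proof -
  have pol: "z * cst (Fract f 1) = cst (Fract f 1) * z" for f
  proof (induction f)
    case (pCons b f)
    have "Fract (pCons b f) 1 = Fract [:b:] 1 + tvar * Fract f 1"
      by (simp add: tvar_def)
    then show ?case
      using c[of b] t pCons.IH by (simp add: cst_add cst_mult distrib_left distrib_right) (metis mult.assoc)
  qed (simp add: fract_collapse)
  show ?thesis
  proof (cases a)
    case (Fract f g)
    have "a * Fract g 1 = Fract f 1" using Fract by (simp add: eq_fract)
    then have e: "cst a * cst (Fract g 1) = cst (Fract f 1)" by (simp flip: cst_mult)
    have "(z * cst a) * cst (Fract g 1) = cst a * (z * cst (Fract g 1))"
      unfolding pol[of g] using e pol[of f] by (metis mult.assoc)
    then have "(z * cst a - cst a * z) * cst (Fract g 1) = 0"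
      by (simp add: left_diff_distrib mult.assoc)
    moreover have "cst (Fract g 1) \<noteq> 0" using Fract by (simp add: Zero_fract_def eq_fract)
    ultimately show ?thesis by simp
  qed
qed

text \<open>Stated for any x with the commutation rule of \<partial>, since it serves both
  \<open>dd\<close> and \<open>dd - ysub f\<close>. Here [x^p, t] = p x^(p-1) = 0, and x itself
  commutes with F_q.\<close>

lemma power_CHAR_commutes_cst:
  fixes x :: "'a::{finite,field} ldo"
  assumes "\<And>a. x * cst a = cst a * x + cst (ddt a)"
  shows "x ^ CHAR('a) * cst a = cst a * x ^ CHAR('a)"
proof (rule commutes_cstI)
  show "x ^ CHAR('a) * cst tvar = cst tvar * x ^ CHAR('a)"
    using power_commutator[of x "cst tvar" "CHAR('a)"] assms[of tvar] by simp
  fix c :: 'a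
  have "ddt (Fract [:c:] 1) = 0" by (simp add: ddt_Fract fract_collapse)
  then show "x ^ CHAR('a) * cst (Fract [:c:] 1) = cst (Fract [:c:] 1) * x ^ CHAR('a)"
    using assms[of "Fract [:c:] 1"] by (intro commutes_power) simp
qed

lemma centralI:
  assumes c: "\<And>a. z * cst a = cst a * z" and d: "z * dd = dd * z"
  shows "central z"
  unfolding central_def
proof
  fix x :: "'a ldo"
  have "x = (\<Sum>k<Suc (ord x). cst (cf x k) * dd ^ k)"
    by (rule ldo_expand) (simp add: cf_eq_0)
  moreover have "z * (cst (cf x k) * dd ^ k) = cst (cf x k) * dd ^ k * z" for k
    using commutes_power[of dd z k] c[of "cf x k"] d by (metis mult.assoc)
  ultimately show "z * x = x * z"
    by (metis (no_types, lifting) sum.cong sum_distrib_left sum_distrib_right)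
qed

lemma central_commute: "central z \<Longrightarrow> z * x = x * z"
  by (simp add: central_def)

lemma central_1 [simp]: "central 1"
  by (simp add: central_def)

lemma central_mult [simp]: "central x \<Longrightarrow> central y \<Longrightarrow> central (x * y)"
  unfolding central_def by (metis mult.assoc)

lemma central_power [simp]: "central x \<Longrightarrow> central (x ^ k)"
  by (induction k) simp_all

lemma central_yy [simp]: "central yy"
proof (rule centralI)
  show "yy * cst a = cst a * yy" for a :: "'a ratfun"
    unfolding yy_def by (rule power_CHAR_commutes_cst) (rule dd_cst)
qed (simp add: yy_def power_commutes)

lemma central_cancel_left:
  assumes "central (x * y)" "central x" "x \<noteq> 0"
  shows "central y"
  unfolding central_def
proof
  fix u
  have "x * (y * u) = x * (u * y)"
    using assms(1,2) by (metis central_commute mult.assoc)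
  then have "x * (y * u - u * y) = 0" by (simp add: right_diff_distrib)
  then show "y * u = u * y" using assms(3) by simp
qed

subsection \<open>Substituting the central element\<close>

lemma ysub_eq_sum:
  assumes "degree P \<le> n"
  shows "ysub (P :: 'a::{finite,field} ratfun poly) = (\<Sum>k\<le>n. cst (coeff P k) * dd ^ (k * CHAR('a)))"
  unfolding ysub_def
  by (rule sum.mono_neutral_left) (use assms in \<open>auto simp: coeff_eq_0 not_le\<close>)

lemma ysub_eq_sum_less:
  assumes "P = 0 \<or> degree P < n"
  shows "ysub (P :: 'a::{finite,field} ratfun poly) = (\<Sum>k<n. cst (coeff P k) * dd ^ (k * CHAR('a)))"
proof -
  have "(\<Sum>k\<le>degree P. cst (coeff P k) * dd ^ (k * CHAR('a))) =
    (\<Sum>k<n. cst (coeff P k) * dd ^ (k * CHAR('a)))"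
    by (rule sum.mono_neutral_cong) (use assms in \<open>auto simp: coeff_eq_0 not_le not_less\<close>)
  then show ?thesis by (simp add: ysub_def)
qed

lemma ysub_0 [simp]: "ysub 0 = 0"
  by (simp add: ysub_def)

lemma ysub_add: "ysub (P + Q) = ysub P + ysub Q"
proof -
  define n where "n = max (degree P) (degree Q)"
  have "degree (P + Q) \<le> n" "degree P \<le> n" "degree Q \<le> n"
    by (auto simp: n_def degree_add_le_max)
  then show ?thesis
    by (simp add: ysub_eq_sum[of _ n] sum.distrib cst_add distrib_right)
qed

lemma ysub_smult: "ysub (smult a P) = cst a * ysub P"
  using ysub_eq_sum[of "smult a P" "degree P"]
  by (simp add: ysub_def sum_distrib_left cst_mult mult.assoc degree_smult_le)

lemma ysub_uminus: "ysub (- P) = - ysub P"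
  using ysub_add[of P "- P"] by (simp add: eq_neg_iff_add_eq_0 add.commute)

lemma ysub_diff: "ysub (P - Q) = ysub P - ysub Q"
  using ysub_add[of P "- Q"] by (simp add: ysub_uminus)

lemma ysub_pCons: "ysub (pCons a P) = cst a + ysub P * yy"
proof -
  have "ysub (pCons a P) = (\<Sum>k\<le>Suc (degree P). cst (coeff (pCons a P) k) * dd ^ (k * CHAR('a)))"
    by (rule ysub_eq_sum) (rule degree_pCons_le)
  also have "\<dots> = cst a + ysub P * yy"
    by (subst sum.atMost_Suc_shift)
      (simp add: ysub_def sum_distrib_right yy_def mult.assoc add.commute flip: power_add)
  finally show ?thesis .
qed

lemma ysub_const: "ysub [:a:] = cst a"
  by (simp add: ysub_pCons)

lemma ysub_1 [simp]: "ysub 1 = 1"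
  by (simp add: one_pCons ysub_const)

lemma ysub_mult: "ysub (P * Q) = ysub P * ysub Q"
proof (induction P)
  case (pCons a P)
  have "ysub (pCons a P * Q) = cst a * ysub Q + ysub P * ysub Q * yy"
    by (simp add: ysub_add ysub_smult ysub_pCons pCons.IH)
  also have "\<dots> = ysub (pCons a P) * ysub Q"
    by (simp add: ysub_pCons distrib_right mult.assoc central_commute[OF central_yy, of "ysub Q"])
  finally show ?case .
qed simp

lemma ysub_power: "ysub (P ^ k) = ysub P ^ k"
  by (induction k) (simp_all add: ysub_mult)

lemma ysub_sum: "ysub (sum f A) = (\<Sum>i\<in>A. ysub (f i))"
  by (induction A rule: infinite_finite_induct) (simp_all add: ysub_add)

lemma ysub_commute: "ysub P * ysub Q = ysub Q * ysub P"
  by (metis mult.commute ysub_mult)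

lemma ysub_cst_commute: "ysub P * cst a = cst a * ysub P"
  using ysub_commute[of P "[:a:]"] by (simp add: ysub_const)

lemma cf_ysub:
  fixes P :: "'a::{finite,field} ratfun poly"
  shows "cf (ysub P) j = (if CHAR('a) dvd j then coeff P (j div CHAR('a)) else 0)"
proof -
  have "cf (ysub P) j = (\<Sum>k\<le>degree P. if j = k * CHAR('a) then coeff P k else 0)"
    by (simp add: ysub_def cf_sum cf_dd_power if_distrib cong: if_cong)
  also have "\<dots> = (if CHAR('a) dvd j then coeff P (j div CHAR('a)) else 0)"
  proof (cases "CHAR('a) dvd j")
    case True
    then obtain i where i: "j = i * CHAR('a)" by (metis dvdE mult.commute)
    have p: "CHAR('a) \<noteq> 0" using CHAR_pos_ff[where 'a = 'a] by simp
    have "(\<Sum>k\<le>degree P. if j = k * CHAR('a) then coeff P k else 0)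
        = (\<Sum>k\<le>degree P. if k = i then coeff P k else 0)"
      using p by (intro sum.cong refl) (simp add: i)
    also have "\<dots> = coeff P i" by (simp add: coeff_eq_0)
    finally show ?thesis using p by (simp add: i)
  next
    case False
    then have "j \<noteq> k * CHAR('a)" for k by (metis dvd_triv_right)
    then show ?thesis using False by simp
  qed
  finally show ?thesis .
qed

lemma ysub_eq_0_iff [simp]: "ysub P = 0 \<longleftrightarrow> P = (0 :: 'a::{finite,field} ratfun poly)"
proof
  assume "ysub P = 0"
  then have "cf (ysub P) (k * CHAR('a)) = 0" for k by simp
  then show "P = 0" using CHAR_pos_ff[where 'a = 'a] by (intro poly_eqI) (simp add: cf_ysub)
qed simp

lemma ysub_inj: "ysub P = ysub Q \<Longrightarrow> P = Q"
  using ysub_eq_0_iff[of "P - Q"] by (simp add: ysub_diff)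

lemma ord_ysub: "ord (ysub P) = CHAR('a) * degree (P :: 'a::{finite,field} ratfun poly)"
proof (cases "P = 0")
  case False
  have "cf (ysub P) (CHAR('a) * degree P) \<noteq> 0" 
    using False CHAR_pos_ff[where 'a = 'a] by (simp add: cf_ysub)
  moreover have "cf (ysub P) j = 0" if "j > CHAR('a) * degree P" for j
    using that by (auto simp: cf_ysub intro!: coeff_eq_0)
  ultimately show ?thesis using False
    by (metis cf_eq_0 lc_eq_0_iff linorder_neqE_nat ysub_eq_0_iff)
qed simp

lemma dd_ysub: "dd * ysub P = ysub P * dd + ysub (map_poly ddt P)"
proof (induction P)
  case (pCons a P)
  have "dd * ysub (pCons a P) = dd * cst a + (dd * ysub P) * yy"
    by (simp only: ysub_pCons distrib_left mult.assoc)
  also have "\<dots> = cst a * dd + cst (ddt a) + ysub P * (dd * yy) + ysub (map_poly ddt P) * yy"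
    by (simp only: pCons.IH dd_cst distrib_right mult.assoc add.assoc)
  also have "dd * yy = yy * (dd :: 'a ldo)"
    by (rule central_commute[symmetric]) simp
  also have "cst a * dd + cst (ddt a) + ysub P * (yy * dd) + ysub (map_poly ddt P) * yy
      = ysub (pCons a P) * dd + ysub (map_poly ddt (pCons a P))"
    by (simp add: ysub_pCons map_poly_pCons distrib_right mult.assoc)
  finally show ?case .
qed simp

text \<open>Since [\<partial>^k, t] = k \<partial>^(k-1), commuting with t forces k a_k = 0 for each
  coefficient, so only exponents divisible by p survive.\<close>

lemma commutes_tvar_imp_ysub:
  fixes z :: "'a::{finite,field} ldo"
  assumes "z * cst tvar = cst tvar * z"
  obtains P where "z = ysub P"
proof -
  define p where "p = CHAR('a)"
  have p: "p > 0" by (simp add: p_def CHAR_pos_ff)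
  define m where "m = Suc (ord z)"
  have z: "z = (\<Sum>k<m. cst (cf z k) * dd ^ k)"
    by (rule ldo_expand) (simp add: cf_eq_0 m_def)
  have dt: "dd * cst tvar = cst tvar * dd + (1 :: 'a ldo)" by (simp add: dd_cst)
  have tm: "cst a * dd ^ k * cst tvar
      = cst tvar * (cst a * dd ^ k) + cst (of_nat k * a) * dd ^ (k - 1)" for k and a :: "'a ratfun"
  proof -
    have "cst a * dd ^ k * cst tvar = cst a * cst tvar * dd ^ k + cst a * (of_nat k * dd ^ (k - 1))"
      by (simp add: mult.assoc power_commutator[OF dt] distrib_left)
    also have "cst a * cst tvar = cst tvar * cst a" by (metis cst_mult mult.commute)
    also have "cst a * (of_nat k * dd ^ (k - 1)) = cst (of_nat k * a) * dd ^ (k - 1)"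
      by (simp only: cst_mult cst_of_nat) (metis mult_of_nat_commute mult.assoc)
    finally show ?thesis by (simp add: mult.assoc)
  qed
  have "z * cst tvar = cst tvar * z + (\<Sum>k<m. cst (of_nat k * cf z k) * dd ^ (k - 1))"
    by (subst (1 2) z) (simp only: sum_distrib_left sum_distrib_right tm sum.distrib)
  with assms have s0: "(\<Sum>k<m. cst (of_nat k * cf z k) * dd ^ (k - 1)) = 0" by simp
  have cfz: "cf z j = 0" if "\<not> p dvd j" for j
  proof (cases "j < m")
    case True
    have j0: "j > 0" using that by (cases j) auto
    have "0 = cf (\<Sum>k<m. cst (of_nat k * cf z k) * dd ^ (k - 1)) (j - 1)" using s0 by simp
    also have "\<dots> = (\<Sum>k<m. if k = j then of_nat k * cf z k else 0)"
      unfolding cf_sum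
    proof (rule sum.cong)
      fix k
      show "cf (cst (of_nat k * cf z k) * dd ^ (k - 1)) (j - 1) = (if k = j then of_nat k * cf z k else 0)"
        using j0 by (cases "k = 0") (auto simp: cf_dd_power)
    qed simp
    also have "\<dots> = of_nat j * cf z j" using True by simp
    finally show ?thesis using that by (auto simp: of_nat_ratfun_eq_0_iff p_def)
  qed (simp add: cf_eq_0 m_def)
  define P where "P = (\<Sum>k<m. monom (cf z (p * k)) k)"
  have cP: "coeff P k = cf z (p * k)" for k
  proof (cases "k < m")
    case False
    moreover have "k \<le> p * k" using p by simp
    ultimately have "ord z < p * k" unfolding m_def by linarith
    then show ?thesis using False by (simp add: P_def coeff_sum cf_eq_0)
  qed (simp add: P_def coeff_sum)
  have "z = ysub P"
    by (rule ldo_eqI) (use cfz in \<open>auto simp: cf_ysub cP p_def\<close>)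
  then show thesis by (rule that)
qed

lemma map_poly_frob_emb_of_ddt_0:
  fixes P :: "'a::{finite,field} ratfun poly"
  assumes "map_poly ddt P = 0"
  obtains Q where "P = map_poly frob_emb Q"
proof -
  have "\<exists>c. P = map_poly frob_emb c" using assms
  proof (induction P)
    case (pCons a P)
    then have "ddt a = 0" "map_poly ddt P = 0" by (auto simp: map_poly_pCons)
    then obtain y c where "a = frob_emb y" "P = map_poly frob_emb c"
      using pCons.IH by (metis ddt_eq_0_imp_frob_emb)
    then have "pCons a P = map_poly frob_emb (pCons y c)" by (simp add: map_poly_pCons)
    then show ?case by blast
  qed (auto intro: exI[of _ 0])
  then show thesis using that by blast
qed

text \<open>Commuting with t gives a polynomial in \<partial>^p; commuting with \<partial> then
  makes the derivatives of its coefficients vanish.\<close>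

lemma central_imp_ysub:
  assumes "central z"
  obtains Q where "z = ysub (map_poly frob_emb Q)"
proof -
  obtain P where P: "z = ysub P"
    using commutes_tvar_imp_ysub assms central_commute by metis
  then have "ysub (map_poly ddt P) = 0"
    using assms dd_ysub[of P] by (simp add: central_commute)
  then obtain Q where "P = map_poly frob_emb Q"
    using map_poly_frob_emb_of_ddt_0 by auto
  then show thesis using that P by blast
qed

lemma central_ysub_frob_emb [simp]: "central (ysub (map_poly frob_emb Q))"
proof (rule centralI)
  have "map_poly ddt (map_poly frob_emb Q) = 0"
    by (intro poly_eqI) (simp add: coeff_map_poly)
  then show "ysub (map_poly frob_emb Q) * dd = dd * ysub (map_poly frob_emb Q)"
    using dd_ysub[of "map_poly frob_emb Q"] by simp
qed (rule ysub_cst_commute)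

subsection \<open>Left ideals\<close>

lemma lidI: "x = q * L \<Longrightarrow> x \<in> lid L"
  by (auto simp: lid_def)

lemma lidE: assumes "x \<in> lid L" obtains q where "x = q * L"
  using assms by (auto simp: lid_def)

lemma lid_0 [simp]: "0 \<in> lid L"
  by (rule lidI[of _ 0]) simp

lemma lid_self [simp]: "L \<in> lid L"
  by (rule lidI[of _ 1]) simp

lemma lid_add: "x \<in> lid L \<Longrightarrow> y \<in> lid L \<Longrightarrow> x + y \<in> lid L"
  by (metis lidE lidI distrib_right)

lemma lid_mult: "x \<in> lid L \<Longrightarrow> y * x \<in> lid L"
  by (metis lidE lidI mult.assoc)

lemma lid_uminus: "x \<in> lid L \<Longrightarrow> - x \<in> lid L"
  using lid_mult[of x L "- 1"] by simp

lemma lid_diff: "x \<in> lid L \<Longrightarrow> y \<in> lid L \<Longrightarrow> x - y \<in> lid L"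
  using lid_add[of x L "- y"] lid_uminus[of y L] by simp

lemma lid_sum: "(\<And>i. i \<in> A \<Longrightarrow> f i \<in> lid L) \<Longrightarrow> sum f A \<in> lid L"
  by (induction A rule: infinite_finite_induct) (auto intro: lid_add)

lemma lid_cong: "x - y \<in> lid L \<Longrightarrow> x \<in> lid L \<longleftrightarrow> y \<in> lid L"
  using lid_add[of "x - y" L y] lid_diff[of x L "x - y"] by auto

lemma lid_mono: "L \<in> lid M \<Longrightarrow> x \<in> lid L \<Longrightarrow> x \<in> lid M"
  by (metis lidE lid_mult)

lemma lid_ord_less: "x \<in> lid L \<Longrightarrow> ord x < ord L \<Longrightarrow> x = 0"
  by (metis lidE mult_eq_0_iff not_add_less2 ord_mult)

lemma right_division:
  assumes "L \<noteq> 0"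
  obtains r where "x - r \<in> lid L" "r = 0 \<or> ord r < ord L"
proof -
  have "\<exists>r. x - r \<in> lid L \<and> (r = 0 \<or> ord r < ord L)"
  proof (induction "ord x" arbitrary: x rule: less_induct)
    case less
    show ?case
    proof (cases "x = 0 \<or> ord x < ord L")
      case True
      then show ?thesis by (intro exI[of _ x]) simp
    next
      case False
      define q where "q = cst (lc x / lc L) * dd ^ (ord x - ord L)"
      have l: "lc x / lc L \<noteq> 0" using False assms by simp
      have dnz: "(dd ^ k :: 'a ldo) \<noteq> 0" for k by (metis cf_0 cf_dd_power zero_neq_one)
      have q0: "q \<noteq> 0" using l dnz[of "ord x - ord L"] by (simp add: q_def del: power_eq_0_iff)
      have oq: "ord q = ord x - ord L" using l by (simp add: q_def ord_cst_mult)
      have lq: "lc q = lc x / lc L"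
        unfolding oq by (simp add: q_def cf_dd_power)
      have oqL: "ord (q * L) = ord x" using q0 assms oq False by (simp add: ord_mult)
      have lqL: "cf (q * L) (ord x) = lc x" using lc_mult[of q L] lq assms oqL by simp
      have top: "cf (x - q * L) (ord x) = 0" using lqL by simp
      have big: "cf (x - q * L) k = 0" if "k > ord x" for k
        using that oqL by (simp add: cf_eq_0)
      show ?thesis
      proof (cases "x - q * L = 0")
        case True
        then show ?thesis by (intro exI[of _ 0]) (auto intro: lidI)
      next
        case nz: False
        have "ord (x - q * L) < ord x"
          using top big nz by (metis lc_eq_0_iff linorder_neqE_nat)
        then obtain r where r: "x - q * L - r \<in> lid L" "r = 0 \<or> ord r < ord L"
          using less by blast
        have "x - r = (x - q * L - r) + q * L" by simp
        then have "x - r \<in> lid L" using r(1) by (metis lidI lid_add)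
        then show ?thesis using r(2) by blast
      qed
    qed
  qed
  then show thesis using that by blast
qed

lemma left_ideal_principal:
  assumes "0 \<in> J" and add: "\<And>x y. x \<in> J \<Longrightarrow> y \<in> J \<Longrightarrow> x + y \<in> J"
    and mult: "\<And>x y. x \<in> J \<Longrightarrow> y * x \<in> J" and "J \<noteq> {0}"
  obtains G where "J = lid G" "G \<noteq> 0" "lc G = 1"
proof -
  have "\<exists>x. x \<in> J \<and> x \<noteq> 0" using assms(1,4) by blast
  define H where "H = (ARG_MIN ord x. x \<in> J \<and> x \<noteq> 0)"
  have H: "H \<in> J" "H \<noteq> 0" and min: "\<And>x. x \<in> J \<Longrightarrow> x \<noteq> 0 \<Longrightarrow> ord H \<le> ord x"
    using arg_min_natI[of "\<lambda>x. x \<in> J \<and> x \<noteq> 0" _ ord] arg_min_nat_le[of "\<lambda>x. x \<in> J \<and> x \<noteq> 0" _ ord]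
      \<open>\<exists>x. x \<in> J \<and> x \<noteq> 0\<close> by (auto simp: H_def)
  define G where "G = cst (inverse (lc H)) * H"
  have i: "inverse (lc H) \<noteq> 0" using H by simp
  have G: "G \<in> J" "G \<noteq> 0" "ord G = ord H" "lc G = 1"
    using H i mult by (simp_all add: G_def ord_cst_mult)
  have "J = lid G"
  proof (intro subset_antisym subsetI)
    fix x assume "x \<in> J"
    obtain r where r: "x - r \<in> lid G" "r = 0 \<or> ord r < ord G"
      using right_division[OF G(2)] by blast
    have "x - r \<in> J" using r(1) G(1) mult by (auto simp: lid_def)
    then have "r \<in> J" using add[of x "(- 1) * (x - r)"] mult[of "x - r" "- 1"] \<open>x \<in> J\<close> by simp
    then have "r = 0" using r(2) min G(3) by force
    then show "x \<in> lid G" using r(1) by simp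
  qed (use G(1) mult in \<open>auto simp: lid_def\<close>)
  then show thesis using that G by blast
qed

subsection \<open>Linear algebra modulo a left ideal\<close>

text \<open>Gaussian elimination: \<open>k\<close> is an unknown occurring in equation j,
  \<open>B\<close> the system left after eliminating it, and \<open>s\<close> the value of
  \<open>c k\<close> forced by equation j.\<close>

lemma homogeneous_system:
  fixes A :: "'i \<Rightarrow> 'j \<Rightarrow> 'k::field"
  assumes "finite J" "finite I" "card J < card I"
  shows "\<exists>c. (\<exists>i\<in>I. c i \<noteq> 0) \<and> (\<forall>j\<in>J. (\<Sum>i\<in>I. c i * A i j) = 0)"
  using assms
proof (induction J arbitrary: I A rule: finite_induct)
  case empty
  then obtain i where "i \<in> I" by fastforce
  then show ?case by (intro exI[of _ "\<lambda>_. 1"]) auto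
next
  case (insert j J)
  show ?case
  proof (cases "\<forall>i\<in>I. A i j = 0")
    case True
    obtain c where "\<exists>i\<in>I. c i \<noteq> 0" "\<forall>j\<in>J. (\<Sum>i\<in>I. c i * A i j) = 0"
      using insert.IH[of I A] insert.prems insert.hyps by auto
    then show ?thesis using True by (intro exI[of _ c]) auto
  next
    case False
    then obtain k where k: "k \<in> I" "A k j \<noteq> 0" by blast
    define B where "B = (\<lambda>i l. A i l - A i j / A k j * A k l)"
    have "card J < card (I - {k})" using insert k by simp
    then obtain c where c: "\<exists>i\<in>I - {k}. c i \<noteq> 0" "\<forall>l\<in>J. (\<Sum>i\<in>I - {k}. c i * B i l) = 0"
      using insert.IH[of "I - {k}" B] insert.prems by auto
    define s where "s = - (\<Sum>i\<in>I - {k}. c i * A i j / A k j)"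
    define c' where "c' = c(k := s)"
    have sum: "(\<Sum>i\<in>I. c' i * A i l) = s * A k l + (\<Sum>i\<in>I - {k}. c i * A i l)" for l
      unfolding sum.remove[OF insert.prems(1) k(1)] by (auto simp: c'_def intro!: sum.cong)
    have "(\<Sum>i\<in>I. c' i * A i j) = 0"
      unfolding sum s_def using k(2)
      by (simp add: sum_distrib_right sum_negf)
    moreover have "(\<Sum>i\<in>I. c' i * A i l) = 0" if "l \<in> J" for l
    proof -
      have "(\<Sum>i\<in>I. c' i * A i l) = (\<Sum>i\<in>I - {k}. c i * B i l)"
        unfolding sum s_def B_def
        by (simp add: sum_distrib_right right_diff_distrib sum_subtractf mult.assoc)
      then show ?thesis using c that by simp
    qed
    moreover have "\<exists>i\<in>I. c' i \<noteq> 0" using c(1) by (auto simp: c'_def)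
    ultimately show ?thesis by (intro exI[of _ c']) auto
  qed
qed

text \<open>Linear algebra over F_q(t) in the quotient by the left ideal of \<open>L\<close>,
  carried out on representatives. Indexed families rather than sets make congruent representatives
  at different indices dependent.\<close>

definition indep_mod :: "'a::{finite,field} ldo \<Rightarrow> 'i set \<Rightarrow> ('i \<Rightarrow> 'a ldo) \<Rightarrow> bool" where
  "indep_mod L I x \<longleftrightarrow> (\<forall>c. (\<Sum>i\<in>I. cst (c i) * x i) \<in> lid L \<longrightarrow> (\<forall>i\<in>I. c i = 0))"

definition span_mod :: "'a::{finite,field} ldo \<Rightarrow> 'i set \<Rightarrow> ('i \<Rightarrow> 'a ldo) \<Rightarrow> 'a ldo set" where
  "span_mod L I x = {w. \<exists>c. w - (\<Sum>i\<in>I. cst (c i) * x i) \<in> lid L}"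

lemma span_modI: "w - (\<Sum>i\<in>I. cst (c i) * x i) \<in> lid L \<Longrightarrow> w \<in> span_mod L I x"
  unfolding span_mod_def by (rule CollectI) (rule exI[of _ c])

lemma span_modE:
  assumes "w \<in> span_mod L I x"
  obtains c where "w - (\<Sum>i\<in>I. cst (c i) * x i) \<in> lid L"
  using assms that unfolding span_mod_def by blast

text \<open>As the powers of \<open>dd\<close> below \<open>ord L\<close> form a basis of the
  quotient, this turns statements about orders into dimension counts.\<close>

lemma indep_mod_card_le:
  assumes "finite I" "finite J" and ind: "indep_mod L I x" and sp: "\<And>i. i \<in> I \<Longrightarrow> x i \<in> span_mod L J y"
  shows "card I \<le> card J"
proof (rule ccontr)
  assume "\<not> card I \<le> card J"
  have "\<forall>i\<in>I. \<exists>a. x i - (\<Sum>j\<in>J. cst (a j) * y j) \<in> lid L"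
    using sp by (auto simp: span_mod_def)
  then obtain A where A: "\<And>i. i \<in> I \<Longrightarrow> x i - (\<Sum>j\<in>J. cst (A i j) * y j) \<in> lid L"
    by metis
  obtain c where c: "\<exists>i\<in>I. c i \<noteq> 0" "\<And>j. j \<in> J \<Longrightarrow> (\<Sum>i\<in>I. c i * A i j) = 0"
    using homogeneous_system[OF assms(2,1), of A] \<open>\<not> card I \<le> card J\<close> by auto
  have "(\<Sum>i\<in>I. cst (c i) * (x i - (\<Sum>j\<in>J. cst (A i j) * y j))) \<in> lid L"
    using A by (intro lid_sum lid_mult)
  moreover have "(\<Sum>i\<in>I. cst (c i) * (\<Sum>j\<in>J. cst (A i j) * y j))
      = (\<Sum>j\<in>J. (\<Sum>i\<in>I. cst (c i * A i j)) * y j)"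
    by (simp add: sum_distrib_left sum_distrib_right cst_mult mult.assoc) (rule sum.swap)
  moreover have "(\<Sum>i\<in>I. cst (c i * A i j)) = 0" if "j \<in> J" for j
  proof -
    have "(\<Sum>i\<in>I. cst (c i * A i j)) = cst (\<Sum>i\<in>I. c i * A i j)"
      by (induction I rule: infinite_finite_induct) (simp_all add: cst_add)
    then show ?thesis using c(2)[OF that] by simp
  qed
  ultimately have "(\<Sum>i\<in>I. cst (c i) * x i) \<in> lid L"
    by (simp add: right_diff_distrib sum_subtractf)
  then show False using ind c(1) by (auto simp: indep_mod_def)
qed

lemma span_mod_dd_power:
  assumes "L \<noteq> 0" shows "w \<in> span_mod L {..<ord L} (\<lambda>k. dd ^ k)"
proof -
  obtain r where r: "w - r \<in> lid L" "r = 0 \<or> ord r < ord L"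
    using right_division[OF assms] by blast
  have "(\<Sum>k<ord L. cst (cf r k) * dd ^ k) = r"
    by (rule ldo_expand[symmetric]) (use r(2) in \<open>auto simp: cf_eq_0\<close>)
  then show ?thesis using r(1) by (intro span_modI[where c = "cf r"]) simp
qed

lemma indep_mod_dd_power: "indep_mod L {..<ord L} (\<lambda>k. dd ^ k)"
  unfolding indep_mod_def
proof (intro allI impI ballI)
  fix c k assume s: "(\<Sum>i<ord L. cst (c i) * dd ^ i) \<in> lid L" and k: "k \<in> {..<ord L}"
  define x where "x = (\<Sum>i<ord L. cst (c i) * dd ^ i)"
  have cx: "cf x j = (if j < ord L then c j else 0)" for j
    by (simp add: x_def cf_sum cf_dd_power if_distrib cong: if_cong)
  have "ord x < ord L" using k by (subst ord_less_iff) (auto simp: cx)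
  then have "x = 0" using s lid_ord_less by (auto simp: x_def)
  then show "c k = 0" using cx[of k] k by simp
qed

lemma indep_mod_card_le_ord:
  assumes "L \<noteq> 0" "finite I" "indep_mod L I x"
  shows "card I \<le> ord L"
  using indep_mod_card_le[OF assms(2) _ assms(3) span_mod_dd_power[OF assms(1)]] by simp

lemma indep_mod_insert:
  assumes "finite I" "indep_mod L I x" "w \<notin> span_mod L I x" "j \<notin> I"
  shows "indep_mod L (insert j I) (x(j := w))"
  unfolding indep_mod_def
proof (intro allI impI)
  fix c assume "(\<Sum>i\<in>insert j I. cst (c i) * (x(j := w)) i) \<in> lid L"
  moreover have "(\<Sum>i\<in>I. cst (c i) * (x(j := w)) i) = (\<Sum>i\<in>I. cst (c i) * x i)"
    by (rule sum.cong) (use assms(4) in auto)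
  ultimately have s: "cst (c j) * w + (\<Sum>i\<in>I. cst (c i) * x i) \<in> lid L"
    using assms(1,4) by simp
  have "c j = 0"
  proof (rule ccontr)
    assume cj: "c j \<noteq> 0"
    have "cst (inverse (c j)) * (cst (c j) * w + (\<Sum>i\<in>I. cst (c i) * x i)) \<in> lid L"
      using s by (rule lid_mult)
    moreover have "cst (inverse (c j)) * (cst (c j) * w) = w"
      using cj by (simp add: mult.assoc[symmetric] flip: cst_mult)
    moreover have "cst (inverse (c j)) * (\<Sum>i\<in>I. cst (c i) * x i)
        = - (\<Sum>i\<in>I. cst (- (inverse (c j) * c i)) * x i)"
      by (simp add: sum_distrib_left cst_mult cst_uminus mult.assoc sum_negf)
    ultimately have "w - (\<Sum>i\<in>I. cst (- (inverse (c j) * c i)) * x i) \<in> lid L"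
      by (simp only: distrib_left) simp
    then show False using assms(3) span_modI by metis
  qed
  moreover have "\<forall>i\<in>I. c i = 0" using s \<open>c j = 0\<close> assms(2) by (simp add: indep_mod_def)
  ultimately show "\<forall>i\<in>insert j I. c i = 0" by blast
qed

lemma indep_mod_card_eq_imp_span:
  assumes "L \<noteq> 0" "finite I" "indep_mod L I x" "card I = ord L"
  shows "w \<in> span_mod L I x"
proof (rule ccontr)
  assume n: "w \<notin> span_mod L I x"
  define x' where "x' = (\<lambda>i. case i of None \<Rightarrow> w | Some i \<Rightarrow> x i)"
  \<comment> \<open>Moving the index set into the option type makes \<open>None\<close> a fresh
    index for \<open>w\<close>.\<close>
  have "indep_mod L (Some ` I) (\<lambda>i. x (the i))"
    using assms(3) by (simp add: indep_mod_def sum.reindex) (metis comp_def)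
  moreover have "w \<notin> span_mod L (Some ` I) (\<lambda>i. x (the i))"
    using n by (auto simp: span_mod_def sum.reindex)
  ultimately have "indep_mod L (insert None (Some ` I)) ((\<lambda>i. x (the i))(None := w))"
    using assms(2) by (intro indep_mod_insert) auto
  then have "card (insert None (Some ` I)) \<le> ord L"
    using assms(1,2) by (intro indep_mod_card_le_ord) auto
  then show False using assms(2,4) by (simp add: card_image)
qed

subsection \<open>Irreducibility over F_q(t) and the irreducible case\<close>

lemma poly_bezout:
  fixes P Q :: "'k::field poly"
  assumes "coprime P Q"
  obtains u v where "u * P + v * Q = 1"
proof -
  define J where "J = {u * P + v * Q |u v. True}"
  have nz: "\<exists>x. x \<in> J \<and> x \<noteq> 0"
  proof (rule ccontr)
    assume "\<not> (\<exists>x. x \<in> J \<and> x \<noteq> 0)"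
    moreover have "1 * P + 0 * Q \<in> J" "0 * P + 1 * Q \<in> J" unfolding J_def by blast+
    ultimately have "P = 0" "Q = 0" by auto
    then show False using assms by simp
  qed
  define g where "g = (ARG_MIN degree x. x \<in> J \<and> x \<noteq> 0)"
  have g: "g \<in> J" "g \<noteq> 0" and min: "\<And>x. x \<in> J \<Longrightarrow> x \<noteq> 0 \<Longrightarrow> degree g \<le> degree x"
    using arg_min_natI[of "\<lambda>x. x \<in> J \<and> x \<noteq> 0" _ degree]
      arg_min_nat_le[of "\<lambda>x. x \<in> J \<and> x \<noteq> 0" _ degree] nz by (auto simp: g_def)
  obtain a b where ab: "g = a * P + b * Q" using g by (auto simp: J_def)
  have dvd: "g dvd x" if x: "x \<in> J" for x
  proof -
    obtain u v where uv: "x = u * P + v * Q" using x by (auto simp: J_def)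
    have "x mod g = x - x div g * g" by (simp add: minus_div_mult_eq_mod)
    also have "\<dots> = (u - x div g * a) * P + (v - x div g * b) * Q"
      by (subst uv, subst (2) ab) (simp add: algebra_simps)
    finally have "x mod g \<in> J" unfolding J_def by blast
    then have "x mod g = 0" using min degree_mod_less'[OF g(2), of x] by force
    then show ?thesis by auto
  qed
  have "1 * P + 0 * Q \<in> J" "0 * P + 1 * Q \<in> J" unfolding J_def by blast+
  then have "g dvd P" "g dvd Q" using dvd by fastforce+
  then have "is_unit g" using assms coprime_common_divisor by blast
  then obtain h where "g * h = 1" by (metis dvdE)
  then have "(h * a) * P + (h * b) * Q = 1" unfolding ab by (simp add: algebra_simps)
  then show thesis by (rule that)
qed

text \<open>Invertibility modulo P lifts to P^m by multiplying Bezout identities. Hence whatever is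
  not divisible by P can be inverted on elements killed by a power of P.\<close>

lemma irreducible_bezout_power:
  fixes P Q :: "'k::field poly"
  assumes "irreducible P" "\<not> P dvd Q"
  obtains u v where "u * Q + v * P ^ m = 1"
proof -
  have "coprime Q P"
  proof (rule coprimeI)
    fix c assume c: "c dvd Q" "c dvd P"
    then obtain e where e: "P = c * e" by auto
    show "is_unit c"
    proof (rule ccontr)
      assume "\<not> is_unit c"
      then have "is_unit e" using assms(1) e irreducibleD by blast
      then have "P dvd c" using e by auto
      then show False using c(1) assms(2) dvd_trans by blast
    qed
  qed
  then obtain u v where uv: "u * Q + v * P = 1" by (rule poly_bezout)
  have "\<exists>a b. a * Q + b * P ^ m = 1"
  proof (induction m)
    case 0
    show ?case by (intro exI[of _ 0] exI[of _ 1]) simp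
  next
    case (Suc m)
    then obtain a b where ab: "a * Q + b * P ^ m = 1" by blast
    have "(u * a * Q + u * b * P ^ m + v * P * a) * Q + (v * b) * P ^ Suc m
        = (u * Q + v * P) * (a * Q + b * P ^ m)" by (simp add: algebra_simps)
    then show ?case using uv ab by (metis mult_1)
  qed
  then show thesis using that by blast
qed

lemma frob_emb_sum: "frob_emb (sum f A) = (\<Sum>i\<in>A. frob_emb (f i))"
  by (induction A rule: infinite_finite_induct) simp_all

lemma map_frob_emb_add: "map_poly frob_emb (P + Q) = map_poly frob_emb P + map_poly frob_emb Q"
  by (intro poly_eqI) (simp add: coeff_map_poly)

lemma map_frob_emb_mult: "map_poly frob_emb (P * Q) = map_poly frob_emb P * map_poly frob_emb Q"
  by (intro poly_eqI) (simp add: coeff_map_poly coeff_mult frob_emb_sum)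

lemma map_frob_emb_1: "map_poly frob_emb 1 = 1"
  by (simp add: one_pCons map_poly_pCons)

lemma map_frob_emb_inj: "map_poly frob_emb P = map_poly frob_emb Q \<Longrightarrow> P = Q"
  by (metis (no_types, lifting) coeff_map_poly frob_emb_0 frob_emb_inj poly_eqI)

lemma degree_map_frob_emb [simp]: "degree (map_poly frob_emb P) = degree P"
  by (rule degree_map_poly) simp

lemma frob_emb_of_nat: "frob_emb (of_nat k) = of_nat k"
  by (induction k) simp_all

lemma map_frob_emb_pderiv: "map_poly frob_emb (pderiv P) = pderiv (map_poly frob_emb P)"
  by (intro poly_eqI) (simp add: coeff_map_poly coeff_pderiv frob_emb_of_nat del: of_nat_Suc)

lemma map_ddt_mult: "map_poly ddt (P * Q) = map_poly ddt P * Q + P * map_poly ddt Q"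
  by (intro poly_eqI) (simp add: coeff_map_poly coeff_mult ddt_sum ddt_mult sum.distrib add.commute)

text \<open>A monic factor \<open>A\<close> of the image of a separable \<open>N\<close> divides its coefficientwise derivative,
  which has smaller degree.\<close>
lemma monic_factor_constant_coeffs:
  fixes N A B :: "'a::{finite,field} ratfun poly"
  assumes sep: "coprime N (pderiv N)" and AB: "map_poly frob_emb N = A * B" and lA: "lead_coeff A = 1"
  shows "map_poly ddt A = 0"
proof (rule ccontr)
  assume nz: "map_poly ddt A \<noteq> 0"
  define F where "F = map_poly frob_emb N"
  obtain u v where "u * N + v * pderiv N = 1" using sep by (rule poly_bezout)
  then have "map_poly frob_emb u * F + map_poly frob_emb v * pderiv F = 1"
    unfolding F_def by (metis map_frob_emb_1 map_frob_emb_add map_frob_emb_mult map_frob_emb_pderiv)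
  then obtain u' v' where uv: "u' * F + v' * pderiv F = 1" by blast
  have "map_poly ddt F = 0" unfolding F_def by (intro poly_eqI) (simp add: coeff_map_poly)
  then have d: "map_poly ddt A * B = A * (- map_poly ddt B)"
    by (simp add: F_def AB map_ddt_mult eq_neg_iff_add_eq_0)
  \<comment> \<open>Modulo A the Bezout identity reads B * v' * pderiv A = 1, so B is invertible
    there, whereas \<open>d\<close> says that B times the coefficientwise derivative of A is
    0.\<close>
  have "map_poly ddt A = map_poly ddt A * (u' * F + v' * pderiv F)" using uv by simp
  also have "\<dots> = A * (map_poly ddt A * u' * B + map_poly ddt A * v' * pderiv B)
      + map_poly ddt A * B * (v' * pderiv A)"
    by (simp add: F_def AB pderiv_mult algebra_simps)
  also have "\<dots> = A * (map_poly ddt A * u' * B + map_poly ddt A * v' * pderiv B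
      - map_poly ddt B * (v' * pderiv A))"
    unfolding d by (simp add: algebra_simps)
  finally have "A dvd map_poly ddt A" by (rule dvdI)
  then have "degree A \<le> degree (map_poly ddt A)" using nz by (rule dvd_imp_degree_le)
  moreover have "coeff (map_poly ddt A) k = 0" if "k \<ge> degree A" for k
    using that lA by (cases "k = degree A") (auto simp: coeff_map_poly coeff_eq_0)
  ultimately show False using nz by (metis leading_coeff_0_iff)
qed

text \<open>A factorization over F_q(t) descends to F_q(t^p): after scaling both factors to be
  monic, their coefficients have derivative 0. Each factor is scaled by the leading coefficient of
  the other, because the two multiply to 1.\<close>

lemma irreducible_map_frob_emb:
  fixes N :: "'a::{finite,field} ratfun poly"
  assumes monic: "lead_coeff N = 1" and irr: "irreducible N" and sep: "coprime N (pderiv N)"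
  shows "irreducible (map_poly frob_emb N)"
proof (rule irreducibleI)
  have dN: "degree N > 0" using irr monic
    by (metis gr0I is_unit_iff_degree irreducible_def)
  show "map_poly frob_emb N \<noteq> 0" using dN degree_map_frob_emb[of N] by fastforce
  show "\<not> is_unit (map_poly frob_emb N)"
    using dN degree_map_frob_emb[of N] is_unit_iff_degree by (metis degree_0 less_irrefl)
  fix A B assume AB: "map_poly frob_emb N = A * B"
  have l: "lead_coeff A * lead_coeff B = 1"
    using monic by (metis AB coeff_map_poly degree_map_frob_emb frob_emb_0 frob_emb_1 lead_coeff_mult)
  then have nz: "lead_coeff A \<noteq> 0" "lead_coeff B \<noteq> 0"
    by (metis mult_zero_left mult_zero_right zero_neq_one)+
  define A' B' where "A' = smult (lead_coeff B) A" and "B' = smult (lead_coeff A) B"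
  have mon: "lead_coeff A' = 1" "lead_coeff B' = 1"
    using l nz by (simp_all add: A'_def B'_def mult.commute)
  have AB': "map_poly frob_emb N = A' * B'"
    using l by (simp add: A'_def B'_def AB mult.commute)
  have "map_poly ddt A' = 0"
    using monic_factor_constant_coeffs[OF sep AB' mon(1)] .
  moreover have "map_poly ddt B' = 0"
    using AB' mult.commute by (intro monic_factor_constant_coeffs[OF sep _ mon(2), of A']) simp
  ultimately obtain C D where CD: "A' = map_poly frob_emb C" "B' = map_poly frob_emb D"
    using map_poly_frob_emb_of_ddt_0 by metis
  then have "N = C * D" using AB' by (metis map_frob_emb_inj map_frob_emb_mult)
  then have "is_unit C \<or> is_unit D" using irr irreducibleD by blast
  then have "degree A' = 0 \<or> degree B' = 0"
    using CD by (metis degree_map_frob_emb is_unit_iff_degree not_is_unit_0)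
  then show "is_unit A \<or> is_unit B"
    using nz by (auto simp: A'_def B'_def is_unit_iff_degree)
qed

definition ldecomp :: "'a::{finite,field} ldo \<Rightarrow> bool" where
  "ldecomp L \<longleftrightarrow> (\<exists>L1 L2. (\<exists>A B. A * L1 + B * L2 = 1) \<and> ord L1 > 0 \<and> ord L2 > 0 \<and>
     (\<forall>M. M \<in> lid L \<longleftrightarrow> M \<in> lid L1 \<and> M \<in> lid L2))"

section \<open>Elements killed by a power of n, and the case of irreducible n\<close>

locale separable_irreducible =
  fixes N :: "'a::{finite,field} ratfun poly"
  assumes monicN: "lead_coeff N = 1"
    and irrN: "irreducible N"
    and sepN: "coprime N (pderiv N)"
begin

definition Ne :: "'a ratfun poly" where "Ne = map_poly frob_emb N"
definition n :: "'a ldo" where "n = ysub Ne"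
definition d :: nat where "d = degree N"

lemma d_pos: "d > 0"
  unfolding d_def using irrN monicN by (metis gr0I is_unit_iff_degree irreducible_def)

lemma degree_Ne [simp]: "degree Ne = d"
  by (simp add: Ne_def d_def)

lemma Ne_nonzero [simp]: "Ne \<noteq> 0"
  using d_pos degree_Ne by fastforce

lemma irr_Ne: "irreducible Ne"
  unfolding Ne_def using monicN irrN sepN by (rule irreducible_map_frob_emb)

lemma degree_Ne_power [simp]: "degree (Ne ^ k) = k * d"
  by (simp add: degree_power_eq)

lemma central_n [simp]: "central n"
  by (simp add: n_def Ne_def)

lemma n_nonzero [simp]: "n \<noteq> 0"
  by (simp add: n_def)

lemma ord_n: "ord n = CHAR('a) * d"
  by (simp add: n_def ord_ysub)

lemma ord_n_pos: "ord n > 0"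
  using d_pos CHAR_pos_ff[where 'a = 'a] by (simp add: ord_n)

lemma lc_n_power [simp]: "lc (n ^ k) = 1"
proof -
  have "lc n = lead_coeff Ne" using CHAR_pos_ff[where 'a = 'a]
    by (simp add: n_def ord_ysub cf_ysub)
  also have "\<dots> = 1" using monicN by (simp add: Ne_def coeff_map_poly)
  finally show ?thesis by (induction k) (simp_all add: lc_mult)
qed

lemma n_power_commute: "n ^ k * x = x * n ^ k"
  by (simp add: central_commute)

lemma lid_mult_n: "x \<in> lid A \<Longrightarrow> n ^ k * x \<in> lid A" "n ^ k \<in> lid A \<Longrightarrow> n ^ k * x \<in> lid A"
  by (rule lid_mult) (simp_all add: n_power_commute lid_mult)

lemma n_power_lid_mono: "n ^ j \<in> lid A \<Longrightarrow> j \<le> k \<Longrightarrow> n ^ k \<in> lid A"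
  by (metis le_add_diff_inverse2 lid_mult power_add)

text \<open>Take m least with n^m w = 0 modulo A. If P kills w and Ne^i with i < m is the exact
  power of Ne in P, the Bezout identity for the cofactor shows that n^i already kills w.\<close>

lemma annihilator_power:
  fixes w :: "'a ldo"
  assumes "n ^ \<nu> * w \<in> lid A"
  obtains m where "m \<le> \<nu>" "n ^ m * w \<in> lid A" "\<And>P. ysub P * w \<in> lid A \<Longrightarrow> Ne ^ m dvd P"
proof -
  define m where "m = (LEAST m. n ^ m * w \<in> lid A)"
  have m: "n ^ m * w \<in> lid A" unfolding m_def using assms by (rule LeastI)
  have less: "n ^ j * w \<notin> lid A" if "j < m" for j using that not_less_Least unfolding m_def by blast
  have "Ne ^ i dvd P" if P: "ysub P * w \<in> lid A" and "i \<le> m" for i P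
    using \<open>i \<le> m\<close>
  proof (induction i)
    case (Suc i)
    then obtain Q where Q: "P = Ne ^ i * Q" by auto
    have "Ne dvd Q"
    proof (rule ccontr)
      assume "\<not> Ne dvd Q"
      then obtain u v where uv: "u * Q + v * Ne ^ m = 1"
        by (rule irreducible_bezout_power[OF irr_Ne])
      have "Ne ^ i = Ne ^ i * (u * Q + v * Ne ^ m)" unfolding uv by simp
      also have "\<dots> = u * P + (Ne ^ i * v) * Ne ^ m" by (simp add: Q algebra_simps)
      finally have "ysub (Ne ^ i) = ysub u * ysub P + ysub (Ne ^ i * v) * ysub (Ne ^ m)"
        by (metis ysub_add ysub_mult)
      then have "ysub (Ne ^ i) * w = ysub u * (ysub P * w) + ysub (Ne ^ i * v) * (ysub (Ne ^ m) * w)"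
        by (simp only: distrib_right mult.assoc)
      then have "n ^ i * w \<in> lid A"
        using P m by (auto simp: n_def ysub_power intro!: lid_add lid_mult)
      then show False using less[of i] Suc by simp
    qed
    then show ?case by (simp add: Q mult_dvd_mono)
  qed simp
  moreover have "m \<le> \<nu>" unfolding m_def using assms by (rule Least_le)
  ultimately show thesis using that m by blast
qed

lemma sum_indices_ysub:
  fixes w :: "'i \<Rightarrow> 'a ldo"
  assumes "finite I" "\<And>i. i \<in> I \<Longrightarrow> P i = (\<Sum>j<k i. monom (c (i, j)) j)"
  shows "(\<Sum>i\<in>I. ysub (P i) * w i)
    = (\<Sum>ij\<in>(SIGMA i:I. {..<k i}). cst (c ij) * (case ij of (i, j) \<Rightarrow> dd ^ (j * CHAR('a)) * w i))"
proof -
  have "ysub (P i) = (\<Sum>j<k i. cst (c (i, j)) * dd ^ (j * CHAR('a)))" if "i \<in> I" for i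
  proof -
    have "coeff (P i) j = (if j < k i then c (i, j) else 0)" for j
      using assms(2)[OF that] by (simp add: coeff_sum)
    moreover from this have "P i = 0 \<or> degree (P i) < k i"
      by (metis leading_coeff_0_iff)
    ultimately show ?thesis by (simp add: ysub_eq_sum_less)
  qed
  then have "(\<Sum>i\<in>I. ysub (P i) * w i)
      = (\<Sum>i\<in>I. \<Sum>j<k i. cst (c (i, j)) * dd ^ (j * CHAR('a)) * w i)"
    by (simp add: sum_distrib_right)
  also have "\<dots> = (\<Sum>(i, j)\<in>(SIGMA i:I. {..<k i}). cst (c (i, j)) * dd ^ (j * CHAR('a)) * w i)"
    using assms(1) by (simp add: sum.Sigma)
  finally show ?thesis by (simp add: case_prod_unfold mult.assoc)
qed

lemma poly_eq_sum_monom_less: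
  assumes "P = 0 \<or> degree P < k"
  shows "P = (\<Sum>j<k. monom (coeff P j) j)"
  using assms by (intro poly_eqI) (auto simp: coeff_sum coeff_eq_0 not_less)

text \<open>A polynomial of degree below k * d that is divisible by Ne^k is 0, so independence over
  K[Y] with these annihilators gives independence over K.\<close>

lemma indep_mod_family:
  fixes w :: "'i \<Rightarrow> 'a ldo"
  assumes "finite I"
    and dir: "\<And>P. (\<Sum>i\<in>I. ysub (P i) * w i) \<in> lid A \<Longrightarrow> \<forall>i\<in>I. Ne ^ k i dvd P i"
  shows "indep_mod A (SIGMA i:I. {..<k i * d}) (\<lambda>(i, j). dd ^ (j * CHAR('a)) * w i)"
  unfolding indep_mod_def
proof (intro allI impI)
  fix c :: "'i \<times> nat \<Rightarrow> 'a ratfun"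
  define P where "P = (\<lambda>i. \<Sum>j<k i * d. monom (c (i, j)) j)"
  have e: "(\<Sum>i\<in>I. ysub (P i) * w i)
      = (\<Sum>ij\<in>(SIGMA i:I. {..<k i * d}). cst (c ij) * (case ij of (i, j) \<Rightarrow> dd ^ (j * CHAR('a)) * w i))"
    by (rule sum_indices_ysub[OF assms(1)]) (simp only: P_def)
  assume "(\<Sum>ij\<in>(SIGMA i:I. {..<k i * d}). cst (c ij) * (case ij of (i, j) \<Rightarrow> dd ^ (j * CHAR('a)) * w i)) \<in> lid A"
  then have "(\<Sum>i\<in>I. ysub (P i) * w i) \<in> lid A"
    unfolding e .
  then have dvd: "\<forall>i\<in>I. Ne ^ k i dvd P i" by (rule dir)
  show "\<forall>ij\<in>(SIGMA i:I. {..<k i * d}). c ij = 0"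
  proof safe
    fix i j assume i: "i \<in> I" and j: "j < k i * d"
    have cP: "coeff (P i) l = (if l < k i * d then c (i, l) else 0)" for l
      by (simp add: P_def coeff_sum)
    have "P i = 0"
    proof (rule ccontr)
      assume nz: "P i \<noteq> 0"
      then have "k i * d \<le> degree (P i)" using dvd i dvd_imp_degree_le[of "Ne ^ k i" "P i"] by simp
      then show False using nz cP[of "degree (P i)"] by simp
    qed
    then show "c (i, j) = 0" using cP[of j] j by simp
  qed
qed

text \<open>Coefficients may be reduced modulo Ne^(k i), which leaves only the powers of
  \<partial>^p below k i * d. With \<open>indep_mod_family\<close> this computes the dimension of a
  sum of cyclic K[Y]-modules.\<close>

lemma span_mod_family:
  fixes w :: "'i \<Rightarrow> 'a ldo"
  assumes "finite I" and ann: "\<And>i. i \<in> I \<Longrightarrow> n ^ k i * w i \<in> lid A"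
    and z: "z - (\<Sum>i\<in>I. ysub (P i) * w i) \<in> lid A"
  shows "z \<in> span_mod A (SIGMA i:I. {..<k i * d}) (\<lambda>(i, j). dd ^ (j * CHAR('a)) * w i)"
proof -
  define R where "R = (\<lambda>i. P i mod Ne ^ k i)"
  have "R i = 0 \<or> degree (R i) < k i * d" for i
    using degree_mod_less[of "Ne ^ k i" "P i"] by (simp add: R_def)
  then have R: "R i = (\<Sum>j<k i * d. monom (coeff (R i) j) j)" for i
    by (rule poly_eq_sum_monom_less)
  have "ysub (P i) * w i - ysub (R i) * w i \<in> lid A" if "i \<in> I" for i
  proof -
    have e: "P i - R i = (P i div Ne ^ k i) * Ne ^ k i"
      by (simp add: R_def minus_mod_eq_div_mult)
    have "ysub (P i) - ysub (R i) = ysub (P i div Ne ^ k i) * n ^ k i"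
      unfolding n_def ysub_power[symmetric] ysub_mult[symmetric] ysub_diff[symmetric] e ..
    then have "ysub (P i) * w i - ysub (R i) * w i = ysub (P i div Ne ^ k i) * (n ^ k i * w i)"
      by (simp only: left_diff_distrib[symmetric] mult.assoc[symmetric])
    then show ?thesis using ann[OF that] by (simp add: lid_mult)
  qed
  then have "(\<Sum>i\<in>I. ysub (P i) * w i - ysub (R i) * w i) \<in> lid A"
    by (rule lid_sum)
  with z have "(z - (\<Sum>i\<in>I. ysub (P i) * w i)) + (\<Sum>i\<in>I. ysub (P i) * w i - ysub (R i) * w i) \<in> lid A"
    by (rule lid_add)
  then have "z - (\<Sum>i\<in>I. ysub (R i) * w i) \<in> lid A"
    by (simp add: sum_subtractf)
  also have "(\<Sum>i\<in>I. ysub (R i) * w i) = (\<Sum>ij\<in>(SIGMA i:I. {..<k i * d}).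
      cst ((\<lambda>(i, j). coeff (R i) j) ij) * (case ij of (i, j) \<Rightarrow> dd ^ (j * CHAR('a)) * w i))"
    by (rule sum_indices_ysub[OF assms(1)]) (simp add: R[symmetric])
  finally show ?thesis by (rule span_modI)
qed

lemma annihilator_degree_le:
  assumes "A \<noteq> 0" and dvd: "\<And>P. ysub P * w \<in> lid A \<Longrightarrow> Ne ^ m dvd P"
  shows "m * d \<le> ord A"
proof -
  have "indep_mod A (SIGMA i:{()}. {..<m * d}) (\<lambda>(i, j). dd ^ (j * CHAR('a)) * w)"
    by (rule indep_mod_family[where k = "\<lambda>_. m" and w = "\<lambda>_. w"]) (use dvd in auto)
  then have "card (SIGMA i:{()}. {..<m * d}) \<le> ord A"
    by (intro indep_mod_card_le_ord assms(1)) auto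
  then show ?thesis by simp
qed

text \<open>The class of 1 generates over K[Y] a copy of K[Y]/(Ne^k), whose dimension k * d is at
  most \<open>ord A\<close>. So a small order forces a small exponent k.\<close>

lemma exponent_bound:
  assumes "A \<noteq> 0" "n ^ \<nu> \<in> lid A" "ord A < Suc m * d"
  shows "n ^ m \<in> lid A"
proof -
  obtain k where k: "n ^ k * 1 \<in> lid A" "\<And>P. ysub P * 1 \<in> lid A \<Longrightarrow> Ne ^ k dvd P"
    using annihilator_power[of \<nu> 1 A] assms(2) by auto
  have "k * d \<le> ord A" using assms(1) k(2) by (rule annihilator_degree_le)
  then have "k < Suc m" using assms(3) by (metis mult_less_cancel2 order_le_less_trans)
  then show ?thesis using k(1) n_power_lid_mono[of k A m] by simp
qed

lemma not_ldecompI: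
  assumes A: "A \<noteq> 0" "n ^ \<nu> \<in> lid A" "ord A = k * d" "k > 0" "n ^ (k - 1) \<notin> lid A"
  shows "\<not> ldecomp A"
proof
  assume "ldecomp A"
  then obtain L1 L2 C D where cop: "C * L1 + D * L2 = 1" and pos: "ord L1 > 0" "ord L2 > 0"
    and lcm: "\<And>M. M \<in> lid A \<longleftrightarrow> M \<in> lid L1 \<and> M \<in> lid L2" by (auto simp: ldecomp_def)
  have key: "n ^ (k - 1) \<in> lid X"
    if X: "A \<in> lid X" and XY: "\<And>M. M \<in> lid X \<Longrightarrow> M \<in> lid Y \<Longrightarrow> M \<in> lid A"
      and cop: "\<exists>C D. C * X + D * Y = 1" and Y: "A \<in> lid Y" and pos: "ord Y > 0" for X Y
  proof -
    obtain q where q: "A = q * X" using X by (rule lidE)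
    with A have nz: "q \<noteq> 0" "X \<noteq> 0" by auto
    \<comment> \<open>X is a proper right divisor of A: otherwise X and A generate the same left
      ideal, X is a left multiple of Y, and coprimality puts 1 into the left ideal of Y.\<close>
    have "ord q \<noteq> 0"
    proof
      assume "ord q = 0"
      then obtain y where "y * q = 1" using nz(1) by (rule ord_0_inverse)
      then have "X = y * A" by (simp add: q mult.assoc[symmetric])
      then have "X \<in> lid Y" using Y by (simp add: lid_mult)
      moreover obtain C D where "C * X + D * Y = 1" using cop by blast
      ultimately have "1 \<in> lid Y" by (metis lid_add lid_mult lid_self)
      then show False using pos lid_ord_less[of 1 Y] by simp
    qed
    then have "ord X < k * d" using A(3) q nz by (simp add: ord_mult)
    moreover have "n ^ \<nu> \<in> lid X" using A(2) X lid_mono by blast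
    ultimately show ?thesis using exponent_bound[of X \<nu> "k - 1"] nz A(4) by simp
  qed
  have "A \<in> lid L1" "A \<in> lid L2" using lcm[of A] by auto
  moreover have "D * L2 + C * L1 = 1" using cop by (simp add: add.commute)
  ultimately have "n ^ (k - 1) \<in> lid L1" "n ^ (k - 1) \<in> lid L2"
    using key[of L1 L2] key[of L2 L1] lcm pos cop by blast+
  then show False using lcm A(5) by blast
qed

text \<open>The unit \<open>c\<close> is kept because the lemma is also applied to the two
  components of a hypothetical decomposition, which are not normalised.\<close>

lemma irreducible_case_powers:
  assumes irr: "\<And>x y. n = x * y \<Longrightarrow> ord x = 0 \<or> ord y = 0"
    and "n ^ \<nu> \<in> lid L"
  shows "\<exists>m\<le>\<nu>. \<exists>c. c \<noteq> 0 \<and> L = cst c * n ^ m"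
  using assms(2)
proof (induction \<nu> arbitrary: L)
  case 0
  then obtain q where q: "1 = q * L" by (auto elim: lidE)
  then have "q \<noteq> 0" "L \<noteq> 0" by auto
  then have "ord L = 0" using q by (metis add_is_0 ord_1 ord_mult)
  then have "L = cst (cf L 0)" by (rule ord_eq_0_imp_cst)
  moreover from this have "cf L 0 \<noteq> 0" using \<open>L \<noteq> 0\<close> by auto
  ultimately show ?case by auto
next
  case (Suc \<nu>)
  define J where "J = {a * L + b * n |a b. True}"
  have "0 * L + 1 * n \<in> J" "1 * L + 0 * n \<in> J" unfolding J_def by blast+
  then have n: "n \<in> J" and L: "L \<in> J" by simp_all
  obtain G where G: "J = lid G" "G \<noteq> 0"
  proof (rule left_ideal_principal[of J])
    show "0 \<in> J" unfolding J_def by (auto intro!: exI[of _ 0])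
    show "J \<noteq> {0}" using n by auto
    show "x + y \<in> J" if xy: "x \<in> J" "y \<in> J" for x y
    proof -
      obtain a b a' b' where "x = a * L + b * n" "y = a' * L + b' * n"
        using xy unfolding J_def by blast
      then have "x + y = (a + a') * L + (b + b') * n" by (simp add: algebra_simps)
      then show ?thesis unfolding J_def by blast
    qed
    show "y * x \<in> J" if x: "x \<in> J" for x y
    proof -
      obtain a b where "x = a * L + b * n" using x unfolding J_def by blast
      then have "y * x = (y * a) * L + (y * b) * n" by (simp add: algebra_simps)
      then show ?thesis unfolding J_def by blast
    qed
  qed
  obtain x where x: "n = x * G" using n G(1) by (auto elim: lidE)
  from irr[OF x] show ?case
  proof
    assume "ord G = 0"
    then obtain y where "y * G = 1" using G(2) by (rule ord_0_inverse)
    then have "1 \<in> J" unfolding G(1) by (metis lidI)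
    then obtain a b where ab: "1 = a * L + b * n" unfolding J_def by blast
    \<comment> \<open>Coprime case: multiplying 1 = a L + b n by n^\<nu> lowers the exponent, since
      n^(\<nu>+1) is a left multiple of L.\<close>
    have "n ^ \<nu> = n ^ \<nu> * (a * L + b * n)" using ab by simp
    also have "\<dots> = n ^ \<nu> * a * L + b * n ^ Suc \<nu>"
      by (simp add: distrib_left mult.assoc n_power_commute power_commutes)
    also have "\<dots> \<in> lid L" using Suc.prems by (intro lid_add lid_mult) (auto intro: lidI)
    finally show ?thesis using Suc.IH le_SucI by blast
  next
    assume "ord x = 0"
    moreover have "x \<noteq> 0" using x n_nonzero by auto
    ultimately obtain z where "z * x = 1" by (rule ord_0_inverse)
    then have "G = z * n" by (simp add: x mult.assoc[symmetric])
    then obtain y where y: "L = y * n" using L G(1) by (metis lidE mult.assoc)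
    obtain q where "n ^ Suc \<nu> = q * L" using Suc.prems by (rule lidE)
    then have "(n ^ \<nu> - q * y) * n = 0" by (simp add: y left_diff_distrib mult.assoc power_commutes)
    then have "n ^ \<nu> = q * y" by simp
    then obtain m c where "m \<le> \<nu>" "c \<noteq> 0" "y = cst c * n ^ m" using Suc.IH[of y] lidI by blast
    then have "Suc m \<le> Suc \<nu>" "c \<noteq> 0" "L = cst c * n ^ Suc m"
      by (auto simp: y mult.assoc power_commutes)
    then show ?thesis by blast
  qed
qed

lemma irreducible_case:
  assumes irr: "\<And>x y. n = x * y \<Longrightarrow> ord x = 0 \<or> ord y = 0"
    and L: "n ^ \<nu> \<in> lid L" "lc L = 1"
  shows "(\<exists>m\<le>\<nu>. L = n ^ m) \<and> \<not> ldecomp L"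
proof -
  obtain m c where m: "m \<le> \<nu>" "c \<noteq> 0" "L = cst c * n ^ m"
    using irreducible_case_powers[OF irr L(1)] by blast
  then have "lc L = c" by (simp add: ord_cst_mult)
  then have Lm: "L = n ^ m" using m L(2) by simp
  have "\<not> ldecomp L"
  proof
    assume "ldecomp L"
    then obtain L1 L2 C D where cop: "C * L1 + D * L2 = 1" and pos: "ord L1 > 0" "ord L2 > 0"
      and lcm: "\<And>M. M \<in> lid L \<longleftrightarrow> M \<in> lid L1 \<and> M \<in> lid L2" by (auto simp: ldecomp_def)
    \<comment> \<open>Both components of a decomposition would be powers of n with positive exponent
      up to a unit, hence not coprime.\<close>
    have key: "X \<in> lid n" if "L \<in> lid X" "ord X > 0" for X
    proof -
      have "n ^ m \<in> lid X" using that Lm by simp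
      then obtain a c where X: "X = cst c * n ^ a" "c \<noteq> 0"
        using irreducible_case_powers[OF irr, of m X] by blast
      then have "a \<noteq> 0" using that(2) by (cases a) (auto simp: ord_cst_mult)
      then have "X = cst c * n ^ (a - 1) * n" using X
        by (simp add: mult.assoc power_commutes flip: power_Suc)
      then show ?thesis by (rule lidI)
    qed
    have "L1 \<in> lid n" "L2 \<in> lid n" using key lcm[of L] pos by auto
    then have "1 \<in> lid n" using cop by (metis lid_add lid_mult)
    then show False using ord_n_pos lid_ord_less[of 1 n] by simp
  qed
  then show ?thesis using Lm m(1) by blast
qed

end

subsection \<open>A connection with nilpotent p-curvature\<close>

definition adj :: "'b::ring_1 \<Rightarrow> 'b \<Rightarrow> 'b" where "adj x u = x * u - u * x"

text \<open>Left multiplication by x is the sum of \<open>adj x\<close> and right multiplication by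
  x. These two commute, so this is the binomial theorem.\<close>

lemma power_mult_adj:
  fixes x u :: "'b::ring_1"
  shows "x ^ m * u = (\<Sum>j\<le>m. of_nat (m choose j) * (adj x ^^ j) u * x ^ (m - j))"
proof (induction m)
  case (Suc m)
  define E where "E = (\<lambda>j. (adj x ^^ j) u)"
  have xE: "x * E j = E j * x + E (Suc j)" for j
    by (simp add: E_def adj_def)
  have "x ^ Suc m * u = x * (\<Sum>j\<le>m. of_nat (m choose j) * E j * x ^ (m - j))"
    using Suc by (simp add: E_def mult.assoc)
  also have "\<dots> = (\<Sum>j\<le>m. of_nat (m choose j) * (x * E j) * x ^ (m - j))"
    unfolding sum_distrib_left by (intro sum.cong refl) (metis mult.assoc mult_of_nat_commute)
  also have "\<dots> = (\<Sum>j\<le>m. of_nat (m choose j) * E j * x ^ (Suc m - j))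
      + (\<Sum>j\<le>m. of_nat (m choose j) * E (Suc j) * x ^ (m - j))"
    unfolding sum.distrib[symmetric]
    by (intro sum.cong refl) (simp add: xE distrib_left distrib_right mult.assoc Suc_diff_le)
  also have "(\<Sum>j\<le>m. of_nat (m choose j) * E j * x ^ (Suc m - j))
      = (\<Sum>j\<le>Suc m. of_nat (m choose j) * E j * x ^ (Suc m - j))"
    by (simp add: binomial_eq_0)
  also have "\<dots> = E 0 * x ^ Suc m + (\<Sum>j\<le>m. of_nat (m choose Suc j) * E (Suc j) * x ^ (m - j))"
    by (subst sum.atMost_Suc_shift) simp
  also have "\<dots> + (\<Sum>j\<le>m. of_nat (m choose j) * E (Suc j) * x ^ (m - j))
      = E 0 * x ^ Suc m + (\<Sum>j\<le>m. of_nat (Suc m choose Suc j) * E (Suc j) * x ^ (Suc m - Suc j))"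
    by (simp add: sum.distrib[symmetric] distrib_right add.commute add.assoc)
  also have "\<dots> = (\<Sum>j\<le>Suc m. of_nat (Suc m choose j) * E j * x ^ (Suc m - j))"
    by (subst sum.atMost_Suc_shift) simp
  finally show ?case by (simp only: E_def)
qed simp

text \<open>With l and r for left and right multiplication by x, the left side is (l^m - r^m)/(l -
  r) applied to u, where l - r = \<open>adj x\<close>; expand (\<open>adj x\<close> + r)^m.\<close>

lemma sum_power_mult_power_adj:
  fixes x u :: "'b::ring_1"
  shows "(\<Sum>i<m. x ^ i * u * x ^ (m - 1 - i))
    = (\<Sum>j<m. of_nat (m choose Suc j) * (adj x ^^ j) u * x ^ (m - 1 - j))"
proof (induction m)
  case (Suc m)
  have e: "x ^ (m - Suc i) * x = x ^ (m - i)" if "i < m" for i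
    using that by (metis Suc_diff_Suc power_Suc2)
  have "(\<Sum>i<Suc m. x ^ i * u * x ^ (Suc m - 1 - i)) = (\<Sum>i<m. x ^ i * u * x ^ (m - 1 - i)) * x + x ^ m * u"
    by (simp add: sum_distrib_right mult.assoc e)
  also have "\<dots> = (\<Sum>j<m. of_nat (m choose Suc j) * (adj x ^^ j) u * x ^ (m - j))
      + (\<Sum>j\<le>m. of_nat (m choose j) * (adj x ^^ j) u * x ^ (m - j))"
    unfolding Suc power_mult_adj[of x m u] by (simp add: sum_distrib_right mult.assoc e)
  also have "(\<Sum>j<m. of_nat (m choose Suc j) * (adj x ^^ j) u * x ^ (m - j))
      = (\<Sum>j\<le>m. of_nat (m choose Suc j) * (adj x ^^ j) u * x ^ (m - j))"
    by (simp add: binomial_eq_0 flip: lessThan_Suc_atMost)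
  finally show ?case
    by (simp add: sum.distrib[symmetric] distrib_right add.commute flip: lessThan_Suc_atMost)
qed simp

text \<open>Only the term \<open>j = p - 1\<close> of \<open>sum_power_mult_power_adj\<close> survives, since p divides the other
  binomial coefficients.\<close>
lemma sum_power_mult_power_prime:
  fixes x u :: "'b::ring_1"
  assumes "prime p" "of_nat p = (0 :: 'b)"
  shows "(\<Sum>i<p. x ^ i * u * x ^ (p - 1 - i)) = (adj x ^^ (p - 1)) u"
proof -
  have p: "p > 0" using assms(1) prime_gt_0_nat by blast
  have z: "of_nat (p choose Suc j) = (0 :: 'b)" if "j < p - 1" for j
  proof -
    have "p dvd (p choose Suc j)" using that assms(1) by (intro dvd_choose_prime) auto
    then show ?thesis using assms(2) by (metis dvdE mult_zero_left of_nat_mult)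
  qed
  have "(\<Sum>j<p. of_nat (p choose Suc j) * (adj x ^^ j) u * x ^ (p - 1 - j))
      = (\<Sum>j<p. if j = p - 1 then (adj x ^^ j) u else 0)"
    by (rule sum.cong) (use z p in auto)
  then show ?thesis unfolding sum_power_mult_power_adj using p by simp
qed

text \<open>Expansion to first order in the central element e. For m = p the linear coefficient is
  evaluated by \<open>sum_power_mult_power_prime\<close>.\<close>

lemma perturbed_power:
  fixes x u e :: "'b::ring_1"
  assumes e: "\<And>z. z * e = e * z"
  shows "\<exists>r. (x - e * u) ^ m = x ^ m - e * (\<Sum>i<m. x ^ i * u * x ^ (m - 1 - i)) + e * e * r"
proof (induction m)
  case 0
  show ?case by (intro exI[of _ 0]) simp
next
  case (Suc m)
  define T where "T = (\<Sum>i<m. x ^ i * u * x ^ (m - 1 - i))"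
  obtain r where r: "(x - e * u) ^ m = x ^ m - e * T + e * e * r" using Suc by (auto simp: T_def)
  have ex: "x ^ (m - Suc i) * x = x ^ (m - i)" if "i < m" for i
    using that by (metis Suc_diff_Suc power_Suc2)
  have T': "(\<Sum>i<Suc m. x ^ i * u * x ^ (Suc m - 1 - i)) = T * x + x ^ m * u"
    by (simp add: T_def sum_distrib_right mult.assoc ex)
  have c1: "x ^ m * (e * u) = e * (x ^ m * u)" "T * (e * u) = e * (T * u)" "r * (e * u) = e * (r * u)"
    by (metis e mult.assoc)+
  have "(x - e * u) ^ Suc m = (x ^ m - e * T + e * e * r) * (x - e * u)"
    unfolding r[symmetric] by (simp add: power_commutes)
  also have "\<dots> = x ^ Suc m - e * (T * x + x ^ m * u) + e * e * (T * u + r * x - e * (r * u))"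
    by (simp add: distrib_left distrib_right left_diff_distrib right_diff_distrib mult.assoc c1
        power_commutes flip: power_Suc)
  finally show ?case unfolding T' by blast
qed

text \<open>For \<open>m \<ge> p\<close> the factorial vanishes and \<open>divpow m\<close> is the junk value 0.\<close>
definition divpow :: "nat \<Rightarrow> 'a::{finite,field} ratfun" where
  "divpow m = tvar ^ m * inverse (of_nat (fact m))"

lemma divpow_0 [simp]: "divpow 0 = 1"
  by (simp add: divpow_def)

lemma ddt_power: "ddt (x ^ Suc m) = of_nat (Suc m) * x ^ m * ddt x"
  by (induction m) (simp_all add: ddt_mult algebra_simps)

lemma ddt_divpow:
  assumes "Suc m < CHAR('a)"
  shows "ddt (divpow (Suc m) :: 'a::{finite,field} ratfun) = divpow m"
proof -
  have nz: "of_nat (fact (Suc m)) \<noteq> (0 :: 'a ratfun)"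
    using assms CHAR_prime_ff[where 'a = 'a] prime_dvd_fact_iff
    by (metis not_less of_nat_ratfun_eq_0_iff)
  define c where "c = inverse (of_nat (fact (Suc m)) :: 'a ratfun)"
  have "0 = ddt (of_nat (fact (Suc m)) * c)" using nz by (simp add: c_def del: of_nat_mult fact_Suc)
  then have dc: "ddt c = 0" using nz by (simp add: ddt_mult del: of_nat_mult fact_Suc)
  have f: "of_nat (fact (Suc m)) = of_nat (Suc m) * (of_nat (fact m) :: 'a ratfun)"
    by (simp only: fact_Suc of_nat_mult) simp
  have "of_nat (Suc m) * c = inverse (of_nat (fact m))"
    using nz unfolding c_def f by (simp add: field_simps del: of_nat_Suc)
  then have "of_nat (Suc m) * tvar ^ m * c = tvar ^ m * inverse (of_nat (fact m))"
    by (metis mult.assoc mult.commute)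
  then show ?thesis
    unfolding divpow_def c_def[symmetric] by (simp add: ddt_mult ddt_power dc del: of_nat_Suc power_Suc)
qed

lemma funpow_ddt_divpow:
  "m < CHAR('a) \<Longrightarrow> (ddt ^^ m) (divpow m :: 'a::{finite,field} ratfun) = 1"
  by (induction m) (simp_all add: ddt_divpow funpow_swap1 del: funpow.simps(2) add: funpow_Suc_right)

lemma commutes_cst_imp_ysub:
  assumes "\<And>a. z * cst a = cst a * z"
  shows "z * ysub P = ysub P * z"
proof (induction P)
  case (pCons a P)
  have "z * ysub (pCons a P) = cst a * z + (z * ysub P) * yy"
    by (simp only: ysub_pCons distrib_left assms mult.assoc)
  also have "\<dots> = cst a * z + ysub P * (yy * z)"
    unfolding pCons.IH by (metis mult.assoc central_commute central_yy)
  finally show ?case by (simp only: ysub_pCons distrib_right mult.assoc)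
qed simp

lemma nabla_cst: "(dd - ysub f) * cst a = cst a * (dd - ysub f) + cst (ddt a)"
  by (simp add: left_diff_distrib right_diff_distrib dd_cst ysub_cst_commute)

text \<open>The p-th power commutes with F_q(t), hence with \<open>ysub f\<close>; it also commutes
  with its own base, so it commutes with the sum of the two, which is \<open>dd\<close>.\<close>

lemma central_nabla_power:
  fixes f :: "'a::{finite,field} ratfun poly"
  shows "central ((dd - ysub f) ^ CHAR('a))"
proof (rule centralI)
  define z where "z = (dd - ysub f) ^ CHAR('a)"
  show c: "(dd - ysub f) ^ CHAR('a) * cst a = cst a * (dd - ysub f) ^ CHAR('a)" for a
    by (rule power_CHAR_commutes_cst) (rule nabla_cst)
  then have "z * ysub f = ysub f * z" by (intro commutes_cst_imp_ysub) (simp add: z_def)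
  moreover have "z * (dd - ysub f) = (dd - ysub f) * z" by (simp add: z_def power_commutes)
  ultimately have "z * dd = dd * z" by (simp add: left_diff_distrib right_diff_distrib)
  then show "(dd - ysub f) ^ CHAR('a) * dd = dd * (dd - ysub f) ^ CHAR('a)" by (simp add: z_def)
qed

text \<open>Commutators with \<open>G\<close> lie in its left ideal, so they vanish once their order
  is below that of \<open>G\<close>. For scalars the top terms cancel because
  \<open>lc G = 1\<close>; this yields \<open>G = ysub P\<close>, and then the commutator with
  \<open>dd\<close> is the coefficientwise derivative of the monic P.\<close>

lemma two_sided_generator_central:
  assumes G: "lc G = 1" and right: "\<And>x. G * x \<in> lid G"
  shows "central G"
proof -
  have nz: "G \<noteq> 0" using G by auto
  have zero: "z = 0" if zG: "z \<in> lid G" and top: "\<And>k. k \<ge> ord G \<Longrightarrow> cf z k = 0" for z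
  proof (rule ccontr)
    assume z: "z \<noteq> 0"
    obtain q where q: "z = q * G" using zG by (rule lidE)
    then have "q \<noteq> 0" using z by auto
    then have "ord z \<ge> ord G" using q nz by (simp add: ord_mult)
    then show False using top z lc_eq_0_iff by blast
  qed
  have c: "G * cst a = cst a * G" for a
  proof -
    have "G * cst a - cst a * G = 0"
    proof (rule zero)
      show "G * cst a - cst a * G \<in> lid G" by (rule lid_diff[OF right lid_mult[OF lid_self]])
      fix k assume k: "k \<ge> ord G"
      show "cf (G * cst a - cst a * G) k = 0"
      proof (cases "a = 0")
        case False
        then have o: "ord (G * cst a) = ord G" using nz by (simp add: ord_mult)
        have "cf (cst a) 0 = a" using cf_cst_mult[of a 1 0] by simp
        then have "cf (G * cst a) (ord G) = a" using lc_mult[of G "cst a"] G o by simp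
        then show ?thesis using k o G by (cases "k = ord G") (auto simp: cf_eq_0)
      qed simp
    qed
    then show ?thesis by simp
  qed
  obtain P where P: "G = ysub P" using commutes_tvar_imp_ysub c by metis
  have "dd * G - G * dd = ysub (map_poly ddt P)" unfolding P using dd_ysub[of P] by simp
  moreover have "dd * G - G * dd = 0"
  proof (rule zero)
    show "dd * G - G * dd \<in> lid G" by (rule lid_diff[OF lid_mult[OF lid_self] right])
    fix k assume k: "k \<ge> ord G"
    have "coeff P (degree P) = 1" using G unfolding P ord_ysub cf_ysub
      using CHAR_pos_ff[where 'a = 'a] by simp
    then have "ddt (coeff P j) = 0" if "j \<ge> degree P" for j
      using that by (cases "j = degree P") (auto simp: coeff_eq_0)
    moreover have "k div CHAR('a) \<ge> degree P" using k CHAR_pos_ff[where 'a = 'a] unfolding P ord_ysub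
      by (metis div_le_mono nonzero_mult_div_cancel_left less_numeral_extra(3))
    ultimately show "cf (dd * G - G * dd) k = 0"
      unfolding \<open>dd * G - G * dd = ysub (map_poly ddt P)\<close> cf_ysub by (simp add: coeff_map_poly)
  qed
  ultimately show ?thesis by (intro centralI c) simp
qed

section \<open>Right divisors of n of minimal order, and the construction of \<nabla>\<close>

context separable_irreducible
begin

lemma n_mult_lid: "n \<in> lid A \<Longrightarrow> n * w \<in> lid A"
  unfolding central_commute[OF central_n, of w] by (rule lid_mult)

text \<open>The quotient modulo the left ideal of \<open>l\<close> is a vector space over the field K[Y]/(Ne),
  which has dimension \<open>d\<close> over K = F_q(t).\<close>
lemma d_dvd_ord:
  assumes l: "l \<noteq> 0" "n \<in> lid l"
  shows "d dvd ord l"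
proof -
  \<comment> \<open>\<open>ind s h\<close> says that h 0, ..., h (s - 1) are linearly independent
    over the field K[Y]/(Ne). A family of greatest length is then a basis.\<close>
  define ind where "ind = (\<lambda>s (h :: nat \<Rightarrow> 'a ldo). \<forall>P. (\<Sum>i<s. ysub (P i) * h i) \<in> lid l \<longrightarrow> (\<forall>i<s. Ne dvd P i))"
  have card: "indep_mod l (SIGMA i:{..<s}. {..<1 * d}) (\<lambda>(i, j). dd ^ (j * CHAR('a)) * h i)" if "ind s h" for s h
    by (rule indep_mod_family[where k = "\<lambda>_. 1" and w = h]) (use that in \<open>auto simp: ind_def\<close>)
  have bound: "s * d \<le> ord l" if "ind s h" for s h
    using indep_mod_card_le_ord[OF l(1) _ card[OF that]] by simp
  define s where "s = (GREATEST s. \<exists>h. ind s h)"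
  have b: "s \<le> ord l" if ex: "\<exists>h. ind s h" for s
  proof -
    have "s * d \<le> ord l" using ex bound by blast
    moreover have "s \<le> s * d" using d_pos by simp
    ultimately show ?thesis by (rule le_trans[rotated])
  qed
  have "ind 0 (\<lambda>_. 0)" by (simp add: ind_def)
  then have "\<exists>h. ind 0 h" by blast
  then have "\<exists>h. ind s h" unfolding s_def
    by (rule GreatestI_nat[where P = "\<lambda>s. \<exists>h. ind s h" and b = "ord l"]) (rule b)
  then obtain h where h: "ind s h" by blast
  have "k \<le> s" if "\<exists>h. ind k h" for k
    unfolding s_def using that b by (rule Greatest_le_nat[where P = "\<lambda>s. \<exists>h. ind s h"])
  from this[of "Suc s"] have max: "\<not> ind (Suc s) h'" for h' by auto
  have nl: "n * w \<in> lid l" for w using l(2) by (rule n_mult_lid)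
  have sp: "w \<in> span_mod l (SIGMA i:{..<s}. {..<1 * d}) (\<lambda>(i, j). dd ^ (j * CHAR('a)) * h i)" for w
  proof -
    obtain P where P: "(\<Sum>i<Suc s. ysub (P i) * (h(s := w)) i) \<in> lid l" "\<exists>i<Suc s. \<not> Ne dvd P i"
      using max[of "h(s := w)"] unfolding ind_def by blast
    have P1: "(\<Sum>i<s. ysub (P i) * h i) + ysub (P s) * w \<in> lid l" using P(1) by simp
    \<comment> \<open>The coefficient of w is invertible modulo Ne: if Ne divided it, its term would
      vanish in the quotient and \<open>h\<close> alone would be dependent.\<close>
    have nd: "\<not> Ne dvd P s"
    proof
      assume dv: "Ne dvd P s"
      then obtain Q where "P s = Q * Ne" by (metis dvdE mult.commute)
      then have "ysub (P s) * w = ysub Q * (n * w)" by (simp add: ysub_mult n_def mult.assoc)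
      then have "ysub (P s) * w \<in> lid l" using nl by (simp add: lid_mult)
      then have "(\<Sum>i<s. ysub (P i) * h i) + ysub (P s) * w - ysub (P s) * w \<in> lid l"
        by (rule lid_diff[OF P1])
      then have "(\<Sum>i<s. ysub (P i) * h i) \<in> lid l" by simp
      then have "\<forall>i<s. Ne dvd P i" using h by (simp add: ind_def)
      then show False using P(2) dv by (metis less_Suc_eq)
    qed
    obtain u v where uv: "u * P s + v * Ne ^ 1 = 1" using irreducible_bezout_power[OF irr_Ne nd] .
    have "w = ysub (u * P s + v * Ne) * w" using uv by simp
    also have "\<dots> = ysub u * (ysub (P s) * w) + ysub v * (n * w)"
      by (simp only: ysub_add ysub_mult n_def distrib_right mult.assoc)
    finally have w: "w = ysub u * (ysub (P s) * w) + ysub v * (n * w)" .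
    have "ysub u * ((\<Sum>i<s. ysub (P i) * h i) + ysub (P s) * w) + ysub v * (n * w) \<in> lid l"
      by (rule lid_add[OF lid_mult[OF P1] lid_mult[OF nl]])
    moreover have "ysub u * ((\<Sum>i<s. ysub (P i) * h i) + ysub (P s) * w) + ysub v * (n * w)
        = w - (\<Sum>i<s. ysub (- (u * P i)) * h i)"
      unfolding distrib_left add.assoc w[symmetric]
      by (simp add: sum_distrib_left ysub_uminus ysub_mult mult.assoc sum_negf add.commute)
    ultimately have "w - (\<Sum>i<s. ysub (- (u * P i)) * h i) \<in> lid l" by simp
    then show ?thesis
      by (intro span_mod_family[where k = "\<lambda>_. 1" and w = h and P = "\<lambda>i. - (u * P i)"]) (use nl in simp_all)
  qed
  have "card {..<ord l} \<le> card (SIGMA i:{..<s}. {..<1 * d})"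
    by (rule indep_mod_card_le[OF _ _ indep_mod_dd_power sp]) auto
  then have "ord l = s * d" using bound[OF h] by simp
  then show ?thesis by simp
qed

text \<open>A two-sided ideal is generated by a central element, which corresponds to a factor of \<open>N\<close>.\<close>
lemma annihilator_subset:
  assumes l: "ord l > 0" "n \<in> lid l" and g: "\<And>h. g * h \<in> lid l"
  shows "g \<in> lid n"
proof -
  define I where "I = {g. \<forall>h. g * h \<in> lid l}"
  have "n * h \<in> lid l" for h using l(2) by (rule n_mult_lid)
  then have nI: "n \<in> I" by (simp add: I_def)
  obtain G where G: "I = lid G" "G \<noteq> 0" "lc G = 1"
  proof (rule left_ideal_principal[of I])
    show "I \<noteq> {0}" using nI n_nonzero by blast
    show "0 \<in> I" by (simp add: I_def)
    show "x + y \<in> I" if "x \<in> I" "y \<in> I" for x y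
      using that by (simp add: I_def distrib_right lid_add)
    show "y * x \<in> I" if "x \<in> I" for x y
      using that by (simp add: I_def mult.assoc lid_mult)
  qed
  have GI: "G \<in> I" unfolding G(1) by simp
  have "G * x \<in> I" for x using GI by (simp add: I_def mult.assoc)
  then have cG: "central G" using G(1,3) by (intro two_sided_generator_central) auto
  obtain x where x: "n = x * G" using nI unfolding G(1) by (rule lidE)
  have cx: "central x"
  proof (rule central_cancel_left)
    show "central (G * x)" unfolding central_commute[OF cG] x[symmetric] by simp
  qed (rule cG G(2))+
  obtain Q where Q: "G = ysub (map_poly frob_emb Q)" using cG by (rule central_imp_ysub)
  obtain Q' where Q': "x = ysub (map_poly frob_emb Q')" using cx by (rule central_imp_ysub)
  have "ysub (map_poly frob_emb N) = ysub (map_poly frob_emb (Q' * Q))"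
    unfolding map_frob_emb_mult ysub_mult Q[symmetric] Q'[symmetric] x[symmetric] n_def Ne_def ..
  then have "N = Q' * Q" by (rule map_frob_emb_inj[OF ysub_inj])
  then have "is_unit Q' \<or> is_unit Q" using irrN irreducibleD by blast
  then have "ord x = 0 \<or> ord G = 0"
    unfolding Q Q' ord_ysub by (metis degree_map_frob_emb is_unit_iff_degree mult_0_right not_is_unit_0)
  then have "G \<in> lid n"
  proof
    assume "ord x = 0"
    moreover have "x \<noteq> 0" using x n_nonzero by auto
    ultimately obtain y where "y * x = 1" by (rule ord_0_inverse)
    then have "G = y * n" by (simp add: x mult.assoc[symmetric])
    then show ?thesis by (rule lidI)
  next
    assume "ord G = 0"
    then obtain y where "y * G = 1" using G(2) by (rule ord_0_inverse)
    then have "1 \<in> I" unfolding G(1) by (metis lidI)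
    then have "1 * 1 \<in> lid l" unfolding I_def by blast
    then show ?thesis using l(1) lid_ord_less[of 1 l] by simp
  qed
  moreover have "g \<in> lid G" using g G(1) by (auto simp: I_def)
  ultimately show ?thesis using lid_mono by blast
qed

text \<open>Let G be a right divisor of n of greatest order among those whose order is a multiple of
  \<open>ord l\<close>. If G does not kill some h modulo l, the annihilator l' of the class of G h
  has order \<open>ord l\<close>, and l' * G is a larger such divisor. So G kills the whole
  quotient, hence lies in R n and has the order of n.\<close>

lemma minimal_ord_dvd:
  assumes l: "n \<in> lid l" "ord l > 0"
    and min: "\<And>x. n \<in> lid x \<Longrightarrow> ord x > 0 \<Longrightarrow> ord l \<le> ord x"
  shows "ord l dvd ord n"
proof -
  have l0: "l \<noteq> 0" using l(2) by auto
  have nl: "n * w \<in> lid l" for w using l(1) by (rule n_mult_lid)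
  \<comment> \<open>The order of the annihilator is at least \<open>ord l\<close> by minimality, and
    at most \<open>ord l\<close> because the \<open>ord l + 1\<close> elements dd^k h are dependent
    in a space of dimension \<open>ord l\<close>.\<close>
  have ann: "\<exists>m. m \<noteq> 0 \<and> ord m = ord l \<and> (\<forall>g. g \<in> lid m \<longleftrightarrow> g * h \<in> lid l)" if h: "h \<notin> lid l" for h
  proof -
    define J where "J = {g. g * h \<in> lid l}"
    obtain m where m: "J = lid m" "m \<noteq> 0"
    proof (rule left_ideal_principal[of J])
      have "n \<in> J" using nl by (simp add: J_def)
      then show "J \<noteq> {0}" using n_nonzero by blast
      show "0 \<in> J" by (simp add: J_def)
      show "x + y \<in> J" if "x \<in> J" "y \<in> J" for x y
        using that by (simp add: J_def distrib_right lid_add)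
      show "y * x \<in> J" if "x \<in> J" for x y
        using that by (simp add: J_def mult.assoc lid_mult)
    qed
    have nm: "n \<in> lid m" using nl m(1) by (auto simp: J_def)
    have "ord m > 0"
    proof (rule ccontr)
      assume "\<not> ord m > 0"
      then obtain y where "y * m = 1" using ord_0_inverse m(2) by blast
      then have "1 \<in> J" unfolding m(1) by (metis lidI)
      then show False using h by (simp add: J_def)
    qed
    then have ge: "ord l \<le> ord m" using min nm by blast
    have "\<not> indep_mod l {..ord l} (\<lambda>k. dd ^ k * h)"
      using indep_mod_card_le_ord[OF l0, of "{..ord l}" "\<lambda>k. dd ^ k * h"] by auto
    then obtain c k where c: "(\<Sum>i\<le>ord l. cst (c i) * (dd ^ i * h)) \<in> lid l" "k \<le> ord l" "c k \<noteq> 0"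
      by (auto simp: indep_mod_def)
    define g where "g = (\<Sum>i\<le>ord l. cst (c i) * dd ^ i)"
    have cg: "cf g j = (if j \<le> ord l then c j else 0)" for j
      by (simp add: g_def cf_sum cf_dd_power if_distrib cong: if_cong)
    have g0: "g \<noteq> 0" using cg[of k] c by auto
    have "ord g \<le> ord l" using cg[of "ord g"] g0 by (metis lc_eq_0_iff)
    have "g \<in> J" using c(1) by (simp add: J_def g_def sum_distrib_right mult.assoc)
    then have "ord m \<le> ord g" using g0 unfolding m(1) by (metis lid_ord_less not_less)
    then have "ord m = ord l" using ge \<open>ord g \<le> ord l\<close> by simp
    then show ?thesis using m by (auto simp: J_def)
  qed
  define S where "S = (\<lambda>m. \<exists>G. G \<noteq> 0 \<and> n \<in> lid G \<and> ord G = m \<and> ord l dvd m)"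
  define m where "m = (GREATEST m. S m)"
  have S0: "S 0" unfolding S_def by (intro exI[of _ 1]) (auto intro: lidI)
  have bound: "m \<le> ord n" if "S m" for m
    using that lid_ord_less n_nonzero unfolding S_def by (metis not_less)
  have "S m" unfolding m_def using S0 bound by (rule GreatestI_nat)
  then obtain G where G: "G \<noteq> 0" "n \<in> lid G" "ord G = m" "ord l dvd m" by (auto simp: S_def)
  have max: "k \<le> m" if "S k" for k unfolding m_def using that bound by (rule Greatest_le_nat)
  have "G * h \<in> lid l" for h
  proof (rule ccontr)
    assume "G * h \<notin> lid l"
    then obtain l' where l': "l' \<noteq> 0" "ord l' = ord l" "\<And>g. g \<in> lid l' \<longleftrightarrow> g * (G * h) \<in> lid l"
      using ann[of "G * h"] by blast
    obtain x where x: "n = x * G" using G(2) by (rule lidE)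
    have "x * (G * h) \<in> lid l" using nl[of h] by (simp add: x mult.assoc)
    then obtain y where "x = y * l'" using l'(3) lidE by blast
    then have "n = y * (l' * G)" by (simp add: x mult.assoc)
    then have "S (ord l + m)" unfolding S_def using G l'
      by (intro exI[of _ "l' * G"]) (auto simp: ord_mult intro: lidI)
    then show False using max[of "ord l + m"] l(2) by simp
  qed
  then have "G \<in> lid n" by (rule annihilator_subset[OF l(2,1)])
  then have "ord n \<le> m" using G(1,3) lid_ord_less not_less by blast
  then have "m = ord n" using bound[OF \<open>S m\<close>] by simp
  then show ?thesis using G(4) by simp
qed

lemma exists_right_divisor_ord_d:
  assumes "n = x * y" "ord x \<noteq> 0" "ord y \<noteq> 0"
  obtains l where "n \<in> lid l" "ord l = d"
proof -
  define l where "l = (ARG_MIN ord l. n \<in> lid l \<and> ord l > 0)"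
  have y: "n \<in> lid y \<and> ord y > 0" using assms by (auto intro: lidI)
  have l: "n \<in> lid l" "ord l > 0" and min: "\<And>x. n \<in> lid x \<Longrightarrow> ord x > 0 \<Longrightarrow> ord l \<le> ord x"
    using arg_min_natI[of "\<lambda>l. n \<in> lid l \<and> ord l > 0", OF y]
      arg_min_nat_le[of "\<lambda>l. n \<in> lid l \<and> ord l > 0" _ ord] by (auto simp: l_def)
  have "x \<noteq> 0" "y \<noteq> 0" using assms by auto
  then have "ord l < ord n" using min[of y] y assms(2) by (simp add: assms(1) ord_mult)
  have "l \<noteq> 0" using l(2) by auto
  then obtain s where s: "ord l = d * s" using d_dvd_ord[OF _ l(1)] by (auto elim: dvdE)
  have "d * s dvd d * CHAR('a)" using minimal_ord_dvd[OF l min] s by (simp add: ord_n mult.commute)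
  then have "s dvd CHAR('a)" using d_pos by simp
  \<comment> \<open>The value s = p is excluded because reducibility of n makes l of smaller order
    than n.\<close>
  then have "s = 1 \<or> s = CHAR('a)" using CHAR_prime_ff[where 'a = 'a] by (auto simp: prime_nat_iff)
  then have "ord l = d" using s \<open>ord l < ord n\<close> by (auto simp: ord_n mult.commute)
  then show thesis using that l by blast
qed

lemma nabla_exists_1:
  assumes "n = x * y" "ord x \<noteq> 0" "ord y \<noteq> 0"
  obtains f where "(dd - ysub f) ^ CHAR('a) \<in> lid n"
proof -
  obtain l where l: "n \<in> lid l" "ord l = d" using assms by (rule exists_right_divisor_ord_d)
  have l0: "l \<noteq> 0" using l d_pos by auto
  obtain m where m: "m \<le> 1" "n ^ m * 1 \<in> lid l" "\<And>P. ysub P * 1 \<in> lid l \<Longrightarrow> Ne ^ m dvd P"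
    using annihilator_power[of 1 1 l] l by auto
  have "m \<noteq> 0"
  proof
    assume "m = 0"
    then show False using m(2) lid_ord_less[of 1 l] l(2) d_pos by simp
  qed
  then have m1: "m = 1" using m(1) by simp
  have "indep_mod l (SIGMA i:{()}. {..<1 * d}) (\<lambda>(i, j). dd ^ (j * CHAR('a)) * 1)"
    by (rule indep_mod_family[where k = "\<lambda>_. 1" and w = "\<lambda>_. 1"]) (use m(3) m1 in auto)
  then have "dd \<in> span_mod l (SIGMA i:{()}. {..<1 * d}) (\<lambda>(i, j). dd ^ (j * CHAR('a)) * 1)"
    by (intro indep_mod_card_eq_imp_span l0) (auto simp: l(2))
  then obtain c where c: "dd - (\<Sum>ij\<in>(SIGMA i:{()}. {..<1 * d}). cst (c ij) *
      (case ij of (i, j) \<Rightarrow> dd ^ (j * CHAR('a)) * 1)) \<in> lid l"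
    by (rule span_modE)
  define f where "f = (\<Sum>j<1 * d. monom (c ((), j)) j)"
  have "(\<Sum>i\<in>{()}. ysub f * 1) = (\<Sum>ij\<in>(SIGMA i:{()}. {..<1 * d}). cst (c ij) *
      (case ij of (i, j) \<Rightarrow> dd ^ (j * CHAR('a)) * 1))"
    by (rule sum_indices_ysub[where P = "\<lambda>_. f" and w = "\<lambda>_. 1"]) (auto simp: f_def)
  then have nabla: "dd - ysub f \<in> lid l" using c by simp
  define z where "z = (dd - ysub f) ^ CHAR('a)"
  have "z = (dd - ysub f) ^ (CHAR('a) - 1) * (dd - ysub f)"
    unfolding z_def using CHAR_pos_ff[where 'a = 'a] by (metis Suc_diff_1 power_Suc2)
  then have zl: "z \<in> lid l" using nabla by (simp add: lid_mult)
  obtain Q where Q: "z = ysub (map_poly frob_emb Q)"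
    using central_nabla_power[of f] unfolding z_def by (rule central_imp_ysub)
  \<comment> \<open>The annihilator of the class of 1 in K[Y] is generated by Ne; this improves
    membership in the left ideal of l to membership in that of n.\<close>
  then have "Ne dvd map_poly frob_emb Q" using m(3)[of "map_poly frob_emb Q"] zl m1 by simp
  then obtain R where "map_poly frob_emb Q = R * Ne" by (metis dvdE mult.commute)
  then have "z = ysub R * n" unfolding Q n_def by (simp add: ysub_mult)
  then show thesis using that[of f] unfolding z_def by (blast intro: lidI)
qed

text \<open>Hensel lifting: the correction is \<open>divpow (p - 1)\<close> times the error, which is central.\<close>
lemma nabla_exists:
  assumes "n = x * y" "ord x \<noteq> 0" "ord y \<noteq> 0"
  shows "\<exists>f. (dd - ysub f) ^ CHAR('a) \<in> lid (n ^ Suc \<nu>)"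
proof (induction \<nu>)
  case 0
  obtain f where "(dd - ysub f) ^ CHAR('a) \<in> lid n" by (rule nabla_exists_1[OF assms])
  then show ?case by (intro exI[of _ f]) simp
next
  case (Suc \<nu>)
  define p where "p = CHAR('a)"
  define a where "a = Suc \<nu>"
  obtain f where f: "(dd - ysub f) ^ p \<in> lid (n ^ a)" using Suc by (auto simp: p_def a_def)
  define D where "D = dd - ysub f"
  obtain g where g: "D ^ p = g * n ^ a" using f unfolding D_def by (rule lidE)
  have cen: "central (n ^ a)" by simp
  have "central (n ^ a * g)" using central_nabla_power[of f] g n_power_commute[of a g]
    by (simp add: D_def p_def)
  then have cg: "central g" by (rule central_cancel_left) simp_all
  obtain Q where Q: "g = ysub Q" using central_imp_ysub[OF cg] by metis
  \<comment> \<open>As g is central, \<open>adj D\<close> acts on \<open>cst b * g\<close> by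
    differentiating b, and the (p-1)-st derivative of t^(p-1)/(p-1)! is 1.\<close>
  define u where "u = cst (divpow (p - 1)) * g"
  have adj: "(adj D ^^ k) (cst b * g) = cst ((ddt ^^ k) b) * g" for k b
  proof (induction k)
    case (Suc k)
    have "adj D (cst c * g) = cst (ddt c) * g" for c
    proof -
      have "adj D (cst c * g) = D * cst c * g - cst c * (D * g)"
        unfolding adj_def mult.assoc central_commute[OF cg, of D] ..
      also have "\<dots> = cst (ddt c) * g"
        unfolding D_def nabla_cst by (simp add: distrib_right mult.assoc)
      finally show ?thesis .
    qed
    then show ?case using Suc by simp
  qed simp
  have "p - 1 < p" unfolding p_def using CHAR_pos_ff[where 'a = 'a] by simp
  then have "(adj D ^^ (p - 1)) u = g"
    unfolding u_def adj p_def by (simp add: funpow_ddt_divpow)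
  then have T: "(\<Sum>i<p. D ^ i * u * D ^ (p - 1 - i)) = g"
    using sum_power_mult_power_prime[of p D u] CHAR_prime_ff[where 'a = 'a] by (simp add: p_def)
  obtain r where "(D - n ^ a * u) ^ p = D ^ p - n ^ a * (\<Sum>i<p. D ^ i * u * D ^ (p - 1 - i)) + n ^ a * n ^ a * r"
    using perturbed_power[of "n ^ a" D u p, OF n_power_commute[of a, symmetric]] by blast
  then have "(D - n ^ a * u) ^ p = n ^ a * n ^ a * r"
    unfolding T g n_power_commute[of a g] by simp
  also have "\<dots> = (n ^ \<nu> * r) * n ^ Suc a"
  proof -
    \<comment> \<open>The remaining error has exponent 2a = \<nu> + (a + 1), because a = \<nu> + 1;
      of this a + 1 is kept.\<close>
    have na: "n ^ a * n ^ a = n ^ \<nu> * n ^ Suc a" 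
      unfolding power_add[symmetric] by (rule arg_cong[where f = "power n"]) (simp add: a_def)
    show ?thesis unfolding na unfolding mult.assoc n_power_commute[of "Suc a" r] ..
  qed
  finally have "(D - n ^ a * u) ^ p \<in> lid (n ^ Suc a)" by (rule lidI)
  \<comment> \<open>The correction is itself a polynomial in \<partial>^p, so the shape
    \<open>dd - ysub f\<close> is preserved.\<close>
  moreover have "D - n ^ a * u = dd - ysub (f + smult (divpow (p - 1)) (Q * Ne ^ a))"
    unfolding n_power_commute[of a u]
    by (simp add: D_def u_def Q n_def ysub_add ysub_mult ysub_power ysub_smult mult.assoc)
  ultimately have "(dd - ysub (f + smult (divpow (p - 1)) (Q * Ne ^ a))) ^ p \<in> lid (n ^ Suc a)" by simp
  then show ?case unfolding p_def a_def by blast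
qed

end

subsection \<open>Horizontal cyclic bases\<close>

lemma nabla_power_mult:
  assumes "(dd - ysub f) * w \<in> lid L"
  shows "(dd - ysub f) ^ j * (cst b * w) - cst ((ddt ^^ j) b) * w \<in> lid L"
proof (induction j)
  case (Suc j)
  define D where "D = dd - ysub f"
  define c where "c = (ddt ^^ j) b"
  have "D * (D ^ j * (cst b * w) - cst c * w) + cst c * (D * w) \<in> lid L"
    by (rule lid_add[OF lid_mult[OF Suc[folded D_def c_def]] lid_mult[OF assms[folded D_def]]])
  also have "D * (D ^ j * (cst b * w) - cst c * w) + cst c * (D * w)
      = D ^ Suc j * (cst b * w) - cst (ddt c) * w"
  proof -
    have "D * (cst c * w) = cst c * (D * w) + cst (ddt c) * w"
      unfolding D_def mult.assoc[symmetric] nabla_cst by (simp add: distrib_right)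
    then show ?thesis by (simp add: right_diff_distrib mult.assoc)
  qed
  finally show ?case by (simp add: D_def c_def)
qed simp

text \<open>Cartier's theorem: an element killed by a power of \<open>dd - ysub f\<close> is a combination of
  horizontal elements.  That they are left multiples of \<open>m\<close> keeps track of annihilation by
  central elements.\<close>
lemma horizontal_expansion:
  fixes L :: "'a::{finite,field} ldo"
  assumes "k \<le> CHAR('a)" "(dd - ysub f) ^ k * m \<in> lid L"
  shows "\<exists>x. (\<forall>j<k. (dd - ysub f) * (x j * m) \<in> lid L)
    \<and> m - (\<Sum>j<k. cst (divpow j) * (x j * m)) \<in> lid L"
proof -
  define D where "D = dd - ysub f"
  have "\<exists>x. (\<forall>j<k. D * (x j * m) \<in> lid L) \<and> y * m - (\<Sum>j<k. cst (divpow j) * (x j * m)) \<in> lid L"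
    if "k \<le> CHAR('a)" "D ^ k * (y * m) \<in> lid L" for k y
    using that
  proof (induction k arbitrary: y)
    case (Suc k)
    \<comment> \<open>z is horizontal, and D^k sends t^k/k! z to z modulo L. Subtracting that term
      from y lowers the power of D needed to kill the rest.\<close>
    define z where "z = D ^ k * y"
    have z: "D * (z * m) \<in> lid L" using Suc.prems(2) by (simp add: z_def mult.assoc)
    then have "D ^ k * (cst (divpow k) * (z * m)) - cst ((ddt ^^ k) (divpow k)) * (z * m) \<in> lid L"
      unfolding D_def by (rule nabla_power_mult)
    then have "D ^ k * (cst (divpow k) * (z * m)) - z * m \<in> lid L"
      using Suc.prems(1) by (simp add: funpow_ddt_divpow)
    then have "- (D ^ k * (cst (divpow k) * (z * m)) - z * m) \<in> lid L" by (rule lid_uminus)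
    moreover have "- (D ^ k * (cst (divpow k) * (z * m)) - z * m) = D ^ k * ((y - cst (divpow k) * z) * m)"
      by (simp add: z_def left_diff_distrib right_diff_distrib mult.assoc)
    ultimately obtain x where x: "\<forall>j<k. D * (x j * m) \<in> lid L"
      "(y - cst (divpow k) * z) * m - (\<Sum>j<k. cst (divpow j) * (x j * m)) \<in> lid L"
      using Suc.IH[of "y - cst (divpow k) * z"] Suc.prems(1) by auto
    define x' where "x' = x(k := z)"
    have "(\<Sum>j<Suc k. cst (divpow j) * (x' j * m))
        = (\<Sum>j<k. cst (divpow j) * (x j * m)) + cst (divpow k) * (z * m)"
      by (simp add: x'_def)
    then have "y * m - (\<Sum>j<Suc k. cst (divpow j) * (x' j * m)) \<in> lid L"
      using x(2) by (simp add: left_diff_distrib mult.assoc algebra_simps)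
    moreover have "\<forall>j<Suc k. D * (x' j * m) \<in> lid L"
      using x(1) z by (auto simp: x'_def less_Suc_eq)
    ultimately show ?case by blast
  qed auto
  from this[of k 1] show ?thesis using assms by (simp add: D_def)
qed

text \<open>Modulo L, \<partial> w = f(\<partial>^p) w, so every \<partial>^k w is a
  K[\<partial>^p]-multiple of w; the polynomials follow the recursion P f + P'. Thus R w and
  K[\<partial>^p] w coincide.\<close>

lemma horizontal_cyclic:
  assumes "(dd - ysub f) * w \<in> lid L"
  obtains P where "x * w - ysub P * w \<in> lid L"
proof -
  have "\<exists>P. dd ^ k * w - ysub P * w \<in> lid L" for k
  proof (induction k)
    case 0
    show ?case by (intro exI[of _ 1]) simp
  next
    case (Suc k)
    then obtain P where P: "dd ^ k * w - ysub P * w \<in> lid L" by blast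
    have "dd * (dd ^ k * w - ysub P * w) + ysub P * ((dd - ysub f) * w) \<in> lid L"
      by (rule lid_add[OF lid_mult[OF P] lid_mult[OF assms]])
    also have "dd * (dd ^ k * w - ysub P * w) + ysub P * ((dd - ysub f) * w)
        = dd ^ Suc k * w - ysub (P * f + map_poly ddt P) * w"
    proof -
      have "dd * (ysub P * w) = ysub P * (dd * w) + ysub (map_poly ddt P) * w"
        by (simp add: mult.assoc[symmetric] dd_ysub distrib_right)
      then show ?thesis
        by (simp add: right_diff_distrib left_diff_distrib distrib_right ysub_add ysub_mult mult.assoc)
    qed
    finally show ?case by blast
  qed
  then obtain P where P: "\<And>k. dd ^ k * w - ysub (P k) * w \<in> lid L" by metis
  have x: "x = (\<Sum>k<Suc (ord x). cst (cf x k) * dd ^ k)"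
    by (rule ldo_expand) (simp add: cf_eq_0)
  have "(\<Sum>k<Suc (ord x). cst (cf x k) * (dd ^ k * w - ysub (P k) * w)) \<in> lid L"
    by (rule lid_sum[OF lid_mult[OF P]])
  also have "(\<Sum>k<Suc (ord x). cst (cf x k) * (dd ^ k * w - ysub (P k) * w))
      = (\<Sum>k<Suc (ord x). cst (cf x k) * dd ^ k) * w - ysub (\<Sum>k<Suc (ord x). smult (cf x k) (P k)) * w"
    by (simp only: right_diff_distrib sum_subtractf sum_distrib_right ysub_sum ysub_smult mult.assoc)
  finally show thesis using that x by metis
qed

context separable_irreducible
begin

text \<open>The classes of \<open>v 0, \<dots>, v (r - 1)\<close> are independent generators of the quotient by the left
  ideal of \<open>L\<close> over K[Y], with annihilators generated by the powers \<open>Ne ^ k i\<close>.\<close>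
definition cyclic_basis :: "'a ldo \<Rightarrow> nat \<Rightarrow> (nat \<Rightarrow> nat) \<Rightarrow> (nat \<Rightarrow> 'a ldo) \<Rightarrow> bool" where
  "cyclic_basis L r k v \<longleftrightarrow>
    (\<forall>i<r. n ^ k i * v i \<in> lid L) \<and>
    (\<forall>w. \<exists>P. w - (\<Sum>i<r. ysub (P i) * v i) \<in> lid L) \<and>
    (\<forall>P. (\<Sum>i<r. ysub (P i) * v i) \<in> lid L \<longrightarrow> (\<forall>i<r. Ne ^ k i dvd P i))"

lemma ysub_mult_in_lid:
  assumes "Ne ^ k dvd P" "n ^ k * w \<in> lid L"
  shows "ysub P * w \<in> lid L"
proof -
  obtain Q where "P = Q * Ne ^ k" using assms(1) by (metis dvdE mult.commute)
  then have "ysub P * w = ysub Q * (n ^ k * w)" by (simp add: ysub_mult ysub_power n_def mult.assoc)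
  then show ?thesis using assms(2) by (simp add: lid_mult)
qed

lemma sum_fun_upd_remove:
  fixes v :: "nat \<Rightarrow> 'a ldo"
  assumes "i0 < r"
  shows "(\<Sum>i<r. ysub (P i) * (v(i0 := w)) i) = ysub (P i0) * w + (\<Sum>i\<in>{..<r} - {i0}. ysub (P i) * v i)"
    and "(\<Sum>i<r. ysub (P i) * v i) = ysub (P i0) * v i0 + (\<Sum>i\<in>{..<r} - {i0}. ysub (P i) * v i)"
proof -
  have "(\<Sum>i\<in>{..<r} - {i0}. ysub (P i) * (v(i0 := w)) i) = (\<Sum>i\<in>{..<r} - {i0}. ysub (P i) * v i)"
    by (rule sum.cong) auto
  then show "(\<Sum>i<r. ysub (P i) * (v(i0 := w)) i) = ysub (P i0) * w + (\<Sum>i\<in>{..<r} - {i0}. ysub (P i) * v i)"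
    using assms by (subst sum.remove[of _ i0]) auto
  show "(\<Sum>i<r. ysub (P i) * v i) = ysub (P i0) * v i0 + (\<Sum>i\<in>{..<r} - {i0}. ysub (P i) * v i)"
    using assms by (subst sum.remove[of _ i0]) auto
qed

text \<open>The coordinate \<open>C i0\<close> is a unit modulo Ne^(k i0), so \<open>v i0\<close>
  can be solved for in terms of w and the other generators. The bound on the annihilator of w keeps
  the exponent unchanged.\<close>

lemma cyclic_basis_exchange:
  assumes v: "cyclic_basis L r k v" and i0: "i0 < r"
    and w: "n ^ k i0 * w \<in> lid L" "w - (\<Sum>i<r. ysub (C i) * v i) \<in> lid L" "\<not> Ne dvd C i0"
  shows "cyclic_basis L r k (v(i0 := w))"
proof -
  let ?R = "{..<r} - {i0}"
  have ann: "\<And>i. i < r \<Longrightarrow> n ^ k i * v i \<in> lid L"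
    and gen: "\<And>w. \<exists>P. w - (\<Sum>i<r. ysub (P i) * v i) \<in> lid L"
    and dir: "\<And>P i. (\<Sum>i<r. ysub (P i) * v i) \<in> lid L \<Longrightarrow> i < r \<Longrightarrow> Ne ^ k i dvd P i"
    using v by (auto simp: cyclic_basis_def)
  obtain u t where ut: "u * C i0 + t * Ne ^ k i0 = 1"
    by (rule irreducible_bezout_power[OF irr_Ne w(3)])
  have gen': "\<exists>P. x - (\<Sum>i<r. ysub (P i) * (v(i0 := w)) i) \<in> lid L" for x
  proof -
    obtain P where P: "x - (\<Sum>i<r. ysub (P i) * v i) \<in> lid L" using gen by blast
    \<comment> \<open>Coordinates after substituting u * (w - other terms) for \<open>v i0\<close>,
      where u inverts \<open>C i0\<close>.\<close>
    define P' where "P' = (\<lambda>i. if i = i0 then P i0 * u else P i - P i0 * u * C i)"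
    have s: "(\<Sum>i\<in>?R. ysub (P' i) * v i) = (\<Sum>i\<in>?R. ysub (P i) * v i) - ysub (P i0 * u) * (\<Sum>i\<in>?R. ysub (C i) * v i)"
      unfolding sum_distrib_left sum_subtractf[symmetric]
      by (rule sum.cong) (auto simp: P'_def ysub_diff ysub_mult left_diff_distrib mult.assoc)
    have "ysub (P i0) * v i0 = ysub (P i0 * (u * C i0 + t * Ne ^ k i0)) * v i0" using ut by simp
    also have "\<dots> = ysub (P i0 * u) * (ysub (C i0) * v i0) + ysub (P i0 * t) * (n ^ k i0 * v i0)"
      by (simp only: distrib_left mult.assoc[symmetric] ysub_add ysub_mult ysub_power n_def distrib_right)
    finally have Pv: "ysub (P i0) * v i0 = ysub (P i0 * u) * (ysub (C i0) * v i0)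
        + ysub (P i0 * t) * (n ^ k i0 * v i0)" .
    have "x - (\<Sum>i<r. ysub (P' i) * (v(i0 := w)) i)
      = (x - (\<Sum>i<r. ysub (P i) * v i))
        - ysub (P i0 * u) * (w - (\<Sum>i<r. ysub (C i) * v i)) + ysub (P i0 * t) * (n ^ k i0 * v i0)"
      unfolding sum_fun_upd_remove[OF i0] s Pv by (simp add: P'_def algebra_simps)
    also have "\<dots> \<in> lid L"
      by (rule lid_add[OF lid_diff[OF P lid_mult[OF w(2)]] lid_mult[OF ann[OF i0]]])
    finally show ?thesis by blast
  qed
  have dir': "Ne ^ k i dvd P i"
    if P: "(\<Sum>i<r. ysub (P i) * (v(i0 := w)) i) \<in> lid L" and i: "i < r" for P i
  proof -
    \<comment> \<open>The given relation rewritten in the old generators.\<close>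
    define Q where "Q = (\<lambda>i. if i = i0 then P i0 * C i0 else P i + P i0 * C i)"
    have s: "(\<Sum>i\<in>?R. ysub (Q i) * v i) = (\<Sum>i\<in>?R. ysub (P i) * v i) + ysub (P i0) * (\<Sum>i\<in>?R. ysub (C i) * v i)"
      unfolding sum_distrib_left sum.distrib[symmetric]
      by (rule sum.cong) (auto simp: Q_def ysub_add ysub_mult distrib_right mult.assoc)
    have q: "ysub (Q i0) * v i0 = ysub (P i0) * (ysub (C i0) * v i0)"
      unfolding Q_def if_P[OF refl] ysub_mult mult.assoc ..
    have "(\<Sum>i<r. ysub (Q i) * v i) = (\<Sum>i<r. ysub (P i) * (v(i0 := w)) i)
        - ysub (P i0) * (w - (\<Sum>i<r. ysub (C i) * v i))"
      unfolding sum_fun_upd_remove[OF i0] s q by (simp add: algebra_simps)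
    also have "\<dots> \<in> lid L" by (rule lid_diff[OF P lid_mult[OF w(2)]])
    finally have dQ: "\<And>i. i < r \<Longrightarrow> Ne ^ k i dvd Q i" by (rule dir)
    have "u * (P i0 * C i0) + (t * P i0) * Ne ^ k i0 = P i0 * (u * C i0 + t * Ne ^ k i0)"
      by (simp add: algebra_simps)
    then have e: "u * (P i0 * C i0) + (t * P i0) * Ne ^ k i0 = P i0" unfolding ut by simp
    have "Ne ^ k i0 dvd P i0 * C i0" using dQ[OF i0] unfolding Q_def if_P[OF refl] .
    then have "Ne ^ k i0 dvd u * (P i0 * C i0) + (t * P i0) * Ne ^ k i0"
      by (rule dvd_add[OF dvd_mult dvd_triv_right])
    then have d0: "Ne ^ k i0 dvd P i0" unfolding e .
    then have "ysub (P i0) * w \<in> lid L" using w(1) by (rule ysub_mult_in_lid)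
    \<comment> \<open>Now the term of w vanishes, so its old coordinates \<open>P i0 * C i\<close>
      are themselves divisible by Ne^(k i) and can be removed from \<open>Q i\<close>.\<close>
    then have "ysub (P i0) * w - ysub (P i0) * (w - (\<Sum>i<r. ysub (C i) * v i)) \<in> lid L"
      by (rule lid_diff[OF _ lid_mult[OF w(2)]])
    also have "ysub (P i0) * w - ysub (P i0) * (w - (\<Sum>i<r. ysub (C i) * v i))
        = (\<Sum>i<r. ysub (P i0 * C i) * v i)"
      by (simp add: right_diff_distrib sum_distrib_left ysub_mult mult.assoc)
    finally have "Ne ^ k i dvd P i0 * C i" using i by (rule dir)
    then have "Ne ^ k i dvd P i" if "i \<noteq> i0"
      using dQ[OF i] that unfolding Q_def by (simp only: if_False dvd_add_left_iff)
    then show ?thesis using d0 by blast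
  qed
  show ?thesis unfolding cyclic_basis_def
  proof (intro conjI allI impI)
    show "n ^ k i * (v(i0 := w)) i \<in> lid L" if "i < r" for i using ann[OF that] w(1) by simp
  qed (use gen' dir' in blast)+
qed

text \<open>By Cartier's theorem \<open>v i0\<close> is a K-combination of horizontal elements x j *
  v i0. Its own i0-coordinate is 1, so one of them has an i0-coordinate not divisible by Ne and can
  be exchanged for \<open>v i0\<close>. Being a left multiple of \<open>v i0\<close>, it is killed
  by the central n^(k i0).\<close>

lemma cyclic_basis_replace_horizontal:
  assumes v: "cyclic_basis L r k v" and i0: "i0 < r" and k: "k i0 > 0"
    and nabla: "(dd - ysub f) ^ CHAR('a) * v i0 \<in> lid L"
  shows "\<exists>w. (dd - ysub f) * w \<in> lid L \<and> cyclic_basis L r k (v(i0 := w))"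
proof -
  define p where "p = CHAR('a)"
  obtain x where x: "\<And>j. j < p \<Longrightarrow> (dd - ysub f) * (x j * v i0) \<in> lid L"
    "v i0 - (\<Sum>j<p. cst (divpow j) * (x j * v i0)) \<in> lid L"
    using horizontal_expansion[of p f "v i0" L] nabla by (auto simp: p_def)
  have ann: "n ^ k i0 * v i0 \<in> lid L"
    and gen: "\<And>w. \<exists>P. w - (\<Sum>i<r. ysub (P i) * v i) \<in> lid L"
    and dir: "\<And>P i. (\<Sum>i<r. ysub (P i) * v i) \<in> lid L \<Longrightarrow> i < r \<Longrightarrow> Ne ^ k i dvd P i"
    using v i0 by (auto simp: cyclic_basis_def)
  have "\<forall>j. \<exists>C. x j * v i0 - (\<Sum>i<r. ysub (C i) * v i) \<in> lid L" using gen by blast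
  then obtain C where C: "\<And>j. x j * v i0 - (\<Sum>i<r. ysub (C j i) * v i) \<in> lid L" by metis
  \<comment> \<open>Coordinates of \<open>v i0\<close> minus its horizontal expansion, an element
    that is 0 modulo L.\<close>
  define E where "E = (\<lambda>i. (if i = i0 then 1 else 0) - (\<Sum>j<p. smult (divpow j) (C j i)))"
  have "(\<Sum>i<r. ysub (E i) * v i) = (\<Sum>i<r. ysub (if i = i0 then 1 else 0) * v i)
      - (\<Sum>i<r. \<Sum>j<p. cst (divpow j) * (ysub (C j i) * v i))"
    by (simp add: E_def ysub_diff left_diff_distrib sum_subtractf ysub_sum ysub_smult
        sum_distrib_right mult.assoc)
  also have "(\<Sum>i<r. ysub (if i = i0 then 1 else 0) * v i) = (\<Sum>i<r. if i = i0 then v i else 0)"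
    by (rule sum.cong) auto
  also have "\<dots> = v i0" using i0 by simp
  also have "(\<Sum>i<r. \<Sum>j<p. cst (divpow j) * (ysub (C j i) * v i))
      = (\<Sum>j<p. cst (divpow j) * (\<Sum>i<r. ysub (C j i) * v i))"
    by (subst sum.swap) (simp add: sum_distrib_left)
  also have "v i0 - (\<Sum>j<p. cst (divpow j) * (\<Sum>i<r. ysub (C j i) * v i))
      = (v i0 - (\<Sum>j<p. cst (divpow j) * (x j * v i0)))
        + (\<Sum>j<p. cst (divpow j) * (x j * v i0 - (\<Sum>i<r. ysub (C j i) * v i)))"
    by (simp add: right_diff_distrib sum_subtractf)
  also have "\<dots> \<in> lid L" by (rule lid_add[OF x(2) lid_sum[OF lid_mult[OF C]]])
  finally have "Ne ^ k i0 dvd E i0" using i0 by (rule dir)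
  moreover have "Ne dvd Ne ^ k i0" using k by (simp add: dvd_power)
  ultimately have dE: "Ne dvd E i0" by (rule dvd_trans[rotated])
  have "\<exists>j<p. \<not> Ne dvd C j i0"
  proof (rule ccontr)
    assume "\<not> (\<exists>j<p. \<not> Ne dvd C j i0)"
    then have "Ne dvd (\<Sum>j<p. smult (divpow j) (C j i0))" by (intro dvd_sum) (auto intro: dvd_smult)
    then have "Ne dvd E i0 + (\<Sum>j<p. smult (divpow j) (C j i0))" using dE by (rule dvd_add[rotated])
    then have "Ne dvd 1" by (simp add: E_def)
    then show False using irr_Ne by (simp add: irreducible_def)
  qed
  then obtain j where j: "j < p" "\<not> Ne dvd C j i0" by blast
  have "n ^ k i0 * (x j * v i0) = x j * (n ^ k i0 * v i0)"
    using n_power_commute[of "k i0" "x j"] by (simp add: mult.assoc[symmetric])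
  then have "n ^ k i0 * (x j * v i0) \<in> lid L" using ann by (simp add: lid_mult)
  then have "cyclic_basis L r k (v(i0 := x j * v i0))"
    using cyclic_basis_exchange[OF v i0 _ C j(2)] by blast
  then show ?thesis using x(1)[OF j(1)] by blast
qed

lemma horizontal_cyclic_basis:
  assumes v: "cyclic_basis L r k v" and k: "\<And>i. i < r \<Longrightarrow> k i > 0"
    and nabla: "\<And>x. (dd - ysub f) ^ CHAR('a) * x \<in> lid L"
  obtains w where "cyclic_basis L r k w" "\<And>i. i < r \<Longrightarrow> (dd - ysub f) * w i \<in> lid L"
proof -
  have "\<exists>w. cyclic_basis L r k w \<and> (\<forall>i<s. (dd - ysub f) * w i \<in> lid L)" if "s \<le> r" for s
    using that
  proof (induction s)
    case (Suc s)
    then obtain w where w: "cyclic_basis L r k w" "\<forall>i<s. (dd - ysub f) * w i \<in> lid L" by auto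
    obtain y where y: "(dd - ysub f) * y \<in> lid L" "cyclic_basis L r k (w(s := y))"
      using cyclic_basis_replace_horizontal[OF w(1), of s f] k[of s] nabla Suc.prems by auto
    then have "\<forall>i<Suc s. (dd - ysub f) * (w(s := y)) i \<in> lid L" using w(2) by (auto simp: less_Suc_eq)
    then show ?case using y(2) by blast
  qed (use v in auto)
  then show thesis using that by blast
qed

lemma ord_eq_sum_cyclic_basis:
  assumes L: "L \<noteq> 0" and v: "cyclic_basis L r k v"
  shows "ord L = (\<Sum>i<r. k i * d)"
proof -
  let ?S = "SIGMA i:{..<r}. {..<k i * d}"
  have ind: "indep_mod L ?S (\<lambda>(i, j). dd ^ (j * CHAR('a)) * v i)"
    by (rule indep_mod_family[where k = k and w = v]) (use v in \<open>auto simp: cyclic_basis_def\<close>)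
  have sp: "z \<in> span_mod L ?S (\<lambda>(i, j). dd ^ (j * CHAR('a)) * v i)" for z
  proof -
    obtain P where "z - (\<Sum>i<r. ysub (P i) * v i) \<in> lid L" using v unfolding cyclic_basis_def by blast
    then show ?thesis
      by (intro span_mod_family[where k = k and w = v and P = P]) (use v in \<open>auto simp: cyclic_basis_def\<close>)
  qed
  have "card ?S \<le> ord L" by (rule indep_mod_card_le_ord[OF L _ ind]) auto
  moreover have "card {..<ord L} \<le> card ?S"
    by (rule indep_mod_card_le[OF _ _ indep_mod_dd_power sp]) auto
  ultimately show ?thesis by simp
qed

text \<open>For horizontal generators the K[Y]-decomposition is one into R-submodules R w i. The
  component m i of 1 generates R w i, so the quotient by its annihilator has dimension k i *
  d.\<close>

lemma horizontal_decomposition: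
  assumes L: "L \<noteq> 0" "n ^ \<nu> \<in> lid L" and w: "cyclic_basis L r k w" and k: "\<And>i. i < r \<Longrightarrow> k i > 0"
    and hor: "\<And>i. i < r \<Longrightarrow> (dd - ysub f) * w i \<in> lid L"
  shows "\<exists>Ls. (\<forall>i<r. ord (Ls i) = k i * d \<and> \<not> ldecomp (Ls i)) \<and> (\<forall>M. M \<in> lid L \<longleftrightarrow> (\<forall>i<r. M \<in> lid (Ls i)))"
proof -
  have ann: "\<And>i. i < r \<Longrightarrow> n ^ k i * w i \<in> lid L"
    and gen: "\<And>x. \<exists>P. x - (\<Sum>i<r. ysub (P i) * w i) \<in> lid L"
    and dir: "\<And>P i. (\<Sum>i<r. ysub (P i) * w i) \<in> lid L \<Longrightarrow> i < r \<Longrightarrow> Ne ^ k i dvd P i"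
    using w by (auto simp: cyclic_basis_def)
  have dir1: "Ne ^ k i dvd P" if P: "ysub P * w i \<in> lid L" and i: "i < r" for P i
  proof -
    have "(\<Sum>l<r. ysub (if l = i then P else 0) * w l) = (\<Sum>l<r. if l = i then ysub P * w l else 0)"
      by (rule sum.cong) auto
    also have "\<dots> \<in> lid L" using P i by simp
    finally show ?thesis using dir[of "\<lambda>l. if l = i then P else 0" i] i by simp
  qed
  \<comment> \<open>Directness over K[Y] extends to coefficients in R, because each x l * w l can be
    replaced by a K[Y]-multiple of w l.\<close>
  have sumdir: "x i * w i \<in> lid L" if x: "(\<Sum>i<r. x i * w i) \<in> lid L" and i: "i < r" for x i
  proof -
    have "\<forall>l\<in>{..<r}. \<exists>P. x l * w l - ysub P * w l \<in> lid L"
      using hor horizontal_cyclic by (metis lessThan_iff)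
    then obtain P where P: "\<And>l. l < r \<Longrightarrow> x l * w l - ysub (P l) * w l \<in> lid L"
      by (metis lessThan_iff)
    have "(\<Sum>l<r. x l * w l - ysub (P l) * w l) \<in> lid L" using P by (intro lid_sum) auto
    then have "(\<Sum>l<r. x l * w l) - (\<Sum>l<r. ysub (P l) * w l) \<in> lid L" by (simp add: sum_subtractf)
    then have "(\<Sum>l<r. ysub (P l) * w l) \<in> lid L" using x by (simp add: lid_cong)
    then have "Ne ^ k i dvd P i" using i by (rule dir)
    then have "ysub (P i) * w i \<in> lid L" using ann[OF i] by (rule ysub_mult_in_lid)
    then show ?thesis using P[OF i] by (simp add: lid_cong)
  qed
  obtain b where b: "1 - (\<Sum>i<r. ysub (b i) * w i) \<in> lid L" using gen by blast
  define m where "m = (\<lambda>i. ysub (b i) * w i)"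
  \<comment> \<open>Compare the i-th components in w i = w i * 1, with 1 expanded as the sum of the
    m l.\<close>
  have wm: "w i * m i - w i \<in> lid L" if i: "i < r" for i
  proof -
    have "w i * (1 - (\<Sum>l<r. ysub (b l) * w l)) \<in> lid L" using b by (rule lid_mult)
    also have "w i * (1 - (\<Sum>l<r. ysub (b l) * w l)) = w i - (\<Sum>l<r. w i * ysub (b l) * w l)"
      by (simp add: right_diff_distrib sum_distrib_left mult.assoc)
    also have "w i = (\<Sum>l<r. if l = i then w l else 0)" using i by simp
    also have "(\<Sum>l<r. if l = i then w l else 0) - (\<Sum>l<r. (\<Sum>l<r. if l = i then w l else 0) * ysub (b l) * w l)
        = (\<Sum>l<r. ((if l = i then 1 else 0) - w i * ysub (b l)) * w l)"
      using i by (simp add: left_diff_distrib sum_subtractf if_distrib[where f = "\<lambda>x. x * _"] cong: if_cong)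
    finally have "((if i = i then 1 else 0) - w i * ysub (b i)) * w i \<in> lid L"
      using i by (rule sumdir)
    then have "- (((if i = i then 1 else 0) - w i * ysub (b i)) * w i) \<in> lid L" by (rule lid_uminus)
    then show ?thesis by (simp add: m_def left_diff_distrib mult.assoc)
  qed
  have "\<exists>G. G \<noteq> 0 \<and> (\<forall>x. x \<in> lid G \<longleftrightarrow> x * m i \<in> lid L)" for i
  proof -
    define J where "J = {x. x * m i \<in> lid L}"
    obtain G where "J = lid G" "G \<noteq> 0"
    proof (rule left_ideal_principal[of J])
      have "n ^ \<nu> \<in> J" using L(2) by (simp add: J_def lid_mult_n)
      moreover have "n ^ \<nu> \<noteq> 0" by simp
      ultimately show "J \<noteq> {0}" by blast
      show "0 \<in> J" by (simp add: J_def)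
      show "x + y \<in> J" if "x \<in> J" "y \<in> J" for x y
        using that by (simp add: J_def distrib_right lid_add)
      show "y * x \<in> J" if "x \<in> J" for x y
        using that by (simp add: J_def mult.assoc lid_mult)
    qed
    then show ?thesis by (intro exI[of _ G]) (auto simp: J_def)
  qed
  then obtain Ls where Ls: "\<And>i. Ls i \<noteq> 0" "\<And>i x. x \<in> lid (Ls i) \<longleftrightarrow> x * m i \<in> lid L"
    by metis
  have lcm: "M \<in> lid L \<longleftrightarrow> (\<forall>i<r. M \<in> lid (Ls i))" for M
  proof -
    have "M * (1 - (\<Sum>i<r. m i)) \<in> lid L" using b unfolding m_def by (rule lid_mult)
    then have "M - (\<Sum>i<r. M * ysub (b i) * w i) \<in> lid L"
      by (simp add: right_diff_distrib sum_distrib_left m_def mult.assoc)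
    then have e: "M \<in> lid L \<longleftrightarrow> (\<Sum>i<r. M * ysub (b i) * w i) \<in> lid L" by (rule lid_cong)
    show ?thesis
    proof
      assume "M \<in> lid L"
      then have "(\<Sum>i<r. M * ysub (b i) * w i) \<in> lid L" using e by simp
      then have "\<And>i. i < r \<Longrightarrow> M * ysub (b i) * w i \<in> lid L" by (rule sumdir)
      then show "\<forall>i<r. M \<in> lid (Ls i)" by (simp add: Ls(2) m_def mult.assoc)
    next
      assume "\<forall>i<r. M \<in> lid (Ls i)"
      then have "(\<Sum>i<r. M * ysub (b i) * w i) \<in> lid L"
        by (intro lid_sum) (simp add: Ls(2) m_def mult.assoc)
      then show "M \<in> lid L" using e by simp
    qed
  qed
  \<comment> \<open>Two bases of R w i are counted: dd^j m i for j < ord (Ls i), and dd^(j p) w i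
    for j < k i * d.\<close>
  have ord: "ord (Ls i) = k i * d" if i: "i < r" for i
  proof -
    let ?S = "SIGMA u:{()}. {..<k i * d}"
    let ?y = "\<lambda>(u, j). dd ^ (j * CHAR('a)) * w i"
    let ?x = "\<lambda>j. dd ^ j * m i"
    have indB: "indep_mod L ?S ?y"
      by (rule indep_mod_family[where k = "\<lambda>_. k i" and w = "\<lambda>_. w i"]) (use dir1[OF _ i] in auto)
    have indA: "indep_mod L {..<ord (Ls i)} ?x"
      unfolding indep_mod_def
    proof (intro allI impI)
      fix c assume "(\<Sum>j<ord (Ls i). cst (c j) * (dd ^ j * m i)) \<in> lid L"
      then have "(\<Sum>j<ord (Ls i). cst (c j) * dd ^ j) \<in> lid (Ls i)"
        by (simp add: Ls(2) sum_distrib_right mult.assoc)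
      then show "\<forall>j\<in>{..<ord (Ls i)}. c j = 0"
        using indep_mod_dd_power[of "Ls i"] unfolding indep_mod_def by blast
    qed
    have spB: "dd ^ j * m i \<in> span_mod L ?S ?y" for j
    proof -
      obtain P where P: "(dd ^ j * ysub (b i)) * w i - ysub P * w i \<in> lid L"
        by (rule horizontal_cyclic[OF hor[OF i]])
      show ?thesis
        by (rule span_mod_family[where k = "\<lambda>_. k i" and w = "\<lambda>_. w i" and P = "\<lambda>_. P"])
          (use P ann[OF i] in \<open>auto simp: m_def mult.assoc\<close>)
    qed
    have spA: "z * w i \<in> span_mod L {..<ord (Ls i)} ?x" for z
    proof -
      obtain c where c: "z * w i - (\<Sum>j<ord (Ls i). cst (c j) * dd ^ j) \<in> lid (Ls i)"
        using span_mod_dd_power[OF Ls(1)] by (rule span_modE)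
      have "z * (w i * m i - w i) \<in> lid L" by (rule lid_mult[OF wm[OF i]])
      moreover have "(z * w i - (\<Sum>j<ord (Ls i). cst (c j) * dd ^ j)) * m i \<in> lid L"
        using c by (simp only: Ls(2))
      ultimately have "(z * w i - (\<Sum>j<ord (Ls i). cst (c j) * dd ^ j)) * m i - z * (w i * m i - w i) \<in> lid L"
        by (rule lid_diff[rotated])
      then have "z * w i - (\<Sum>j<ord (Ls i). cst (c j) * (dd ^ j * m i)) \<in> lid L"
        by (simp add: left_diff_distrib right_diff_distrib sum_distrib_right mult.assoc)
      then show ?thesis by (rule span_modI)
    qed
    have "card {..<ord (Ls i)} \<le> card ?S" by (rule indep_mod_card_le[OF _ _ indA spB]) auto
    moreover have "card ?S \<le> card {..<ord (Ls i)}"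
      by (rule indep_mod_card_le[OF _ _ indB]) (use spA in auto)
    ultimately show ?thesis by simp
  qed
  have indec: "\<not> ldecomp (Ls i)" if i: "i < r" for i
  proof (rule not_ldecompI[OF Ls(1) _ ord[OF i] k[OF i]])
    show "n ^ \<nu> \<in> lid (Ls i)" using L(2) lcm[of "n ^ \<nu>"] i by simp
    \<comment> \<open>If n^(k i - 1) killed m i, it would by \<open>wm\<close> also kill w i, whose
      annihilator is generated by Ne^(k i).\<close>
    show "n ^ (k i - 1) \<notin> lid (Ls i)"
    proof
      assume "n ^ (k i - 1) \<in> lid (Ls i)"
      then have "w i * (n ^ (k i - 1) * m i) \<in> lid L" by (simp only: Ls(2) lid_mult)
      moreover have "n ^ (k i - 1) * (w i * m i - w i) \<in> lid L" by (rule lid_mult[OF wm[OF i]])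
      ultimately have "w i * (n ^ (k i - 1) * m i) - n ^ (k i - 1) * (w i * m i - w i) \<in> lid L"
        by (rule lid_diff)
      also have "w i * (n ^ (k i - 1) * m i) - n ^ (k i - 1) * (w i * m i - w i) = n ^ (k i - 1) * w i"
        unfolding right_diff_distrib mult.assoc[symmetric] n_power_commute[of "k i - 1" "w i"]
        by simp
      also have "\<dots> = ysub (Ne ^ (k i - 1)) * w i" by (simp add: n_def ysub_power)
      finally have "Ne ^ k i dvd Ne ^ (k i - 1)" using i by (rule dir1)
      then have "degree (Ne ^ k i) \<le> degree (Ne ^ (k i - 1))" by (rule dvd_imp_degree_le) simp
      then show False using k[OF i] d_pos by simp
    qed
  qed
  show ?thesis using ord indec lcm by blast
qed

lemma reducible_case:
  assumes red: "n = x * y" "ord x \<noteq> 0" "ord y \<noteq> 0"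
    and L: "L \<noteq> 0" "n ^ \<nu> \<in> lid L" and v: "cyclic_basis L r k v" and k: "\<And>i. i < r \<Longrightarrow> k i > 0"
  shows "\<exists>Ls. (\<forall>i<r. ord (Ls i) = k i * d \<and> \<not> ldecomp (Ls i)) \<and> (\<forall>M. M \<in> lid L \<longleftrightarrow> (\<forall>i<r. M \<in> lid (Ls i)))"
proof -
  obtain f where f: "(dd - ysub f) ^ CHAR('a) \<in> lid (n ^ Suc \<nu>)" using nabla_exists[OF red] by blast
  have "n ^ Suc \<nu> \<in> lid L" using L(2) by (rule n_power_lid_mono) simp
  then have fL: "(dd - ysub f) ^ CHAR('a) \<in> lid L" using f lid_mono by blast
  have nab: "(dd - ysub f) ^ CHAR('a) * x \<in> lid L" for x
    unfolding central_commute[OF central_nabla_power, of f x] using fL by (rule lid_mult)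
  obtain w where w: "cyclic_basis L r k w" "\<And>i. i < r \<Longrightarrow> (dd - ysub f) * w i \<in> lid L"
    using horizontal_cyclic_basis[OF v k nab] by blast
  show ?thesis by (rule horizontal_decomposition[OF L w(1) k w(2)])
qed

end

subsection \<open>Transfer to the concrete operators\<close>

lemma Ldo_rep [simp]: "Ldo (rep_ldo x) = x"
  by (rule rep_ldo_inverse)

lemma Ldo_0: "Ldo 0 = 0"
  by (simp add: zero_ldo_def)

lemma Ldo_1: "Ldo 1 = 1"
  by (simp add: one_ldo_def)

lemma Ldo_add: "Ldo (A + B) = Ldo A + Ldo B"
  by (simp add: ldo_defs)

lemma Ldo_sum: "Ldo (sum f I) = (\<Sum>i\<in>I. Ldo (f i))"
  by (induction I rule: infinite_finite_induct) (simp_all add: Ldo_0 Ldo_add)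

lemma Ldo_op_mult: "Ldo (A \<odot> B) = Ldo A * Ldo B"
  by (simp add: ldo_defs)

lemma Ldo_smult: "Ldo (smult a A) = cst a * Ldo A"
  by (simp add: ldo_defs op_mult_pCons)

lemma Ldo_eq_iff: "Ldo A = Ldo B \<longleftrightarrow> A = B"
  by (simp add: ldo_defs)

lemma Ldo_op_pow: "Ldo (op_pow A m) = Ldo A ^ m"
  by (induction m) (simp_all add: op_pow_def Ldo_1 Ldo_op_mult)

lemma Ldo_subst_dp: "Ldo (subst_dp P) = ysub P"
  by (simp add: subst_dp_def ysub_def Ldo_sum Ldo_smult Ldo_op_pow flip: dd_def)

lemma op_ord_eq_ord: "op_ord A = ord (Ldo A)"
  by (simp add: op_ord_def ord_def)

lemma lead_coeff_eq_lc: "lead_coeff A = lc (Ldo A)"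
  by (simp add: cf_def ord_def)

lemma right_divides_iff: "right_divides L M \<longleftrightarrow> Ldo M \<in> lid (Ldo L)"
proof
  assume "right_divides L M"
  then show "Ldo M \<in> lid (Ldo L)" by (auto simp: right_divides_def Ldo_op_mult intro: lidI)
next
  assume "Ldo M \<in> lid (Ldo L)"
  then obtain q where "Ldo M = q * Ldo L" by (rule lidE)
  then have "Ldo M = Ldo (rep_ldo q \<odot> L)" by (simp add: Ldo_op_mult)
  then show "right_divides L M" by (auto simp: right_divides_def Ldo_eq_iff)
qed

lemma decomposable_imp_ldecomp:
  assumes "decomposable A"
  shows "ldecomp (Ldo A)"
proof -
  obtain L1 L2 where c: "op_coprime L1 L2" and o: "op_ord L1 > 0" "op_ord L2 > 0"
    and l: "is_lclm A [L1, L2]" using assms by (auto simp: decomposable_def)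
  obtain C D where "C \<odot> L1 + D \<odot> L2 = 1" using c by (auto simp: op_coprime_def)
  then have "Ldo C * Ldo L1 + Ldo D * Ldo L2 = 1" by (metis Ldo_1 Ldo_add Ldo_op_mult)
  moreover have "M \<in> lid (Ldo A) \<longleftrightarrow> M \<in> lid (Ldo L1) \<and> M \<in> lid (Ldo L2)" for M
    using l[unfolded is_lclm_def, rule_format, of "rep_ldo M"] by (simp add: right_divides_iff)
  ultimately show ?thesis using o unfolding ldecomp_def op_ord_eq_ord by blast
qed

lemma ysub_monom: "ysub (monom a j) = cst a * dd ^ (j * CHAR('a))" for a :: "'a::{finite,field} ratfun"
proof -
  have "ysub (monom a j) = (\<Sum>k\<le>j. cst (coeff (monom a j) k) * dd ^ (k * CHAR('a)))"
    by (rule ysub_eq_sum) (rule degree_monom_le)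
  also have "\<dots> = (\<Sum>k\<le>j. if k = j then cst a * dd ^ (k * CHAR('a)) else 0)"
    by (rule sum.cong) auto
  finally show ?thesis by simp
qed

lemma op_rmod_cong:
  assumes "L \<noteq> 0"
  shows "Ldo M - Ldo (op_rmod M L) \<in> lid (Ldo L)" "op_rmod M L \<in> DL L"
proof -
  have "Ldo L \<noteq> 0" using assms by (metis Ldo_0 Ldo_eq_iff)
  then obtain r where r: "Ldo M - r \<in> lid (Ldo L)" "r = 0 \<or> ord r < ord (Ldo L)"
    by (rule right_division)
  obtain q where q: "Ldo M - r = q * Ldo L" using r(1) by (rule lidE)
  then have "Ldo M = Ldo (rep_ldo q \<odot> L + rep_ldo r)" by (simp add: Ldo_add Ldo_op_mult diff_eq_eq)
  then have "\<exists>Q. M = Q \<odot> L + rep_ldo r" by (auto simp: Ldo_eq_iff)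
  moreover have "rep_ldo r = 0 \<or> degree (rep_ldo r) < degree L"
    using r(2) by (auto simp: ord_def rep_ldo_ops)
  ultimately have ex: "\<exists>R. (\<exists>Q. M = Q \<odot> L + R) \<and> (R = 0 \<or> degree R < degree L)" by blast
  have *: "(\<exists>Q. M = Q \<odot> L + op_rmod M L) \<and> (op_rmod M L = 0 \<or> degree (op_rmod M L) < degree L)"
    unfolding op_rmod_def by (rule someI_ex[OF ex])
  then obtain Q where "M = Q \<odot> L + op_rmod M L" by blast
  then have "Ldo M - Ldo (op_rmod M L) = Ldo Q * Ldo L" by (metis Ldo_add Ldo_op_mult add_diff_cancel_right')
  then show "Ldo M - Ldo (op_rmod M L) \<in> lid (Ldo L)" by (rule lidI)
  show "op_rmod M L \<in> DL L" using * by (simp add: DL_def)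
qed

lemma funpow_pcurv_cong:
  fixes L :: "'a::{finite,field} diffop"
  assumes "L \<noteq> 0"
  shows "Ldo ((pcurv L ^^ j) v) - dd ^ (j * CHAR('a)) * Ldo v \<in> lid (Ldo L)"
proof (induction j)
  case (Suc j)
  define u where "u = (pcurv L ^^ j) v"
  have "yy * Ldo u - Ldo (pcurv L u) \<in> lid (Ldo L)"
    using op_rmod_cong(1)[OF assms, of "op_pow partial CHAR('a) \<odot> u"]
    by (simp add: pcurv_def Ldo_op_mult Ldo_op_pow yy_def flip: dd_def)
  then have "yy * (Ldo u - dd ^ (j * CHAR('a)) * Ldo v) - (yy * Ldo u - Ldo (pcurv L u)) \<in> lid (Ldo L)"
    using Suc unfolding u_def by (rule lid_diff[OF lid_mult, rotated])
  also have "yy * (Ldo u - dd ^ (j * CHAR('a)) * Ldo v) - (yy * Ldo u - Ldo (pcurv L u))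
      = Ldo ((pcurv L ^^ Suc j) v) - dd ^ (Suc j * CHAR('a)) * Ldo v"
    by (simp add: u_def yy_def right_diff_distrib power_add mult.assoc)
  finally show ?case .
qed simp

lemma funpow_pcurv_DL:
  assumes "L \<noteq> 0" "v \<in> DL L"
  shows "(pcurv L ^^ j) v \<in> DL L"
  by (induction j) (simp_all add: assms pcurv_def op_rmod_cong(2))

lemma DL_add: "A \<in> DL L \<Longrightarrow> B \<in> DL L \<Longrightarrow> A + B \<in> DL L"
  unfolding DL_def using degree_add_less by fastforce

lemma DL_smult: "A \<in> DL L \<Longrightarrow> smult a A \<in> DL L"
  unfolding DL_def by (auto intro: le_less_trans[OF degree_smult_le])

lemma DL_sum: "(\<And>i. i \<in> I \<Longrightarrow> f i \<in> DL L) \<Longrightarrow> sum f I \<in> DL L"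
proof (induction I rule: infinite_finite_induct)
  case (insert x F)
  then show ?case by (simp add: DL_add)
qed (simp_all add: DL_def)

lemma DL_lid_eq_0:
  assumes "A \<in> DL L" "Ldo A \<in> lid (Ldo L)"
  shows "A = 0"
proof (rule ccontr)
  assume "A \<noteq> 0"
  then have "ord (Ldo A) < ord (Ldo L)" using assms(1) by (auto simp: DL_def ord_def)
  then have "Ldo A = 0" using assms(2) lid_ord_less by blast
  then show False using \<open>A \<noteq> 0\<close> by (metis Ldo_0 Ldo_eq_iff)
qed

lemma poly_act_cong:
  assumes "L \<noteq> 0"
  shows "Ldo (poly_act L P v) - ysub P * Ldo v \<in> lid (Ldo L)"
proof -
  have "(\<Sum>k\<le>degree P. cst (coeff P k) * (Ldo ((pcurv L ^^ k) v) - dd ^ (k * CHAR('a)) * Ldo v)) \<in> lid (Ldo L)"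
    by (rule lid_sum[OF lid_mult[OF funpow_pcurv_cong[OF assms]]])
  then show ?thesis
    by (simp add: poly_act_def ysub_def Ldo_sum Ldo_smult right_diff_distrib sum_subtractf
        sum_distrib_right mult.assoc)
qed

lemma double_sum_cong:
  fixes L :: "'a::{finite,field} diffop"
  assumes "L \<noteq> 0"
  shows "Ldo (\<Sum>i<r. \<Sum>j<e i. smult (c i j) ((pcurv L ^^ j) (vs ! i)))
    - (\<Sum>i<r. ysub (\<Sum>j<e i. monom (c i j) j) * Ldo (vs ! i)) \<in> lid (Ldo L)"
proof -
  have "(\<Sum>i<r. \<Sum>j<e i. cst (c i j) * (Ldo ((pcurv L ^^ j) (vs ! i)) - dd ^ (j * CHAR('a)) * Ldo (vs ! i)))
      \<in> lid (Ldo L)"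
    by (rule lid_sum[OF lid_sum[OF lid_mult[OF funpow_pcurv_cong[OF assms]]]])
  then show ?thesis
    by (simp add: Ldo_sum Ldo_smult ysub_sum ysub_monom right_diff_distrib sum_subtractf
        sum_distrib_right mult.assoc)
qed

context separable_irreducible
begin

text \<open>Existence of K-coordinates in the vectors \<psi>^j v_i gives generation over K[Y].
  Uniqueness gives independence, after reducing each coefficient modulo Ne^(\<nu>_i) so that its
  degree fits the range of j.\<close>

lemma frobenius_invariants_cyclic_basis:
  assumes L: "L \<noteq> 0" and fro: "frobenius_invariants L (map (\<lambda>k. Ne ^ k) \<nu>s)"
  shows "(\<forall>i<length \<nu>s. \<nu>s ! i > 0) \<and> (\<exists>v. cyclic_basis (Ldo L) (length \<nu>s) (\<lambda>i. \<nu>s ! i) v)"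
proof -
  define r where "r = length \<nu>s"
  define e where "e = (\<lambda>i. \<nu>s ! i * d)"
  define Ps where "Ps = map (\<lambda>k. Ne ^ k) \<nu>s"
  have len: "length Ps = r" by (simp add: Ps_def r_def)
  have nth: "Ps ! i = Ne ^ (\<nu>s ! i)" and deg: "degree (Ps ! i) = e i" if "i < r" for i
    using that by (simp_all add: Ps_def r_def e_def)
  have "\<forall>P\<in>set Ps. degree P > 0"
    using fro unfolding frobenius_invariants_def Ps_def by blast
  then have pos: "\<nu>s ! i > 0" if "i < r" for i
    using that nth_mem[of i \<nu>s] by (auto simp: r_def Ps_def)
  obtain vs where vs0: "\<forall>i<length Ps. vs ! i \<in> DL L \<and> poly_act L (Ps ! i) (vs ! i) = 0"
    and uniq0: "\<forall>w\<in>DL L. \<exists>!c. (\<forall>i j. \<not> (i < length Ps \<and> j < degree (Ps ! i)) \<longrightarrow> c i j = 0) \<and>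
       w = (\<Sum>i<length Ps. \<Sum>j<degree (Ps ! i). smult (c i j) ((pcurv L ^^ j) (vs ! i)))"
    using fro unfolding frobenius_invariants_def Ps_def[symmetric] by blast
  have vs: "vs ! i \<in> DL L" "poly_act L (Ne ^ (\<nu>s ! i)) (vs ! i) = 0" if "i < r" for i
    using vs0 that by (simp_all add: len nth)
  note uniq = bspec[OF uniq0[unfolded len]]
  define v where "v = (\<lambda>i. Ldo (vs ! i))"
  have ann: "n ^ (\<nu>s ! i) * v i \<in> lid (Ldo L)" if "i < r" for i
  proof -
    have "Ldo 0 - ysub (Ne ^ (\<nu>s ! i)) * v i \<in> lid (Ldo L)"
      using poly_act_cong[OF L, of "Ne ^ (\<nu>s ! i)" "vs ! i"] vs(2)[OF that] by (simp add: v_def)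
    then have "- (Ldo 0 - ysub (Ne ^ (\<nu>s ! i)) * v i) \<in> lid (Ldo L)" by (rule lid_uminus)
    then show ?thesis by (simp add: Ldo_0 n_def ysub_power)
  qed
  have dsum: "(\<Sum>i<r. \<Sum>j<degree (Ps ! i). smult (c i j) ((pcurv L ^^ j) (vs ! i)))
      = (\<Sum>i<r. \<Sum>j<e i. smult (c i j) ((pcurv L ^^ j) (vs ! i)))" for c
    by (rule sum.cong) (auto simp: deg)
  have gen: "\<exists>P. w - (\<Sum>i<r. ysub (P i) * v i) \<in> lid (Ldo L)" for w
  proof -
    define R where "R = op_rmod (rep_ldo w) L"
    have R: "w - Ldo R \<in> lid (Ldo L)" "R \<in> DL L"
      using op_rmod_cong[OF L, of "rep_ldo w"] by (simp_all add: R_def)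
    obtain c where c: "R = (\<Sum>i<r. \<Sum>j<e i. smult (c i j) ((pcurv L ^^ j) (vs ! i)))"
      using uniq[OF R(2)] unfolding dsum by blast
    define P where "P = (\<lambda>i. \<Sum>j<e i. monom (c i j) j)"
    have "Ldo R - (\<Sum>i<r. ysub (P i) * v i) \<in> lid (Ldo L)"
      unfolding c P_def v_def by (rule double_sum_cong[OF L])
    then have "(w - Ldo R) + (Ldo R - (\<Sum>i<r. ysub (P i) * v i)) \<in> lid (Ldo L)"
      by (rule lid_add[OF R(1)])
    then have "w - (\<Sum>i<r. ysub (P i) * v i) \<in> lid (Ldo L)" by simp
    then show ?thesis by blast
  qed
  have dir: "\<forall>i<r. Ne ^ (\<nu>s ! i) dvd P i" if P: "(\<Sum>i<r. ysub (P i) * v i) \<in> lid (Ldo L)" for P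
  proof -
    define R where "R = (\<lambda>i. P i mod Ne ^ (\<nu>s ! i))"
    \<comment> \<open>Extended by 0 because the uniqueness in \<open>frobenius_invariants\<close> is
      among functions vanishing outside the index range.\<close>
    define c where "c = (\<lambda>i j. if i < r \<and> j < e i then coeff (R i) j else 0)"
    have "R i = 0 \<or> degree (R i) < e i" for i
      using degree_mod_less[of "Ne ^ (\<nu>s ! i)" "P i"] by (simp add: R_def e_def)
    then have Rsum: "R i = (\<Sum>j<e i. monom (coeff (R i) j) j)" for i
      by (rule poly_eq_sum_monom_less)
    have Rc: "(\<Sum>j<e i. monom (c i j) j) = R i" if "i < r" for i
    proof -
      have "(\<Sum>j<e i. monom (c i j) j) = (\<Sum>j<e i. monom (coeff (R i) j) j)"
        by (rule sum.cong) (auto simp: c_def that)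
      then show ?thesis using Rsum[of i] by (rule trans[OF _ sym])
    qed
    have "ysub (P i - R i) * v i \<in> lid (Ldo L)" if "i < r" for i
    proof (rule ysub_mult_in_lid[OF _ ann[OF that]])
      show "Ne ^ (\<nu>s ! i) dvd P i - R i" unfolding R_def by (simp add: minus_mod_eq_div_mult)
    qed
    then have "(\<Sum>i<r. ysub (P i - R i) * v i) \<in> lid (Ldo L)" by (intro lid_sum) auto
    then have "(\<Sum>i<r. ysub (P i) * v i) - (\<Sum>i<r. ysub (P i - R i) * v i) \<in> lid (Ldo L)"
      by (rule lid_diff[OF P])
    then have "(\<Sum>i<r. ysub (R i) * v i) \<in> lid (Ldo L)"
      by (simp add: ysub_diff left_diff_distrib sum_subtractf)
    also have "(\<Sum>i<r. ysub (R i) * v i) = (\<Sum>i<r. ysub (\<Sum>j<e i. monom (c i j) j) * v i)"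
      by (rule sum.cong) (auto simp: Rc)
    finally have S: "(\<Sum>i<r. ysub (\<Sum>j<e i. monom (c i j) j) * v i) \<in> lid (Ldo L)" .
    define W where "W = (\<Sum>i<r. \<Sum>j<e i. smult (c i j) ((pcurv L ^^ j) (vs ! i)))"
    have "Ldo W - (\<Sum>i<r. ysub (\<Sum>j<e i. monom (c i j) j) * v i) \<in> lid (Ldo L)"
      unfolding W_def v_def by (rule double_sum_cong[OF L])
    then have "Ldo W \<in> lid (Ldo L)" using S by (simp only: lid_cong)
    moreover have "W \<in> DL L" unfolding W_def
      using vs(1) by (intro DL_sum DL_smult funpow_pcurv_DL[OF L]) auto
    ultimately have W0: "0 = W" using DL_lid_eq_0 by metis
    \<comment> \<open>Both \<open>c\<close> and the zero function are coordinates of the zero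
      vector.\<close>
    have "c = (\<lambda>i j. 0)"
    proof (rule ex1E[OF uniq[of 0]])
      show "0 \<in> DL L" by (simp add: DL_def)
      fix c' assume all: "\<forall>y. (\<forall>i j. \<not> (i < r \<and> j < degree (Ps ! i)) \<longrightarrow> y i j = 0) \<and>
        0 = (\<Sum>i<r. \<Sum>j<degree (Ps ! i). smult (y i j) ((pcurv L ^^ j) (vs ! i))) \<longrightarrow> y = c'"
      have "c = c'"
        using W0 unfolding W_def
        by (intro all[rule_format] conjI allI impI) (auto simp: c_def dsum deg)
      moreover have "(\<lambda>i j. 0) = c'" by (intro all[rule_format] conjI allI impI) auto
      ultimately show "c = (\<lambda>i j. 0)" by simp
    qed
    then have "R i = 0" if "i < r" for i using Rc[OF that] by simp
    then show ?thesis by (simp add: R_def mod_eq_0_iff_dvd)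
  qed
  have "cyclic_basis (Ldo L) r (\<lambda>i. \<nu>s ! i) v"
    unfolding cyclic_basis_def using ann gen dir by blast
  then show ?thesis using pos by (auto simp: r_def)
qed

end

theorem mainTheorem5:
  fixes N :: "'a::{finite,field} ratfun poly"   \<comment> \<open>N in F_q(s)[Y], with s = t^p\<close>
    and \<nu> :: nat and L :: "'a diffop"
  defines "Ne \<equiv> map_poly frob_emb N"            \<comment> \<open>N viewed in F_q(t^p)[Y] \<subseteq> F_q(t)[Y]\<close>
  assumes monicN: "lead_coeff N = 1"
    and irrN: "irreducible N"
    and sepN: "coprime N (pderiv N)"
    and monicL: "lead_coeff L = 1"
    and divL: "right_divides L (op_pow (subst_dp Ne) \<nu>)"
  shows "(op_irreducible (subst_dp Ne) \<longrightarrow>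
            (\<exists>m\<le>\<nu>. L = op_pow (subst_dp Ne) m) \<and> indecomposable L)
       \<and> (\<not> op_irreducible (subst_dp Ne) \<longrightarrow>
            (\<forall>\<nu>s :: nat list. frobenius_invariants L (map (\<lambda>k. Ne ^ k) \<nu>s) \<longrightarrow>
               (\<exists>Ls :: 'a diffop list. length Ls = length \<nu>s \<and>
                  is_lclm L Ls \<and> op_ord L = (\<Sum>Li\<leftarrow>Ls. op_ord Li) \<and>
                  (\<forall>i<length \<nu>s. op_ord (Ls ! i) = \<nu>s ! i * degree N) \<and>
                  (\<forall>Li\<in>set Ls. indecomposable Li))))"
proof -
  interpret S: separable_irreducible N
    using monicN irrN sepN by unfold_locales
  have Ne: "S.Ne = Ne" by (simp add: S.Ne_def Ne_def)
  have n: "Ldo (subst_dp Ne) = S.n" by (simp add: Ldo_subst_dp S.n_def Ne)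
  have div: "S.n ^ \<nu> \<in> lid (Ldo L)" using divL by (simp add: right_divides_iff Ldo_op_pow n)
  have lcL: "lc (Ldo L) = 1" using monicL by (simp add: lead_coeff_eq_lc)
  have L0: "L \<noteq> 0" using monicL by auto
  then have L0': "Ldo L \<noteq> 0" by (metis Ldo_0 Ldo_eq_iff)
  show ?thesis
  proof (intro conjI impI allI)
    assume irr: "op_irreducible (subst_dp Ne)"
    have "ord x = 0 \<or> ord y = 0" if xy: "S.n = x * y" for x y
    proof -
      have "Ldo (subst_dp Ne) = Ldo (rep_ldo x \<odot> rep_ldo y)" unfolding n xy by (simp add: Ldo_op_mult)
      then have e: "subst_dp Ne = rep_ldo x \<odot> rep_ldo y" by (simp only: Ldo_eq_iff)
      have irr': "\<And>A B. subst_dp Ne = A \<odot> B \<Longrightarrow> op_ord A = 0 \<or> op_ord B = 0"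
        using irr by (simp add: op_irreducible_def)
      have "op_ord (rep_ldo x) = 0 \<or> op_ord (rep_ldo y) = 0" by (rule irr'[OF e])
      then show ?thesis by (simp add: op_ord_eq_ord)
    qed
    from S.irreducible_case[OF this div lcL]
    obtain m where m: "m \<le> \<nu>" "Ldo L = S.n ^ m" and nd: "\<not> ldecomp (Ldo L)" by blast
    have "Ldo L = Ldo (op_pow (subst_dp Ne) m)" by (simp add: Ldo_op_pow n m(2))
    then show "\<exists>m\<le>\<nu>. L = op_pow (subst_dp Ne) m" using m(1) by (auto simp: Ldo_eq_iff)
    show "indecomposable L" using nd decomposable_imp_ldecomp unfolding indecomposable_def by blast
  next
    fix \<nu>s :: "nat list"
    assume red: "\<not> op_irreducible (subst_dp Ne)" and fro: "frobenius_invariants L (map (\<lambda>k. Ne ^ k) \<nu>s)"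
    define r where "r = length \<nu>s"
    have "subst_dp Ne \<noteq> 0" using n by (metis Ldo_0 S.n_nonzero)
    moreover have "op_ord (subst_dp Ne) > 0" using S.ord_n_pos by (simp add: op_ord_eq_ord n)
    ultimately obtain A B where AB: "subst_dp Ne = A \<odot> B" "op_ord A \<noteq> 0" "op_ord B \<noteq> 0"
      using red by (auto simp: op_irreducible_def)
    have nAB: "S.n = Ldo A * Ldo B" "ord (Ldo A) \<noteq> 0" "ord (Ldo B) \<noteq> 0"
      using AB n by (simp_all add: Ldo_op_mult op_ord_eq_ord)
    obtain v where pos: "\<And>i. i < r \<Longrightarrow> \<nu>s ! i > 0" and v: "S.cyclic_basis (Ldo L) r (\<lambda>i. \<nu>s ! i) v"
      using S.frobenius_invariants_cyclic_basis[OF L0, of \<nu>s] fro unfolding Ne r_def by blast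
    obtain F where F: "\<And>i. i < r \<Longrightarrow> ord (F i) = \<nu>s ! i * S.d" "\<And>i. i < r \<Longrightarrow> \<not> ldecomp (F i)"
      "\<And>M. M \<in> lid (Ldo L) \<longleftrightarrow> (\<forall>i<r. M \<in> lid (F i))"
      using S.reducible_case[OF nAB L0' div v pos] by blast
    define Ls where "Ls = map (\<lambda>i. rep_ldo (F i)) [0..<r]"
    have "is_lclm L Ls"
      unfolding is_lclm_def right_divides_iff F(3) by (auto simp: Ls_def)
    moreover have "op_ord L = (\<Sum>Li\<leftarrow>Ls. op_ord Li)"
    proof -
      have "(\<Sum>Li\<leftarrow>Ls. op_ord Li) = (\<Sum>i<r. ord (F i))"
        by (simp add: Ls_def op_ord_eq_ord o_def interv_sum_list_conv_sum_set_nat atLeast0LessThan)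
      also have "\<dots> = (\<Sum>i<r. \<nu>s ! i * S.d)" by (rule sum.cong) (auto simp: F(1))
      finally show ?thesis
        using S.ord_eq_sum_cyclic_basis[OF L0' v] by (simp add: op_ord_eq_ord)
    qed
    moreover have "\<forall>i<length \<nu>s. op_ord (Ls ! i) = \<nu>s ! i * degree N"
      using F(1) by (simp add: Ls_def r_def op_ord_eq_ord S.d_def)
    moreover have "\<forall>Li\<in>set Ls. indecomposable Li"
      using F(2) decomposable_imp_ldecomp by (fastforce simp: Ls_def indecomposable_def)
    ultimately show "\<exists>Ls. length Ls = length \<nu>s \<and> is_lclm L Ls \<and> op_ord L = (\<Sum>Li\<leftarrow>Ls. op_ord Li) \<and>
        (\<forall>i<length \<nu>s. op_ord (Ls ! i) = \<nu>s ! i * degree N) \<and> (\<forall>Li\<in>set Ls. indecomposable Li)"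
      by (intro exI[of _ Ls]) (simp add: Ls_def r_def)
  qed
qed

end
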